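(* Let $G$ be a finite group, $K\le G$, $(\theta,V)$ an irreducible $K$-representation, $v\in V$ with $\|v\|=1$. The following conditions are equivalent: (a) the induced representation $\mathrm{Ind}_K^G\theta$ is multiplicity-free; (b) the Hecke algebra $\mathcal H(G,K,\psi)$ is commutative. Moreover, suppose one of these conditions holds and let $\mathrm{Ind}_K^GV=\bigoplus_{\sigma\in J}T_\sigma W_\sigma$ be an explicit multiplicity-free decomposition into irreducibles. For $f\in\mathcal H(G,K,\psi)$ let $T_f'$ be the restriction of $T_f:f'\mapsto f'*f$ to the invariant subspace $\mathcal I(G,K,\psi)$. Then $$\mathcal I(G,K,\psi)=\bigoplus_{\sigma\in J}T_v[T_\sigma W_\sigma]$$ is the decomposition of $\mathcal I(G,K,\psi)$ into $T_f'$-eigenspaces (that is, for every $f\in\mathcal H(G,K,\psi)$ and $\sigma\in J$, $T'_f$ acts on $T_v[T_\sigma W_\sigma]$ as a scalar). Also, if $\lambda_{\sigma,f}$ is the eigenvalue of $T_f'$ associated with $T_v[T_\sigma W_\sigma]$, then $f\mapsto(\lambda_{\sigma,f})_{\sigma\in J}$ is an algebra isomorphism from $\mathcal H(G,K,\psi)$ onto $\mathbb C^J$ (with pointwise operations). Finally, $$\dim\mathcal H(G,K,\psi)=|J|=\sum_{s\in\mathcal S}\dim\mathrm{Hom}_{K_s}(\mathrm{Res}^K_{K_s}\theta,\theta^s).$$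
   Context: Representations are unitary on finite-dimensional complex inner product spaces; inner products are conjugate-linear in the second argument. A representation is multiplicity-free if every irreducible representation occurs in it with multiplicity at most one. $L(G)$ is the group algebra of functions $G\to\mathbb C$ with $[f_1*f_2](g)=\sum_{h\in G}f_1(gh)f_2(h^{-1})$. $\mathrm{Ind}_K^GV=\{f:G\to V: f(gk)=\theta(k^{-1})f(g)\ \forall g\in G,k\in K\}$ with left translation action and inner product $\frac1{|K|}\sum_g\langle f_1(g),f_2(g)\rangle_V$. With $d_\theta=\dim V$, $\psi\in L(G)$ is $\psi(k)=\frac{d_\theta}{|K|}\langle v,\theta(k)v\rangle$ for $k\in K$ and $\psi(g)=0$ for $g\notin K$. $\mathcal H(G,K,\psi)=\{f\in L(G): f=\psi*f*\psi\}$, an algebra under convolution. $T_v:\mathrm{Ind}_K^GV\to L(G)$, $[T_vf](g)=\sqrt{d_\theta/|K|}\,\langle f(g),v\rangle$, and $\mathcal I(G,K,\psi)=T_v(\mathrm{Ind}_K^GV)=\{f\in L(G):f*\psi=f\}$. $J$ is a complete set of pairwise inequivalent irreducible $G$-representations contained in $\mathrm{Ind}_K^G\theta$; $W_\sigma$ is the space of $\sigma$. In the multiplicity-free case, an explicit decomposition means a choice of isometric intertwiners $T_\sigma\in\mathrm{Hom}_G(W_\sigma,\mathrm{Ind}_K^GV)$ with $\mathrm{Ind}_K^GV=\bigoplus_{\sigma\in J}T_\sigma W_\sigma$. $\mathcal S$ is a complete set of representatives for the double cosets $KsK$ in $G$; $K_s=K\cap sKs^{-1}$; $\theta^s$ is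 the $K_s$-representation on $V$ with $\theta^s(x)=\theta(s^{-1}xs)$. *)

theory Defs
  imports Complex_Main "HOL-Library.Function_Algebras" "HOL-Library.FuncSet" "HOL-Algebra.Coset"
begin

section \<open>Complex vector spaces\<close>

text \<open>
  The library has no type class of complex vector spaces, only the locale
  \<^locale>\<open>vector_space\<close>; the class below makes its notions (subspace, span, dimension) available
  for the type of complex numbers and for function types with pointwise operations.
\<close>

class complex_vector = ab_group_add +
  fixes scaleC :: "complex \<Rightarrow> 'a \<Rightarrow> 'a" (infixr "*\<^sub>C" 75)
  assumes scaleC_add_right: "a *\<^sub>C (x + y) = a *\<^sub>C x + a *\<^sub>C y"
    and scaleC_add_left: "(a + b) *\<^sub>C x = a *\<^sub>C x + b *\<^sub>C x"
    and scaleC_scaleC: "a *\<^sub>C b *\<^sub>C x = (a * b) *\<^sub>C x"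
    and scaleC_one: "1 *\<^sub>C x = x"

global_interpretation complex_vector: vector_space "scaleC :: complex \<Rightarrow> 'a \<Rightarrow> 'a::complex_vector"
  by unfold_locales (fact scaleC_add_right scaleC_add_left scaleC_scaleC scaleC_one)+

instantiation complex :: complex_vector
begin

definition scaleC_complex :: "complex \<Rightarrow> complex \<Rightarrow> complex" where
  "scaleC_complex c x = c * x"

instance
  by standard (simp_all add: scaleC_complex_def algebra_simps)

end

instantiation "fun" :: (type, complex_vector) complex_vector
begin

definition scaleC_fun :: "complex \<Rightarrow> ('a \<Rightarrow> 'b) \<Rightarrow> 'a \<Rightarrow> 'b" where
  "scaleC_fun c f = (\<lambda>x. c *\<^sub>C f x)"

instance
  by standard
    (simp_all add: fun_eq_iff scaleC_fun_def scaleC_add_right scaleC_add_left scaleC_scaleC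
      scaleC_one)

end

text \<open>
  Linearity of a map on a subspace of the ambient type; nothing is said off that subspace.
\<close>

definition clinear_on :: "'v::complex_vector set \<Rightarrow> ('v \<Rightarrow> 'w::complex_vector) \<Rightarrow> bool" where
  "clinear_on V f \<longleftrightarrow>
    (\<forall>x\<in>V. \<forall>y\<in>V. f (x + y) = f x + f y) \<and> (\<forall>c. \<forall>x\<in>V. f (c *\<^sub>C x) = c *\<^sub>C f x)"

definition fd_inner_product_space :: "'v::complex_vector set \<Rightarrow> ('v \<Rightarrow> 'v \<Rightarrow> complex) \<Rightarrow> bool" where
  "fd_inner_product_space V ip \<longleftrightarrow>
    complex_vector.subspace V \<and>
    (\<exists>B. finite B \<and> V = complex_vector.span B) \<and>
    (\<forall>y\<in>V. clinear_on V (\<lambda>x. ip x y)) \<and>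
    (\<forall>x\<in>V. \<forall>y\<in>V. ip y x = cnj (ip x y)) \<and>
    (\<forall>x\<in>V. x \<noteq> 0 \<longrightarrow> 0 < Re (ip x x))"

definition internal_direct_sum ::
    "'v::complex_vector set \<Rightarrow> 'i set \<Rightarrow> ('i \<Rightarrow> 'v set) \<Rightarrow> bool" where
  "internal_direct_sum X I U \<longleftrightarrow>
    finite I \<and> (\<forall>i\<in>I. complex_vector.subspace (U i)) \<and>
    X = {(\<Sum>i\<in>I. u i) |u. \<forall>i\<in>I. u i \<in> U i} \<and>
    (\<forall>u. (\<forall>i\<in>I. u i \<in> U i) \<and> (\<Sum>i\<in>I. u i) = 0 \<longrightarrow> (\<forall>i\<in>I. u i = 0))"

text \<open>
  The algebra of complex functions on a set \<open>A\<close>, realised as functions on the ambient type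
  that vanish off \<open>A\<close>, so that it is a subspace of a function type.
\<close>

definition functions_on :: "'a set \<Rightarrow> ('a \<Rightarrow> complex) set" where
  "functions_on A = {f. \<forall>x. x \<notin> A \<longrightarrow> f x = 0}"

definition algebra_isomorphism ::
    "'a::complex_vector set \<Rightarrow> ('a \<Rightarrow> 'a \<Rightarrow> 'a) \<Rightarrow>
     'b::complex_vector set \<Rightarrow> ('b \<Rightarrow> 'b \<Rightarrow> 'b) \<Rightarrow> ('a \<Rightarrow> 'b) \<Rightarrow> bool" where
  "algebra_isomorphism A mulA B mulB \<phi> \<longleftrightarrow>
    complex_vector.subspace A \<and> (\<forall>x\<in>A. \<forall>y\<in>A. mulA x y \<in> A) \<and>
    complex_vector.subspace B \<and> (\<forall>x\<in>B. \<forall>y\<in>B. mulB x y \<in> B) \<and>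
    clinear_on A \<phi> \<and> (\<forall>x\<in>A. \<forall>y\<in>A. \<phi> (mulA x y) = mulB (\<phi> x) (\<phi> y)) \<and>
    bij_betw \<phi> A B"

definition eigenvalue_on ::
    "('v::complex_vector \<Rightarrow> 'v) \<Rightarrow> 'v set \<Rightarrow> complex \<Rightarrow> bool" where
  "eigenvalue_on A U c \<longleftrightarrow> U \<noteq> {0} \<and> (\<forall>x\<in>U. A x = c *\<^sub>C x)"


section \<open>Unitary representations\<close>

text \<open>
  The space of a representation is a subspace of an ambient type, so that representations on
  different spaces can be collected in one set. The action is only relevant for group
  elements and for vectors of the space. The same record serves as a representation of any
  subgroup: restriction leaves the record unchanged.
\<close>

record ('g, 'v) urep =
  rspace :: "'v set"
  rinner :: "'v \<Rightarrow> 'v \<Rightarrow> complex"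
  ract :: "'g \<Rightarrow> 'v \<Rightarrow> 'v"

definition rnorm :: "('g, 'v) urep \<Rightarrow> 'v \<Rightarrow> real" where
  "rnorm \<rho> x = sqrt (Re (rinner \<rho> x x))"

definition unitary_rep :: "('g, 'm) monoid_scheme \<Rightarrow> ('g, 'v::complex_vector) urep \<Rightarrow> bool" where
  "unitary_rep G \<rho> \<longleftrightarrow>
    fd_inner_product_space (rspace \<rho>) (rinner \<rho>) \<and>
    (\<forall>g\<in>carrier G. ract \<rho> g \<in> rspace \<rho> \<rightarrow> rspace \<rho> \<and> clinear_on (rspace \<rho>) (ract \<rho> g)) \<and>
    (\<forall>x\<in>rspace \<rho>. ract \<rho> \<one>\<^bsub>G\<^esub> x = x) \<and>
    (\<forall>g\<in>carrier G. \<forall>h\<in>carrier G. \<forall>x\<in>rspace \<rho>.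
      ract \<rho> (g \<otimes>\<^bsub>G\<^esub> h) x = ract \<rho> g (ract \<rho> h x)) \<and>
    (\<forall>g\<in>carrier G. \<forall>x\<in>rspace \<rho>. \<forall>y\<in>rspace \<rho>.
      rinner \<rho> (ract \<rho> g x) (ract \<rho> g y) = rinner \<rho> x y)"

definition invariant_subspace ::
    "('g, 'm) monoid_scheme \<Rightarrow> ('g, 'v::complex_vector) urep \<Rightarrow> 'v set \<Rightarrow> bool" where
  "invariant_subspace G \<rho> U \<longleftrightarrow>
    complex_vector.subspace U \<and> U \<subseteq> rspace \<rho> \<and> (\<forall>g\<in>carrier G. ract \<rho> g \<in> U \<rightarrow> U)"

definition irreducible_rep ::
    "('g, 'm) monoid_scheme \<Rightarrow> ('g, 'v::complex_vector) urep \<Rightarrow> bool" where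
  "irreducible_rep G \<rho> \<longleftrightarrow>
    unitary_rep G \<rho> \<and> rspace \<rho> \<noteq> {0} \<and>
    (\<forall>U. invariant_subspace G \<rho> U \<longrightarrow> U = {0} \<or> U = rspace \<rho>)"

text \<open>
  Intertwiners are normalised to be zero off the space of \<open>\<sigma>\<close>. Thus each linear map between
  the spaces is represented by exactly one function, and the dimension of \<open>rep_Hom\<close> as a
  subspace of the function type is the dimension of the space of intertwiners.
\<close>

definition rep_Hom ::
    "('g, 'm) monoid_scheme \<Rightarrow> ('g, 'w::complex_vector) urep \<Rightarrow> ('g, 'v::complex_vector) urep \<Rightarrow>
     ('w \<Rightarrow> 'v) set" where
  "rep_Hom G \<sigma> \<rho> =
    {T. T \<in> rspace \<sigma> \<rightarrow> rspace \<rho> \<and> clinear_on (rspace \<sigma>) T \<and> (\<forall>x. x \<notin> rspace \<sigma> \<longrightarrow> T x = 0) \<and>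
        (\<forall>g\<in>carrier G. \<forall>x\<in>rspace \<sigma>. T (ract \<sigma> g x) = ract \<rho> g (T x))}"

definition equivalent_rep ::
    "('g, 'm) monoid_scheme \<Rightarrow> ('g, 'w::complex_vector) urep \<Rightarrow> ('g, 'v::complex_vector) urep \<Rightarrow>
     bool" where
  "equivalent_rep G \<sigma> \<rho> \<longleftrightarrow> (\<exists>T\<in>rep_Hom G \<sigma> \<rho>. bij_betw T (rspace \<sigma>) (rspace \<rho>))"

definition contained_rep ::
    "('g, 'm) monoid_scheme \<Rightarrow> ('g, 'w::complex_vector) urep \<Rightarrow> ('g, 'v::complex_vector) urep \<Rightarrow>
     bool" where
  "contained_rep G \<sigma> \<rho> \<longleftrightarrow>
    (\<exists>U. invariant_subspace G \<rho> U \<and> equivalent_rep G \<sigma> (\<rho>\<lparr>rspace := U\<rparr>))"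

definition rep_multiplicity ::
    "('g, 'm) monoid_scheme \<Rightarrow> ('g, 'w::complex_vector) urep \<Rightarrow> ('g, 'v::complex_vector) urep \<Rightarrow>
     nat" where
  "rep_multiplicity G \<sigma> \<rho> = complex_vector.dim (rep_Hom G \<sigma> \<rho>)"

text \<open>
  The bound variable \<open>\<sigma>\<close> ranges over representations whose spaces lie in the same type as that
  of \<open>\<rho>\<close>. No irreducible representation is missed: one that occurs in \<open>\<rho>\<close> at all is
  equivalent to the restriction of \<open>\<rho>\<close> to an invariant subspace. The same remark applies to
  the completeness clause of \<open>complete_constituents\<close>.
\<close>

definition multiplicity_free ::
    "('g, 'm) monoid_scheme \<Rightarrow> ('g, 'v::complex_vector) urep \<Rightarrow> bool" where
  "multiplicity_free G \<rho> \<longleftrightarrow>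
    (\<forall>\<sigma> :: ('g, 'v) urep. irreducible_rep G \<sigma> \<longrightarrow> rep_multiplicity G \<sigma> \<rho> \<le> 1)"

definition complete_constituents ::
    "('g, 'm) monoid_scheme \<Rightarrow> ('g, 'v::complex_vector) urep \<Rightarrow> ('g, 'w::complex_vector) urep set \<Rightarrow>
     bool" where
  "complete_constituents G \<rho> J \<longleftrightarrow>
    (\<forall>\<sigma>\<in>J. irreducible_rep G \<sigma> \<and> contained_rep G \<sigma> \<rho>) \<and>
    (\<forall>\<sigma>\<in>J. \<forall>\<tau>\<in>J. \<sigma> \<noteq> \<tau> \<longrightarrow> \<not> equivalent_rep G \<sigma> \<tau>) \<and>
    (\<forall>\<pi> :: ('g, 'v) urep. irreducible_rep G \<pi> \<and> contained_rep G \<pi> \<rho> \<longrightarrow>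
      (\<exists>\<sigma>\<in>J. equivalent_rep G \<pi> \<sigma>))"

definition explicit_decomposition ::
    "('g, 'm) monoid_scheme \<Rightarrow> ('g, 'v::complex_vector) urep \<Rightarrow> ('g, 'w::complex_vector) urep set \<Rightarrow>
     (('g, 'w) urep \<Rightarrow> 'w \<Rightarrow> 'v) \<Rightarrow> bool" where
  "explicit_decomposition G \<rho> J T \<longleftrightarrow>
    (\<forall>\<sigma>\<in>J. T \<sigma> \<in> rep_Hom G \<sigma> \<rho> \<and>
      (\<forall>x\<in>rspace \<sigma>. \<forall>y\<in>rspace \<sigma>. rinner \<rho> (T \<sigma> x) (T \<sigma> y) = rinner \<sigma> x y)) \<and>
    internal_direct_sum (rspace \<rho>) J (\<lambda>\<sigma>. T \<sigma> ` rspace \<sigma>)"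


section \<open>Induced representations and Hecke algebras\<close>

definition ind_rep ::
    "('g, 'm) monoid_scheme \<Rightarrow> 'g set \<Rightarrow> ('g, 'v::complex_vector) urep \<Rightarrow> ('g, 'g \<Rightarrow> 'v) urep" where
  "ind_rep G K \<theta> =
    \<lparr>rspace = {f. (\<forall>g\<in>carrier G. f g \<in> rspace \<theta>) \<and> (\<forall>g. g \<notin> carrier G \<longrightarrow> f g = 0) \<and>
        (\<forall>g\<in>carrier G. \<forall>k\<in>K. f (g \<otimes>\<^bsub>G\<^esub> k) = ract \<theta> (inv\<^bsub>G\<^esub> k) (f g))},
     rinner = (\<lambda>f1 f2. 1 / of_nat (card K) * (\<Sum>g\<in>carrier G. rinner \<theta> (f1 g) (f2 g))),
     ract = (\<lambda>g f x. if x \<in> carrier G then f (inv\<^bsub>G\<^esub> g \<otimes>\<^bsub>G\<^esub> x) else 0)\<rparr>"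

definition gconv ::
    "('g, 'm) monoid_scheme \<Rightarrow> ('g \<Rightarrow> complex) \<Rightarrow> ('g \<Rightarrow> complex) \<Rightarrow> 'g \<Rightarrow> complex" where
  "gconv G f1 f2 =
    (\<lambda>g. if g \<in> carrier G then \<Sum>h\<in>carrier G. f1 (g \<otimes>\<^bsub>G\<^esub> h) * f2 (inv\<^bsub>G\<^esub> h) else 0)"

definition hecke_psi :: "'g set \<Rightarrow> ('g, 'v::complex_vector) urep \<Rightarrow> 'v \<Rightarrow> 'g \<Rightarrow> complex" where
  "hecke_psi K \<theta> v =
    (\<lambda>g. if g \<in> K
         then of_nat (complex_vector.dim (rspace \<theta>)) / of_nat (card K) * rinner \<theta> v (ract \<theta> g v)
         else 0)"

definition hecke_algebra ::
    "('g, 'm) monoid_scheme \<Rightarrow> 'g set \<Rightarrow> ('g \<Rightarrow> complex) \<Rightarrow> ('g \<Rightarrow> complex) set" where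
  "hecke_algebra G K \<psi> =
    {f \<in> functions_on (carrier G). f = gconv G (gconv G \<psi> f) \<psi>}"

definition commutative_on :: "('a \<Rightarrow> 'a \<Rightarrow> 'a) \<Rightarrow> 'a set \<Rightarrow> bool" where
  "commutative_on mul A \<longleftrightarrow> (\<forall>x\<in>A. \<forall>y\<in>A. mul x y = mul y x)"

definition T_vec ::
    "('g, 'm) monoid_scheme \<Rightarrow> 'g set \<Rightarrow> ('g, 'v::complex_vector) urep \<Rightarrow> 'v \<Rightarrow>
     ('g \<Rightarrow> 'v) \<Rightarrow> 'g \<Rightarrow> complex" where
  "T_vec G K \<theta> v f =
    (\<lambda>g. if g \<in> carrier G
         then of_real (sqrt (real (complex_vector.dim (rspace \<theta>)) / real (card K)))
              * rinner \<theta> (f g) v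
         else 0)"

definition I_space ::
    "('g, 'm) monoid_scheme \<Rightarrow> 'g set \<Rightarrow> ('g, 'v::complex_vector) urep \<Rightarrow> 'v \<Rightarrow>
     ('g \<Rightarrow> complex) set" where
  "I_space G K \<theta> v = T_vec G K \<theta> v ` rspace (ind_rep G K \<theta>)"

definition T_conv ::
    "('g, 'm) monoid_scheme \<Rightarrow> 'g set \<Rightarrow> ('g, 'v::complex_vector) urep \<Rightarrow> 'v \<Rightarrow>
     ('g \<Rightarrow> complex) \<Rightarrow> ('g \<Rightarrow> complex) \<Rightarrow> 'g \<Rightarrow> complex" where
  "T_conv G K \<theta> v f = restrict (\<lambda>f'. gconv G f' f) (I_space G K \<theta> v)"

definition double_coset_representatives ::
    "('g, 'm) monoid_scheme \<Rightarrow> 'g set \<Rightarrow> 'g set \<Rightarrow> bool" where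
  "double_coset_representatives G K S \<longleftrightarrow>
    S \<subseteq> carrier G \<and> (\<forall>g\<in>carrier G. \<exists>!s. s \<in> S \<and> g \<in> K <#>\<^bsub>G\<^esub> (s <#\<^bsub>G\<^esub> K))"

definition conj_inter :: "('g, 'm) monoid_scheme \<Rightarrow> 'g set \<Rightarrow> 'g \<Rightarrow> 'g set" where
  "conj_inter G K s = K \<inter> ((s <#\<^bsub>G\<^esub> K) #>\<^bsub>G\<^esub> inv\<^bsub>G\<^esub> s)"

definition conj_rep ::
    "('g, 'm) monoid_scheme \<Rightarrow> 'g \<Rightarrow> ('g, 'v) urep \<Rightarrow> ('g, 'v) urep" where
  "conj_rep G s \<theta> = \<theta>\<lparr>ract := (\<lambda>x. ract \<theta> (inv\<^bsub>G\<^esub> s \<otimes>\<^bsub>G\<^esub> x \<otimes>\<^bsub>G\<^esub> s))\<rparr>"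

end

theory Submission
  imports Defs "HOL-Computational_Algebra.Fundamental_Theorem_Algebra"
begin

text \<open>
  The map \<open>T\<^sub>v\<close> identifies \<open>Ind V\<close> with the left ideal of those \<open>f\<close> with \<open>f * \<psi> = f\<close>. An endomorphism
  \<open>A\<close> of this ideal commuting with left translations satisfies \<open>A f = A (f * \<psi>) = f * A \<psi>\<close>, so the
  endomorphisms of \<open>Ind V\<close> are the right convolutions by elements of the Hecke algebra, with the order
  of multiplication reversed. By complete reducibility and Schur's lemma, a unitary representation is
  multiplicity-free if and only if its endomorphisms commute, and then each endomorphism is a scalar on
  each irreducible summand.

  For the last formula, the function \<open>f\<close> in the Hecke algebra is turned into the operator-valued function
  \<open>\<Phi> g = \<Sum>k,l\<in>K. f (k g l) \<theta>(l) \<circ> \<langle>_, v\<rangle> v \<circ> \<theta>(k)\<close>, which satisfies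
  \<open>\<Phi> (k g l) = \<theta>(l\<^sup>-\<^sup>1) \<circ> \<Phi> g \<circ> \<theta>(k\<^sup>-\<^sup>1)\<close> and from which \<open>f\<close> is recovered, up to a constant, as
  \<open>\<langle>\<Phi> g v, v\<rangle>\<close>. Such a \<open>\<Phi>\<close> is given by its values at double coset representatives \<open>s\<close>, and these can
  be any elements of the spaces of intertwiners from \<open>\<theta>\<close> to \<open>\<theta>\<^sup>s\<close> over \<open>K\<^sub>s\<close>.
\<close>

section \<open>Linear algebra\<close>

text \<open>Everything rests on one identity, \<open>reproducing\<close>: the sum over K of the
  conjugates of the rank-one projection onto v is the scalar \<open>\<kappa>\<close> = |K| / dim V.
  It says that a vector of V can be rebuilt from the coefficients along v of its K-translates. For a
  function in Ind V these are the coefficients along v of its values on a coset gK. This is why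
  passing to one scalar coefficient loses nothing, why the image is singled out by f * psi = f, and
  why psi is idempotent. Applied on both sides of an operator, the identity also recovers \<Phi>
  from its coefficient at v.

  Complete reducibility enters as an induction principle: a subspace that contains every irreducible
  invariant subspace is everything. The equivalence of (a) and (b) therefore needs no chosen
  decomposition.

  All spaces are subspaces of ambient types, and maps are controlled on them only. Hence linearity
  is taken relative to a set, and facts about linear maps of the whole type are reached by extension
  from a basis.\<close>

interpretation complex_pair: vector_space_pair
  "scaleC :: complex \<Rightarrow> 'a::complex_vector \<Rightarrow> 'a" "scaleC :: complex \<Rightarrow> 'b::complex_vector \<Rightarrow> 'b"
  by unfold_locales

abbreviation csubspace :: "'a::complex_vector set \<Rightarrow> bool" where
  "csubspace \<equiv> complex_vector.subspace"

abbreviation cspan :: "'a::complex_vector set \<Rightarrow> 'a set" where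
  "cspan \<equiv> complex_vector.span"

abbreviation cdim :: "'a::complex_vector set \<Rightarrow> nat" where
  "cdim \<equiv> complex_vector.dim"

text \<open>Since \<open>card\<close> is 0 on infinite sets, \<open>cdim\<close> of an
  infinite-dimensional space is 0, so statements about dimension must carry finiteness along.
  Containment in a finite span, rather than equality, lets the property pass to every
  subset.\<close>

definition fin_dim :: "'a::complex_vector set \<Rightarrow> bool" where
  "fin_dim V \<longleftrightarrow> (\<exists>B. finite B \<and> V \<subseteq> cspan B)"

lemma fin_dim_subset: "fin_dim V \<Longrightarrow> U \<subseteq> V \<Longrightarrow> fin_dim U"
  unfolding fin_dim_def by blast

lemma fin_dim_basis:
  assumes "fin_dim V" "csubspace V"
  obtains B where "finite B" "B \<subseteq> V" "complex_vector.independent B" "cspan B = V" "card B = cdim V"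
proof -
  obtain B where B: "B \<subseteq> V" "complex_vector.independent B" "V \<subseteq> cspan B" "card B = cdim V"
    by (rule complex_vector.basis_exists[of V])
  have "cspan B = V"
    using B(1,3) assms(2) complex_vector.span_minimal by blast
  moreover have "finite B"
    using assms(1) B(1,2) complex_vector.independent_span_bound unfolding fin_dim_def by blast
  ultimately show thesis using B that by blast
qed

lemma card_independent_le_dim:
  assumes "fin_dim V" "csubspace V" "complex_vector.independent B" "B \<subseteq> V"
  shows "finite B \<and> card B \<le> cdim V"
  using fin_dim_basis[OF assms(1,2)] complex_vector.independent_span_bound[of _ B] assms(3,4) by metis

lemma dim_strict_mono:
  assumes "fin_dim V" "csubspace V" "csubspace U" "U \<subset> V"
  shows "cdim U < cdim V"
proof -
  obtain B where B: "finite B" "B \<subseteq> U" "complex_vector.independent B" "cspan B = U" "card B = cdim U"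
    using fin_dim_basis[OF fin_dim_subset[OF assms(1)] assms(3)] assms(4) by blast
  obtain x where x: "x \<in> V" "x \<notin> U" using assms(4) by blast
  have "complex_vector.independent (insert x B)"
    using B x complex_vector.independent_insertI by metis
  then have "card (insert x B) \<le> cdim V"
    using card_independent_le_dim[OF assms(1,2), of "insert x B"] B(2) x(1) assms(4) by blast
  moreover have "x \<notin> B" using B(2) x(2) by blast
  ultimately show ?thesis using B by simp
qed

section \<open>Linear maps on a subspace of the ambient type\<close>

lemma clinear_onI:
  assumes "\<And>x y. x \<in> V \<Longrightarrow> y \<in> V \<Longrightarrow> f (x + y) = f x + f y"
    and "\<And>c x. x \<in> V \<Longrightarrow> f (c *\<^sub>C x) = c *\<^sub>C f x"
  shows "clinear_on V f"
  using assms unfolding clinear_on_def by blast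

lemma clinear_on_add: "clinear_on V f \<Longrightarrow> x \<in> V \<Longrightarrow> y \<in> V \<Longrightarrow> f (x + y) = f x + f y"
  unfolding clinear_on_def by blast

lemma clinear_on_scale: "clinear_on V f \<Longrightarrow> x \<in> V \<Longrightarrow> f (c *\<^sub>C x) = c *\<^sub>C f x"
  unfolding clinear_on_def by blast

lemma clinear_on_zero: "clinear_on V f \<Longrightarrow> csubspace V \<Longrightarrow> f 0 = 0"
  using clinear_on_scale[of V f 0 0] complex_vector.subspace_0 by fastforce

lemma clinear_on_diff:
  "clinear_on V f \<Longrightarrow> csubspace V \<Longrightarrow> x \<in> V \<Longrightarrow> y \<in> V \<Longrightarrow> f (x - y) = f x - f y"
  using clinear_on_add[of V f "x - y" y] complex_vector.subspace_diff[of V x y]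
  by (simp add: eq_diff_eq)

lemma clinear_on_sum:
  assumes "clinear_on V f" "csubspace V" "\<And>i. i \<in> I \<Longrightarrow> x i \<in> V"
  shows "f (\<Sum>i\<in>I. x i) = (\<Sum>i\<in>I. f (x i))"
  using assms(3)
proof (induction I rule: infinite_finite_induct)
  case (insert i I)
  then show ?case
    using clinear_on_add[OF assms(1), of "x i" "sum x I"] complex_vector.subspace_sum[OF assms(2), of I x]
    by simp
qed (auto simp: clinear_on_zero[OF assms(1,2)])

lemma clinear_on_subset: "clinear_on V f \<Longrightarrow> U \<subseteq> V \<Longrightarrow> clinear_on U f"
  unfolding clinear_on_def by blast

lemma clinear_on_inj_on:
  assumes "clinear_on V f" "csubspace V" "\<And>x. x \<in> V \<Longrightarrow> f x = 0 \<Longrightarrow> x = 0"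
  shows "inj_on f V"
proof (rule inj_onI)
  fix x y assume *: "x \<in> V" "y \<in> V" "f x = f y"
  then have "f (x - y) = 0" using clinear_on_diff[OF assms(1,2)] by simp
  then show "x = y" using assms(3)[of "x - y"] complex_vector.subspace_diff[OF assms(2)] * by simp
qed

lemma clinear_on_inv_into:
  assumes "clinear_on V f" "csubspace V" "inj_on f V"
  shows "clinear_on (f ` V) (inv_into V f)"
proof (rule clinear_onI)
  fix x y assume "x \<in> f ` V" "y \<in> f ` V"
  then obtain a b where ab: "a \<in> V" "b \<in> V" "x = f a" "y = f b" by blast
  have "x + y = f (a + b)" using ab clinear_on_add[OF assms(1)] by simp
  then show "inv_into V f (x + y) = inv_into V f x + inv_into V f y"
    using ab assms(3) complex_vector.subspace_add[OF assms(2)] by simp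
next
  fix c x assume "x \<in> f ` V"
  then obtain a where ab: "a \<in> V" "x = f a" by blast
  have "c *\<^sub>C x = f (c *\<^sub>C a)" using ab clinear_on_scale[OF assms(1)] by simp
  then show "inv_into V f (c *\<^sub>C x) = c *\<^sub>C inv_into V f x"
    using ab assms(3) complex_vector.subspace_scale[OF assms(2)] by simp
qed

lemma clinear_on_image_subspace:
  assumes "clinear_on V f" "csubspace V"
  shows "csubspace (f ` V)"
proof (rule complex_vector.subspaceI)
  show "0 \<in> f ` V"
    using clinear_on_zero[OF assms] complex_vector.subspace_0[OF assms(2)] by force
next
  fix x y assume "x \<in> f ` V" "y \<in> f ` V"
  then obtain a b where ab: "a \<in> V" "b \<in> V" "x = f a" "y = f b" by blast
  then show "x + y \<in> f ` V"
    using clinear_on_add[OF assms(1) ab(1,2)] complex_vector.subspace_add[OF assms(2) ab(1,2)] by force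
next
  fix c x assume "x \<in> f ` V"
  then obtain a where ab: "a \<in> V" "x = f a" by blast
  then show "c *\<^sub>C x \<in> f ` V"
    using clinear_on_scale[OF assms(1) ab(1)] complex_vector.subspace_scale[OF assms(2) ab(1)]
    by (metis imageI)
qed

text \<open>Makes facts about maps that are linear on the whole type available for maps that are
  linear on V only: such a map is fixed by its values on a basis of V, which is independent in the
  whole type.\<close>

lemma clinear_on_extend:
  fixes f :: "'a::complex_vector \<Rightarrow> 'b::complex_vector"
  assumes "clinear_on V f" "csubspace V"
  obtains g where "Vector_Spaces.linear scaleC scaleC g" "\<And>x. x \<in> V \<Longrightarrow> g x = f x"
proof -
  obtain B where B: "B \<subseteq> V" "complex_vector.independent B" "V \<subseteq> cspan B"
    by (rule complex_vector.basis_exists[of V])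
  obtain g :: "'a \<Rightarrow> 'b" where g: "Vector_Spaces.linear scaleC scaleC g" "\<forall>x\<in>B. g x = f x"
    using complex_pair.linear_independent_extend[OF B(2), of f] by blast
  interpret g: Vector_Spaces.linear scaleC scaleC g by (rule g)
  \<comment> \<open>Additivity of \<open>f\<close> may be used on \<open>V\<close> only, so
    membership in \<open>V\<close> is carried through the span induction.\<close>
  have "x \<in> V \<and> g x = f x" if "x \<in> cspan B" for x
    using that
  proof (induction rule: complex_vector.span_induct_alt)
    case base
    then show ?case
      using clinear_on_zero[OF assms] complex_vector.subspace_0[OF assms(2)] g.zero by metis
  next
    case (step c x y)
    then have x: "x \<in> V" "c *\<^sub>C x \<in> V" using B(1) complex_vector.subspace_scale[OF assms(2)] by auto
    then have "f (c *\<^sub>C x + y) = c *\<^sub>C f x + f y"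
      using step clinear_on_add[OF assms(1)] clinear_on_scale[OF assms(1)] by simp
    then show ?case
      using step g(2) x complex_vector.subspace_add[OF assms(2)] by (simp add: g.add g.scale)
  qed
  then show thesis using that[OF g(1)] B(3) by blast
qed

section \<open>Dimensions of images and of products\<close>

lemma fin_dim_image:
  fixes f :: "'a::complex_vector \<Rightarrow> 'b::complex_vector"
  assumes "clinear_on V f" "csubspace V" "fin_dim V"
  shows "fin_dim (f ` V)"
proof -
  obtain g :: "'a \<Rightarrow> 'b" where g: "Vector_Spaces.linear scaleC scaleC g" "\<And>x. x \<in> V \<Longrightarrow> g x = f x"
    using clinear_on_extend[OF assms(1,2)] by blast
  interpret g: Vector_Spaces.linear scaleC scaleC g by (rule g)
  obtain B where "finite B" "V \<subseteq> cspan B" using assms(3) unfolding fin_dim_def by blast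
  then have "finite (g ` B)" "f ` V \<subseteq> cspan (g ` B)"
    using g(2) g.span_image[of B] by (auto simp: image_iff) (metis imageI subsetD)
  then show ?thesis unfolding fin_dim_def by blast
qed

lemma cdim_bij_betw:
  fixes f :: "'a::complex_vector \<Rightarrow> 'b::complex_vector"
  assumes "clinear_on V f" "csubspace V" "fin_dim V" "bij_betw f V W"
  shows "cdim W = cdim V"
proof -
  obtain g :: "'a \<Rightarrow> 'b" where g: "Vector_Spaces.linear scaleC scaleC g" "\<And>x. x \<in> V \<Longrightarrow> g x = f x"
    using clinear_on_extend[OF assms(1,2)] by blast
  interpret g: Vector_Spaces.linear scaleC scaleC g by (rule g)
  obtain B where B: "finite B" "B \<subseteq> V" "complex_vector.independent B" "cspan B = V" "card B = cdim V"
    using fin_dim_basis[OF assms(3,2)] by blast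
  have gV: "g ` V = W" "inj_on g V"
    using assms(4) g(2) by (auto simp: bij_betw_def inj_on_def)
  have "complex_vector.independent (g ` B)"
    using g.independent_injective_image[OF B(3)] gV(2) B(4) by blast
  moreover have "cspan (g ` B) = W" using g.span_image[of B] B(4) gV by simp
  moreover have "card (g ` B) = card B"
    using card_image inj_on_subset[OF gV(2) B(2)] by blast
  ultimately show ?thesis
    using B(5) complex_vector.dim_span_eq_card_independent by metis
qed

text \<open>Used with three kinds of fibre: complex lines for the functions on a set, copies of V
  for the induced space, and spaces of intertwiners for the sum over double cosets.\<close>

lemma
  fixes W :: "'a \<Rightarrow> 'b::complex_vector set"
  assumes "finite S" and W: "\<And>s. s \<in> S \<Longrightarrow> csubspace (W s)" "\<And>s. s \<in> S \<Longrightarrow> fin_dim (W s)"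
  shows fin_dim_supported_product:
      "fin_dim {F. (\<forall>s\<in>S. F s \<in> W s) \<and> (\<forall>s. s \<notin> S \<longrightarrow> F s = 0)}" (is "fin_dim ?X")
    and cdim_supported_product:
      "cdim {F. (\<forall>s\<in>S. F s \<in> W s) \<and> (\<forall>s. s \<notin> S \<longrightarrow> F s = 0)} = (\<Sum>s\<in>S. cdim (W s))"
proof -
  have "\<exists>B. finite B \<and> B \<subseteq> W s \<and> complex_vector.independent B \<and> cspan B = W s \<and> card B = cdim (W s)"
    if "s \<in> S" for s
    using fin_dim_basis[OF W(2)[OF that] W(1)[OF that]] by metis
  then obtain B where B: "\<And>s. s \<in> S \<Longrightarrow> finite (B s) \<and> B s \<subseteq> W s \<and>
      complex_vector.independent (B s) \<and> cspan (B s) = W s \<and> card (B s) = cdim (W s)"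
    by metis
  \<comment> \<open>The functions concentrated at one index \<open>s\<close>, with a basis vector of
    \<open>W s\<close> as value there, will form a basis.\<close>
  define \<delta> where "\<delta> = (\<lambda>(s::'a, b). \<lambda>t. if t = s then b else (0::'b))"
  let ?P = "Sigma S B"
  have fP: "finite ?P" using \<open>finite S\<close> B by blast
  have nz: "b \<noteq> 0" if "s \<in> S" "b \<in> B s" for s b
    using that B complex_vector.dependent_zero by metis
  have inj: "inj_on \<delta> ?P"
  proof (rule inj_onI)
    fix p q assume p: "p \<in> ?P" "q \<in> ?P" "\<delta> p = \<delta> q"
    obtain s b t c where *: "p = (s, b)" "q = (t, c)" by fastforce
    have "\<delta> p s = \<delta> q s" "\<delta> p t = \<delta> q t" using p(3) by simp_all
    then show "p = q" using nz p(1,2) unfolding * \<delta>_def by (auto split: if_splits)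
  qed
  \<comment> \<open>At \<open>t\<close> only the block over \<open>t\<close> survives, so
    independence and spanning are both read off index by index.\<close>
  have expand: "(\<Sum>p\<in>?P. u p *\<^sub>C \<delta> p) t = (if t \<in> S then \<Sum>b\<in>B t. u (t, b) *\<^sub>C b else 0)"
    for u :: "'a \<times> 'b \<Rightarrow> complex" and t
  proof -
    have "(\<Sum>p\<in>?P. u p *\<^sub>C \<delta> p) t = (\<Sum>p\<in>?P. u p *\<^sub>C \<delta> p t)"
      using fP by (induction rule: finite_induct) (simp_all add: scaleC_fun_def)
    also have "\<dots> = (\<Sum>s\<in>S. \<Sum>b\<in>B s. u (s, b) *\<^sub>C \<delta> (s, b) t)"
      using \<open>finite S\<close> B by (subst sum.Sigma) (auto simp: case_prod_unfold)
    also have "\<dots> = (\<Sum>s\<in>S. if s = t then \<Sum>b\<in>B t. u (t, b) *\<^sub>C b else 0)"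
      unfolding \<delta>_def by (rule sum.cong) auto
    finally show ?thesis using \<open>finite S\<close> by simp
  qed
  let ?C = "\<delta> ` ?P"
  have fC: "finite ?C" using fP by simp
  have sumC: "(\<Sum>c\<in>?C. w c *\<^sub>C c) = (\<Sum>p\<in>?P. w (\<delta> p) *\<^sub>C \<delta> p)" for w
    by (simp add: sum.reindex[OF inj])
  have ind: "complex_vector.independent ?C"
  proof (rule complex_vector.independent_if_scalars_zero[OF fC])
    fix w c assume 0: "(\<Sum>c\<in>?C. w c *\<^sub>C c) = 0" and c: "c \<in> ?C"
    obtain s b where sb: "s \<in> S" "b \<in> B s" "c = \<delta> (s, b)" using c by auto
    have "(\<Sum>b\<in>B s. w (\<delta> (s, b)) *\<^sub>C b) = 0"
      using expand[of "\<lambda>p. w (\<delta> p)" s] sb(1) 0 sumC[of w] by simp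
    then show "w c = 0"
      using complex_vector.independentD[of "B s" "B s" "\<lambda>b. w (\<delta> (s, b))"] B[OF sb(1)] sb by simp
  qed
  have CX: "?C \<subseteq> ?X"
  proof -
    have "b \<in> W s" if "s \<in> S" "b \<in> B s" for s b using B that by blast
    then show ?thesis using complex_vector.subspace_0[OF W(1)] by (auto simp: \<delta>_def)
  qed
  have XC: "?X \<subseteq> cspan ?C"
  proof
    fix F assume F: "F \<in> ?X"
    have "\<exists>u. F s = (\<Sum>b\<in>B s. u b *\<^sub>C b)" if "s \<in> S" for s
    proof -
      have "F s \<in> cspan (B s)" using F B that by blast
      then show ?thesis using B[OF that] complex_vector.span_finite[of "B s"] by auto
    qed
    then obtain u where u: "\<And>s. s \<in> S \<Longrightarrow> F s = (\<Sum>b\<in>B s. u s b *\<^sub>C b)" by metis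
    have "F t = (\<Sum>p\<in>?P. (case p of (s, b) \<Rightarrow> u s b) *\<^sub>C \<delta> p) t" for t
      using F u by (subst expand) auto
    then have "F = (\<Sum>p\<in>?P. (case p of (s, b) \<Rightarrow> u s b) *\<^sub>C \<delta> p)" by blast
    also have "\<dots> \<in> cspan ?C"
      by (intro complex_vector.span_sum complex_vector.span_scale complex_vector.span_base) auto
    finally show "F \<in> cspan ?C" .
  qed
  show "fin_dim ?X" unfolding fin_dim_def using fC XC by blast
  have "cdim ?X = card ?C"
    using complex_vector.dim_unique[OF CX XC ind refl] .
  also have "\<dots> = (\<Sum>s\<in>S. card (B s))"
    using \<open>finite S\<close> B by (simp add: card_image[OF inj] card_SigmaI)
  also have "\<dots> = (\<Sum>s\<in>S. cdim (W s))" using B by simp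
  finally show "cdim ?X = (\<Sum>s\<in>S. cdim (W s))" .
qed

lemma complex_line:
  shows "fin_dim (UNIV :: complex set)" "cdim (UNIV :: complex set) = 1"
proof -
  have sp: "cspan {1::complex} = UNIV"
    by (auto simp: complex_vector.span_singleton scaleC_complex_def)
  show "fin_dim (UNIV :: complex set)" unfolding fin_dim_def using sp by blast
  show "cdim (UNIV :: complex set) = 1"
    using complex_vector.dim_span_eq_card_independent[of "{1::complex}"] by (simp add: sp)
qed

lemma csubspace_functions_on: "csubspace (functions_on A)"
  by (auto intro!: complex_vector.subspaceI simp: functions_on_def scaleC_fun_def)

lemma
  assumes "finite A"
  shows fin_dim_functions_on: "fin_dim (functions_on A)"
    and cdim_functions_on: "cdim (functions_on A) = card A"
  using fin_dim_supported_product[OF assms, of "\<lambda>_. UNIV :: complex set"]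
    cdim_supported_product[OF assms, of "\<lambda>_. UNIV :: complex set"] complex_line
  by (simp_all add: functions_on_def)

text \<open>Meant for the iterates of a linear map: the relation is then a polynomial, and its
  nonzero leading coefficient keeps it from being zero. It exists because \<open>cdim V\<close> + 1
  vectors are dependent.\<close>

lemma nontrivial_relation:
  fixes x :: "nat \<Rightarrow> 'a::complex_vector"
  assumes "fin_dim V" "csubspace V" "\<And>i. x i \<in> V"
  obtains n u where "u n \<noteq> 0" "(\<Sum>i\<le>n. u i *\<^sub>C x i) = 0"
proof -
  let ?n = "cdim V"
  have "\<exists>u. (\<exists>i\<le>?n. u i \<noteq> 0) \<and> (\<Sum>i\<le>?n. u i *\<^sub>C x i) = 0"
  proof (cases "inj_on x {..?n}")
    case True
    have "complex_vector.dependent (x ` {..?n})"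
      using card_independent_le_dim[OF assms(1,2), of "x ` {..?n}"] assms(3) card_image[OF True]
      by fastforce
    then obtain w where "\<exists>v\<in>x ` {..?n}. w v \<noteq> 0" "(\<Sum>v\<in>x ` {..?n}. w v *\<^sub>C v) = 0"
      using complex_vector.dependent_finite[of "x ` {..?n}"] by auto
    then show ?thesis
      by (intro exI[of _ "\<lambda>i. w (x i)"]) (auto simp: sum.reindex[OF True])
  next
    \<comment> \<open>Dependence is a property of the set of vectors and does not see repetitions,
      so a repeated vector has to supply the relation by itself.\<close>
    case False
    then obtain i j where ij: "i \<le> ?n" "j \<le> ?n" "i \<noteq> j" "x i = x j" by (auto simp: inj_on_def)
    let ?u = "\<lambda>k. if k = i then 1 else if k = j then -1 else (0::complex)"
    have "(\<Sum>k\<le>?n. ?u k *\<^sub>C x k) = (\<Sum>k\<in>{i, j}. ?u k *\<^sub>C x k)"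
      using ij by (intro sum.mono_neutral_right) auto
    also have "\<dots> = 0" using ij by simp
    finally show ?thesis using ij by (intro exI[of _ ?u]) auto
  qed
  then obtain u where u: "\<exists>i\<le>?n. u i \<noteq> 0" "(\<Sum>i\<le>?n. u i *\<^sub>C x i) = 0" by blast
  \<comment> \<open>Cutting the relation at its last nonzero coefficient makes that coefficient the
    leading one.\<close>
  define m where "m = Max {i. i \<le> ?n \<and> u i \<noteq> 0}"
  have fin: "finite {i. i \<le> ?n \<and> u i \<noteq> 0}" by simp
  have m: "m \<le> ?n" "u m \<noteq> 0" using Max_in[OF fin] u(1) unfolding m_def by auto
  have "(\<Sum>i\<le>m. u i *\<^sub>C x i) = (\<Sum>i\<le>?n. u i *\<^sub>C x i)"
  proof (rule sum.mono_neutral_left)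
    show "\<forall>i\<in>{..?n} - {..m}. u i *\<^sub>C x i = 0"
      using Max_ge[OF fin] unfolding m_def by fastforce
  qed (use m in auto)
  with u(2) m(2) that show thesis by metis
qed

lemma cdim_le_1_proportional:
  assumes "fin_dim V" "csubspace V" "cdim V \<le> 1" "x \<in> V" "y \<in> V" "x \<noteq> 0"
  obtains c where "y = c *\<^sub>C x"
proof -
  obtain B where B: "finite B" "cspan B = V" "card B = cdim V"
    using fin_dim_basis[OF assms(1,2)] by metis
  then have "B \<noteq> {}" using assms(4,6) by auto
  then obtain b where b: "B = {b}"
    using B assms(3) by (metis One_nat_def card_1_singletonE card_eq_0_iff le_Suc_eq le_zero_eq)
  have "x \<in> range (\<lambda>k. k *\<^sub>C b)" "y \<in> range (\<lambda>k. k *\<^sub>C b)"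
    using assms(4,5) B(2) b complex_vector.span_singleton[of b] by auto
  then obtain s t where st: "x = s *\<^sub>C b" "y = t *\<^sub>C b" by blast
  then have "s \<noteq> 0" using assms(6) by auto
  then have "y = (t / s) *\<^sub>C x" unfolding st by (simp add: scaleC_scaleC)
  then show thesis by (rule that)
qed

lemma fin_dim_inj:
  assumes "clinear_on V f" "csubspace V" "inj_on f V" "f ` V \<subseteq> W" "fin_dim W"
  shows "fin_dim V"
proof -
  have "fin_dim (inv_into V f ` (f ` V))"
    by (rule fin_dim_image[OF clinear_on_inv_into[OF assms(1-3)]
          clinear_on_image_subspace[OF assms(1,2)] fin_dim_subset[OF assms(5,4)]])
  then show ?thesis using assms(3) by simp
qed

section \<open>Eigenvectors\<close>

text \<open>The vector p(A) x, evaluated by Horner's scheme.\<close>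

definition poly_act :: "complex poly \<Rightarrow> ('a::complex_vector \<Rightarrow> 'a) \<Rightarrow> 'a \<Rightarrow> 'a" where
  "poly_act p A x = fold_coeffs (\<lambda>a w. a *\<^sub>C x + A w) p 0"

context
  fixes A :: "'a::complex_vector \<Rightarrow> 'a"
  assumes A: "Vector_Spaces.linear scaleC scaleC A"
begin

interpretation A: Vector_Spaces.linear scaleC scaleC A by (rule A)

lemma poly_act_0: "poly_act 0 A x = 0"
  by (simp add: poly_act_def)

lemma poly_act_pCons: "poly_act (pCons a p) A x = a *\<^sub>C x + A (poly_act p A x)"
  by (cases "p = 0 \<and> a = 0") (auto simp: poly_act_def A.zero)

lemma poly_act_add: "poly_act (p + q) A x = poly_act p A x + poly_act q A x"
  by (induction p q rule: poly_induct2)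
    (simp_all add: poly_act_0 poly_act_pCons A.add scaleC_add_left algebra_simps)

lemma poly_act_smult: "poly_act (smult c p) A x = c *\<^sub>C poly_act p A x"
  by (induction p) (simp_all add: poly_act_0 poly_act_pCons A.scale scaleC_add_right scaleC_scaleC)

lemma poly_act_apply: "poly_act p A (A x) = A (poly_act p A x)"
  by (induction p) (simp_all add: poly_act_0 poly_act_pCons A.add A.scale A.zero)

lemma poly_act_linear:
  "poly_act p A (x + y) = poly_act p A x + poly_act p A y"
  "poly_act p A (c *\<^sub>C x) = c *\<^sub>C poly_act p A x"
  by (induction p)
    (simp_all add: poly_act_0 poly_act_pCons A.add A.scale scaleC_add_right scaleC_scaleC
      mult.commute algebra_simps)

text \<open>Because p(A) commutes with A, the linear factor may act on the vector first. This trades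
  the polynomial for one of lower degree and x for (A - c) x.\<close>

lemma poly_act_mult_linear: "poly_act ([:- c, 1:] * p) A x = poly_act p A (A x + (- c) *\<^sub>C x)"
proof -
  have "[:- c, 1:] * p = smult (- c) p + pCons 0 p" by simp
  then have "poly_act ([:- c, 1:] * p) A x = (- c) *\<^sub>C poly_act p A x + A (poly_act p A x)"
    using poly_act_add[of "smult (- c) p" "pCons 0 p" x] poly_act_smult[of "- c" p x]
    by (simp add: poly_act_pCons del: smult_minus_left)
  then show ?thesis unfolding poly_act_linear by (simp add: poly_act_apply)
qed

lemma poly_act_coeffs: "poly_act (\<Sum>i\<le>n. monom (u i) i) A x = (\<Sum>i\<le>n. u i *\<^sub>C (A ^^ i) x)"
proof -
  have monom: "poly_act (monom c i) A x = c *\<^sub>C (A ^^ i) x" for c i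
    by (induction i) (simp_all add: poly_act_pCons poly_act_0 A.zero A.scale monom_0 monom_Suc)
  show ?thesis
    by (induction n) (simp_all add: poly_act_add monom)
qed

text \<open>Split off a linear factor at a root c of p. Either (A - c) x vanishes and x is an
  eigenvector, or it is a nonzero vector of V killed by the cofactor, whose degree is
  smaller.\<close>

lemma eigenvector_of_annihilating_poly:
  assumes V: "csubspace V" "A \<in> V \<rightarrow> V"
  shows "p \<noteq> 0 \<Longrightarrow> x \<in> V \<Longrightarrow> x \<noteq> 0 \<Longrightarrow> poly_act p A x = 0 \<Longrightarrow>
    \<exists>c. \<exists>y\<in>V. y \<noteq> 0 \<and> A y = c *\<^sub>C y"
proof (induction "degree p" arbitrary: p x rule: less_induct)
  case less
  have "degree p \<noteq> 0"
  proof
    assume "degree p = 0"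
    then obtain a where "p = [:a:]" using degree_eq_zeroE by blast
    with less.prems show False
      using poly_act_pCons[of a 0 x] poly_act_0[of x] by (simp add: A.zero)
  qed
  then obtain c where c: "poly p c = 0"
    using fundamental_theorem_of_algebra constant_degree by metis
  then obtain q where q: "p = [:- c, 1:] * q" by (metis poly_eq_0_iff_dvd dvdE)
  with less.prems have q0: "q \<noteq> 0" by auto
  define y where "y = A x + (- c) *\<^sub>C x"
  have y: "y \<in> V" "poly_act q A y = 0"
    using V less.prems complex_vector.subspace_add[OF V(1)] complex_vector.subspace_scale[OF V(1)]
      poly_act_mult_linear[of c q x] q unfolding y_def by (blast, metis)
  show ?case
  proof (cases "y = 0")
    case True
    then have "A x = c *\<^sub>C x"
      unfolding y_def by (simp add: complex_vector.scale_minus_left)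
    then show ?thesis using less.prems by blast
  next
    case False
    have "degree q < degree p" unfolding q using q0 by (subst degree_mult_eq) auto
    then show ?thesis using less.hyps y False q0 by blast
  qed
qed

end

text \<open>A nonzero vector and its iterates satisfy a nontrivial relation, that is, some nonzero
  polynomial in A kills the vector; no determinant is involved.\<close>

lemma eigenvector_exists:
  fixes A :: "'a::complex_vector \<Rightarrow> 'a"
  assumes "clinear_on V A" "csubspace V" "fin_dim V" "A \<in> V \<rightarrow> V" "V \<noteq> {0}"
  obtains c x where "x \<in> V" "x \<noteq> 0" "A x = c *\<^sub>C x"
proof -
  obtain L where L: "Vector_Spaces.linear scaleC scaleC L" "\<And>x. x \<in> V \<Longrightarrow> L x = A x"
    using clinear_on_extend[OF assms(1,2)] by blast
  have LV: "L \<in> V \<rightarrow> V" using L(2) assms(4) by auto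
  obtain x where x: "x \<in> V" "x \<noteq> 0"
    using assms(2,5) complex_vector.subspace_0 by blast
  have "(L ^^ i) x \<in> V" for i by (induction i) (use LV x in auto)
  then obtain n u where nu: "u n \<noteq> 0" "(\<Sum>i\<le>n. u i *\<^sub>C (L ^^ i) x) = 0"
    by (rule nontrivial_relation[OF assms(3,2), of "\<lambda>i. (L ^^ i) x"])
  let ?p = "\<Sum>i\<le>n. monom (u i) i"
  have "coeff ?p n = u n" by (simp add: coeff_sum)
  then have "?p \<noteq> 0" using nu(1) by auto
  moreover have "poly_act ?p L x = 0" using poly_act_coeffs[OF L(1)] nu(2) by simp
  ultimately obtain c y where "y \<in> V" "y \<noteq> 0" "L y = c *\<^sub>C y"
    using eigenvector_of_annihilating_poly[OF L(1) assms(2) LV] x by blast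
  then show thesis using that L(2) by metis
qed

section \<open>Inner product spaces\<close>

locale inner_product_space =
  fixes V :: "'v::complex_vector set" and ip :: "'v \<Rightarrow> 'v \<Rightarrow> complex"
  assumes fdip: "fd_inner_product_space V ip"
begin

lemma subspace: "csubspace V"
  and fin_dim: "fin_dim V"
  and ip_linear: "y \<in> V \<Longrightarrow> clinear_on V (\<lambda>x. ip x y)"
  and ip_commute: "x \<in> V \<Longrightarrow> y \<in> V \<Longrightarrow> ip y x = cnj (ip x y)"
  and ip_pos: "x \<in> V \<Longrightarrow> x \<noteq> 0 \<Longrightarrow> 0 < Re (ip x x)"
  using fdip unfolding fd_inner_product_space_def fin_dim_def by blast+

lemmas mem_add = complex_vector.subspace_add[OF subspace]
  and mem_scale = complex_vector.subspace_scale[OF subspace]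
  and mem_diff = complex_vector.subspace_diff[OF subspace]
  and mem_sum = complex_vector.subspace_sum[OF subspace]
  and mem_zero = complex_vector.subspace_0[OF subspace]

lemma ip_add_left: "x \<in> V \<Longrightarrow> y \<in> V \<Longrightarrow> z \<in> V \<Longrightarrow> ip (x + y) z = ip x z + ip y z"
  using clinear_on_add[OF ip_linear] by blast

lemma ip_scale_left: "x \<in> V \<Longrightarrow> z \<in> V \<Longrightarrow> ip (c *\<^sub>C x) z = c * ip x z"
  using clinear_on_scale[OF ip_linear] by (simp add: scaleC_complex_def)

lemma ip_diff_left: "x \<in> V \<Longrightarrow> y \<in> V \<Longrightarrow> z \<in> V \<Longrightarrow> ip (x - y) z = ip x z - ip y z"
  using clinear_on_diff[OF ip_linear subspace] by blast

lemma ip_zero_left: "z \<in> V \<Longrightarrow> ip 0 z = 0"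
  using clinear_on_zero[OF ip_linear subspace] by blast

lemma ip_sum_left: "(\<And>i. i \<in> I \<Longrightarrow> x i \<in> V) \<Longrightarrow> z \<in> V \<Longrightarrow> ip (\<Sum>i\<in>I. x i) z = (\<Sum>i\<in>I. ip (x i) z)"
  using clinear_on_sum[OF ip_linear subspace] by blast

lemma ip_scale_right: "x \<in> V \<Longrightarrow> z \<in> V \<Longrightarrow> ip z (c *\<^sub>C x) = cnj c * ip z x"
  using ip_scale_left[of x z c] ip_commute[of z "c *\<^sub>C x"] ip_commute[of x z] mem_scale
  by (metis complex_cnj_mult complex_cnj_cnj)

lemma ip_self: "x \<in> V \<Longrightarrow> ip x x = of_real (Re (ip x x))"
  using ip_commute[of x x] by (metis Reals_cnj_iff complex_is_Real_iff of_real_Re)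

lemma ip_self_eq_0: "x \<in> V \<Longrightarrow> ip x x = 0 \<longleftrightarrow> x = 0"
  using ip_pos[of x] ip_zero_left[of 0] mem_zero by (cases "x = 0") auto

section \<open>Orthonormal systems and Gram-Schmidt\<close>

definition orthonormal :: "'v set \<Rightarrow> bool" where
  "orthonormal B \<longleftrightarrow> finite B \<and> B \<subseteq> V \<and> (\<forall>x\<in>B. \<forall>y\<in>B. ip x y = (if x = y then 1 else 0))"

lemma orthonormal_sum_ip:
  assumes "orthonormal B" "y \<in> B"
  shows "ip (\<Sum>e\<in>B. u e *\<^sub>C e) y = u y"
proof -
  have B: "finite B" "B \<subseteq> V" using assms(1) unfolding orthonormal_def by auto
  have "ip (\<Sum>e\<in>B. u e *\<^sub>C e) y = (\<Sum>e\<in>B. u e * ip e y)"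
    using B assms(2) by (subst ip_sum_left) (auto intro!: mem_scale sum.cong ip_scale_left)
  also have "\<dots> = (\<Sum>e\<in>B. if e = y then u e else 0)"
    using assms unfolding orthonormal_def by (intro sum.cong) auto
  also have "\<dots> = u y" using B(1) assms(2) by simp
  finally show ?thesis .
qed

lemma orthonormal_independent:
  assumes "orthonormal B"
  shows "complex_vector.independent B"
proof (rule complex_vector.independent_if_scalars_zero)
  show "finite B" using assms unfolding orthonormal_def by blast
  fix u y assume "(\<Sum>e\<in>B. u e *\<^sub>C e) = 0" "y \<in> B"
  then show "u y = 0"
    using orthonormal_sum_ip[OF assms, of y u] ip_zero_left assms unfolding orthonormal_def by auto
qed

text \<open>Gram-Schmidt, orthogonal decompositions and Parseval's identity all come from this
  property of the Fourier sum.\<close>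

lemma orthonormal_residue:
  assumes "orthonormal B" "x \<in> V" "y \<in> cspan B"
  shows "ip (x - (\<Sum>e\<in>B. ip x e *\<^sub>C e)) y = 0"
proof -
  have B: "finite B" "B \<subseteq> V" using assms(1) unfolding orthonormal_def by auto
  let ?w = "x - (\<Sum>e\<in>B. ip x e *\<^sub>C e)"
  have P: "(\<Sum>e\<in>B. ip x e *\<^sub>C e) \<in> V" using B by (auto intro!: mem_sum mem_scale)
  then have w: "?w \<in> V" using assms(2) mem_diff by blast
  have e: "ip ?w e = 0" if "e \<in> B" for e
    using orthonormal_sum_ip[OF assms(1) that] ip_diff_left[OF assms(2) P] that B by auto
  obtain u where u: "y = (\<Sum>e\<in>B. u e *\<^sub>C e)"
    using assms(3) complex_vector.span_finite[OF B(1)] by auto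
  have y: "y \<in> V" unfolding u using B by (auto intro!: mem_sum mem_scale)
  have "ip y ?w = (\<Sum>e\<in>B. u e * ip e ?w)"
    unfolding u using B w by (subst ip_sum_left) (auto intro!: mem_scale sum.cong ip_scale_left)
  also have "\<dots> = 0" using e ip_commute[OF w] B by (intro sum.neutral) auto
  finally show ?thesis using ip_commute[OF y w] by simp
qed

text \<open>Gram-Schmidt, one vector of a finite spanning set at a time. The induction tracks spans,
  so the spanning set may be redundant: a vector that depends on the earlier ones leaves the residue
  0 and adds nothing.\<close>

lemma orthonormal_basis:
  assumes "csubspace U" "U \<subseteq> V"
  obtains B where "orthonormal B" "cspan B = U"
proof -
  have "\<exists>B. orthonormal B \<and> cspan B = cspan C" if "finite C" "C \<subseteq> V" for C
    using that
  proof (induction C rule: finite_induct)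
    case empty
    then show ?case by (intro exI[of _ "{}"]) (simp add: orthonormal_def)
  next
    case (insert c C)
    then obtain B where B: "orthonormal B" "cspan B = cspan C" by auto
    have BV: "finite B" "B \<subseteq> V" using B(1) unfolding orthonormal_def by auto
    let ?p = "\<Sum>e\<in>B. ip c e *\<^sub>C e"
    define w where "w = c - ?p"
    have p: "?p \<in> cspan B"
      by (intro complex_vector.span_sum complex_vector.span_scale complex_vector.span_base)
    have pV: "?p \<in> V" using BV by (auto intro!: mem_sum mem_scale)
    have cV: "c \<in> V" using insert by simp
    have w: "w \<in> V" unfolding w_def using mem_diff[OF cV pV] .
    have span: "cspan (insert w B) = cspan (insert c C)"
    proof -
      have "c - 1 *\<^sub>C w \<in> cspan B" using p by (simp add: w_def)
      then have "c \<in> cspan (insert w B)" unfolding complex_vector.span_insert by blast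
      moreover have "w - 1 *\<^sub>C c \<in> cspan B"
        using complex_vector.span_neg[OF p] by (simp add: w_def)
      then have "w \<in> cspan (insert c B)" unfolding complex_vector.span_insert by blast
      ultimately have "cspan (insert w B) = cspan (insert c B)"
        unfolding complex_vector.span_eq
        using complex_vector.span_superset by (metis insert_subset subset_insertI subset_trans)
      also have "\<dots> = cspan (insert c C)"
        unfolding complex_vector.span_insert B(2) by simp
      finally show ?thesis .
    qed
    show ?case
    proof (cases "w = 0")
      case True
      then show ?thesis using B(1) span by auto
    next
      case False
      define r where "r = complex_of_real (1 / sqrt (Re (ip w w)))"
      define e where "e = r *\<^sub>C w"
      have r: "r \<noteq> 0" using ip_pos[OF w False] unfolding r_def by auto
      have eV: "e \<in> V" unfolding e_def using w mem_scale by blast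
      have wB: "ip w b = 0" if "b \<in> B" for b
        unfolding w_def using orthonormal_residue[OF B(1) cV] that complex_vector.span_base by blast
      have eB: "ip e b = 0" "ip b e = 0" if "b \<in> B" for b
      proof -
        have b: "b \<in> V" using that BV by blast
        show "ip e b = 0" unfolding e_def using ip_scale_left[OF w b] wB[OF that] by simp
        then show "ip b e = 0" using ip_commute[OF eV b] by simp
      qed
      have "r * cnj r * of_real (Re (ip w w)) = 1"
        using ip_pos[OF w False] unfolding r_def
        by (simp add: complex_eq_iff flip: of_real_mult) 
      then have ee: "ip e e = 1"
        unfolding e_def using w mem_scale[OF w, of r] ip_self[OF w]
        by (simp add: ip_scale_left ip_scale_right mult_ac)
      have "orthonormal (insert e B)"
        using B(1) eB ee eV unfolding orthonormal_def by fastforce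
      moreover have "cspan (insert e B) = cspan (insert w B)"
      proof -
        have "\<exists>k. x - k *\<^sub>C w \<in> cspan B" if "x - k *\<^sub>C e \<in> cspan B" for x k
          using that by (intro exI[of _ "k * r"]) (simp add: e_def scaleC_scaleC)
        moreover have "\<exists>k. x - k *\<^sub>C e \<in> cspan B" if "x - k *\<^sub>C w \<in> cspan B" for x k
          using that r by (intro exI[of _ "k / r"]) (simp add: e_def scaleC_scaleC)
        ultimately show ?thesis unfolding complex_vector.span_insert by blast
      qed
      ultimately show ?thesis using span by metis
    qed
  qed
  moreover obtain C where "finite C" "C \<subseteq> U" "cspan C = U"
    using fin_dim_basis[OF fin_dim_subset[OF fin_dim assms(2)] assms(1)] by metis
  ultimately show thesis using that assms(2) by (metis subset_trans)
qed

section \<open>Orthogonal complements\<close>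

definition orthocomplement :: "'v set \<Rightarrow> 'v set" where
  "orthocomplement U = {w \<in> V. \<forall>y\<in>U. ip w y = 0}"

lemma subspace_orthocomplement: "U \<subseteq> V \<Longrightarrow> csubspace (orthocomplement U)"
  by (rule complex_vector.subspaceI)
    (auto simp: orthocomplement_def mem_zero mem_add mem_scale ip_zero_left ip_add_left
      ip_scale_left subset_iff)

lemma orthocomplement_Int: "U \<subseteq> V \<Longrightarrow> x \<in> U \<Longrightarrow> x \<in> orthocomplement U \<Longrightarrow> x = 0"
  using ip_self_eq_0 unfolding orthocomplement_def by blast

lemma orthogonal_decomposition:
  assumes "csubspace U" "U \<subseteq> V" "x \<in> V"
  obtains u w where "u \<in> U" "w \<in> orthocomplement U" "x = u + w"
proof -
  obtain B where B: "orthonormal B" "cspan B = U" using orthonormal_basis[OF assms(1,2)] by blast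
  let ?p = "\<Sum>e\<in>B. ip x e *\<^sub>C e"
  have p: "?p \<in> U" unfolding B(2)[symmetric]
    by (intro complex_vector.span_sum complex_vector.span_scale complex_vector.span_base)
  moreover have "x - ?p \<in> orthocomplement U"
    using orthonormal_residue[OF B(1) assms(3)] p assms(2,3) mem_diff
    unfolding orthocomplement_def B(2) by blast
  ultimately show thesis using that[of ?p "x - ?p"] by simp
qed

lemma orthogonal_decomposition_unique:
  assumes "csubspace U" "U \<subseteq> V" "u \<in> U" "w \<in> orthocomplement U" "u' \<in> U" "w' \<in> orthocomplement U"
    and "u + w = u' + w'"
  shows "u = u'"
proof -
  have "u - u' = w' - w" using assms(7) by (simp add: algebra_simps)
  moreover have "u - u' \<in> U" using complex_vector.subspace_diff assms by blast
  moreover have "w' - w \<in> orthocomplement U"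
    using complex_vector.subspace_diff subspace_orthocomplement assms by blast
  ultimately have "u - u' = 0" using orthocomplement_Int[OF assms(2)] by metis
  then show ?thesis by simp
qed

text \<open>The left-hand side is the trace of the rank-one operator
  \<open>\<lambda>y. ip y x *\<^sub>C x\<close> in the basis \<open>B\<close>; it is left in this
  form for the trace computation in \<open>reproducing\<close>.\<close>

lemma parseval:
  assumes "orthonormal B" "cspan B = V" "x \<in> V"
  shows "(\<Sum>e\<in>B. ip e x * ip x e) = ip x x"
proof -
  have B: "finite B" "B \<subseteq> V" using assms(1) unfolding orthonormal_def by auto
  let ?p = "\<Sum>e\<in>B. ip x e *\<^sub>C e"
  have p: "?p \<in> V" using B by (auto intro!: mem_sum mem_scale)
  have "ip (x - ?p) (x - ?p) = 0"
    using orthonormal_residue[OF assms(1,3)] assms(2,3) p mem_diff by blast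
  then have "x = ?p" using ip_self_eq_0 p assms(3) mem_diff by fastforce
  then have "ip x x = ip ?p x" by simp
  also have "\<dots> = (\<Sum>e\<in>B. ip x e * ip e x)"
    using B assms(3) by (subst ip_sum_left) (auto intro!: mem_scale sum.cong ip_scale_left)
  finally show ?thesis by (simp add: mult.commute)
qed

end

section \<open>Unitary representations\<close>

text \<open>Unlike \<open>rep_Hom\<close>, this says nothing off the space of \<sigma>, so
  compositions and restrictions to invariant subspaces need no adjustment of values.\<close>

definition intertwiner ::
    "('g, 'm) monoid_scheme \<Rightarrow> ('g, 'w::complex_vector) urep \<Rightarrow> ('g, 'v::complex_vector) urep \<Rightarrow>
     ('w \<Rightarrow> 'v) \<Rightarrow> bool" where
  "intertwiner G \<sigma> \<rho> T \<longleftrightarrow>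
    T \<in> rspace \<sigma> \<rightarrow> rspace \<rho> \<and> clinear_on (rspace \<sigma>) T \<and>
    (\<forall>g\<in>carrier G. \<forall>x\<in>rspace \<sigma>. T (ract \<sigma> g x) = ract \<rho> g (T x))"

lemma rep_Hom_iff: "T \<in> rep_Hom G \<sigma> \<rho> \<longleftrightarrow> intertwiner G \<sigma> \<rho> T \<and> (\<forall>x. x \<notin> rspace \<sigma> \<longrightarrow> T x = 0)"
  unfolding rep_Hom_def intertwiner_def by blast

lemma subspace_rep_Hom:
  assumes "csubspace (rspace \<tau>)" "\<And>g. g \<in> carrier G \<Longrightarrow> clinear_on (rspace \<tau>) (ract \<tau> g)"
  shows "csubspace (rep_Hom G \<sigma> \<tau>)"
  by (rule complex_vector.subspaceI)
    (auto simp: rep_Hom_def clinear_on_def scaleC_fun_def Pi_iff complex_vector.subspace_0[OF assms(1)]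
      complex_vector.subspace_add[OF assms(1)] complex_vector.subspace_scale[OF assms(1)]
      clinear_on_zero[OF assms(2,1)] clinear_on_add[OF assms(2)] clinear_on_scale[OF assms(2)]
      scaleC_add_right scaleC_scaleC mult.commute)

lemma intertwiner_mem: "intertwiner G \<sigma> \<rho> T \<Longrightarrow> x \<in> rspace \<sigma> \<Longrightarrow> T x \<in> rspace \<rho>"
  and intertwiner_linear: "intertwiner G \<sigma> \<rho> T \<Longrightarrow> clinear_on (rspace \<sigma>) T"
  and intertwiner_act: "intertwiner G \<sigma> \<rho> T \<Longrightarrow> g \<in> carrier G \<Longrightarrow> x \<in> rspace \<sigma> \<Longrightarrow>
    T (ract \<sigma> g x) = ract \<rho> g (T x)"
  unfolding intertwiner_def by blast+

lemma intertwiner_compose: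
  "intertwiner G \<sigma> \<rho> S \<Longrightarrow> intertwiner G \<rho> \<tau> T \<Longrightarrow> intertwiner G \<sigma> \<tau> (\<lambda>x. T (S x))"
  by (simp add: intertwiner_def clinear_on_def Pi_iff)

lemma invariant_subspace_act:
  "invariant_subspace G \<rho> U \<Longrightarrow> g \<in> carrier G \<Longrightarrow> x \<in> U \<Longrightarrow> ract \<rho> g x \<in> U"
  unfolding invariant_subspace_def by blast

lemma invariant_subspace_restrict:
  assumes "invariant_subspace G \<rho> U"
  shows "invariant_subspace G (\<rho>\<lparr>rspace := U\<rparr>) W \<longleftrightarrow> invariant_subspace G \<rho> W \<and> W \<subseteq> U"
  using assms unfolding invariant_subspace_def by auto

section \<open>Invariant subspaces and complete reducibility\<close>

locale unitary_representation = group G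
  for G :: "('g, 'm) monoid_scheme" (structure) +
  fixes \<rho> :: "('g, 'v::complex_vector) urep"
  assumes unitary: "unitary_rep G \<rho>"
begin

sublocale inner_product_space "rspace \<rho>" "rinner \<rho>"
  using unitary unfolding unitary_rep_def by unfold_locales blast

lemma act_mem: "g \<in> carrier G \<Longrightarrow> x \<in> rspace \<rho> \<Longrightarrow> ract \<rho> g x \<in> rspace \<rho>"
  and act_linear: "g \<in> carrier G \<Longrightarrow> clinear_on (rspace \<rho>) (ract \<rho> g)"
  and act_one: "x \<in> rspace \<rho> \<Longrightarrow> ract \<rho> \<one> x = x"
  and act_mult: "g \<in> carrier G \<Longrightarrow> h \<in> carrier G \<Longrightarrow> x \<in> rspace \<rho> \<Longrightarrow>
    ract \<rho> (g \<otimes> h) x = ract \<rho> g (ract \<rho> h x)"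
  and inner_act: "g \<in> carrier G \<Longrightarrow> x \<in> rspace \<rho> \<Longrightarrow> y \<in> rspace \<rho> \<Longrightarrow>
    rinner \<rho> (ract \<rho> g x) (ract \<rho> g y) = rinner \<rho> x y"
  using unitary unfolding unitary_rep_def by (blast, blast, blast, blast, blast)

lemma act_act_inv: "g \<in> carrier G \<Longrightarrow> x \<in> rspace \<rho> \<Longrightarrow> ract \<rho> g (ract \<rho> (inv g) x) = x"
  using act_mult[of g "inv g" x] act_one by simp

lemma inner_act_left:
  "g \<in> carrier G \<Longrightarrow> x \<in> rspace \<rho> \<Longrightarrow> y \<in> rspace \<rho> \<Longrightarrow>
    rinner \<rho> (ract \<rho> g x) y = rinner \<rho> x (ract \<rho> (inv g) y)"
  using inner_act[of g x "ract \<rho> (inv g) y"] act_act_inv act_mem by simp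

lemma unitary_rep_restrict:
  assumes "invariant_subspace G \<rho> U"
  shows "unitary_rep G (\<rho>\<lparr>rspace := U\<rparr>)"
proof -
  have U: "csubspace U" "U \<subseteq> rspace \<rho>" using assms unfolding invariant_subspace_def by auto
  obtain B where B: "finite B" "cspan B = U"
    using fin_dim_basis[OF fin_dim_subset[OF fin_dim U(2)] U(1)] by metis
  have "fd_inner_product_space U (rinner \<rho>)"
    unfolding fd_inner_product_space_def
  proof (intro conjI ballI impI)
    show "\<exists>B. finite B \<and> U = cspan B" using B by blast
    show "clinear_on U (\<lambda>x. rinner \<rho> x y)" if "y \<in> U" for y
      using that clinear_on_subset[OF ip_linear U(2)] U(2) by blast
    show "rinner \<rho> y x = cnj (rinner \<rho> x y)" if "x \<in> U" "y \<in> U" for x y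
      using ip_commute U(2) that by blast
    show "0 < Re (rinner \<rho> x x)" if "x \<in> U" "x \<noteq> 0" for x
      using ip_pos U(2) that by blast
  qed (fact U(1))
  then show ?thesis
    using U clinear_on_subset[OF act_linear U(2)] assms act_one act_mult inner_act
    unfolding unitary_rep_def invariant_subspace_def by (simp add: subset_iff)
qed

lemma invariant_subspace_UNIV: "invariant_subspace G \<rho> (rspace \<rho>)"
  unfolding invariant_subspace_def using subspace act_mem by blast

lemma invariant_orthocomplement:
  assumes "invariant_subspace G \<rho> U"
  shows "invariant_subspace G \<rho> (orthocomplement U)"
proof -
  have U: "csubspace U" "U \<subseteq> rspace \<rho>" using assms unfolding invariant_subspace_def by auto
  have "ract \<rho> g w \<in> orthocomplement U" if "g \<in> carrier G" "w \<in> orthocomplement U" for g w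
    using that U(2) act_mem inner_act_left invariant_subspace_act[OF assms inv_closed]
    unfolding orthocomplement_def by (auto simp: subset_iff)
  then show ?thesis
    unfolding invariant_subspace_def using subspace_orthocomplement[OF U(2)]
    by (auto simp: orthocomplement_def)
qed

text \<open>The orthogonal projection. U and its complement are both invariant, so the action
  carries the decomposition of x to that of its translate.\<close>

lemma projection_intertwiner:
  assumes "invariant_subspace G \<rho> U"
  shows "\<exists>P. intertwiner G \<rho> \<rho> P \<and> (\<forall>x\<in>rspace \<rho>. P x \<in> U) \<and> (\<forall>u\<in>U. P u = u)"
proof -
  have U: "csubspace U" "U \<subseteq> rspace \<rho>" using assms unfolding invariant_subspace_def by auto
  let ?W = "orthocomplement U"
  have W: "csubspace ?W" "?W \<subseteq> rspace \<rho>"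
    using subspace_orthocomplement[OF U(2)] unfolding orthocomplement_def by auto
  have "\<exists>u w. u \<in> U \<and> w \<in> ?W \<and> x = u + w" if "x \<in> rspace \<rho>" for x
    using orthogonal_decomposition[OF U that] by metis
  then obtain P Q where PQ: "\<And>x. x \<in> rspace \<rho> \<Longrightarrow> P x \<in> U \<and> Q x \<in> ?W \<and> x = P x + Q x"
    by metis
  \<comment> \<open>Linearity and equivariance of \<open>P\<close> follow by exhibiting a
    decomposition and appealing to this uniqueness.\<close>
  have uniq: "P x = u" if "u \<in> U" "w \<in> ?W" "x = u + w" for x u w
  proof -
    have "x \<in> rspace \<rho>" using that U(2) W(2) mem_add by blast
    then show ?thesis
      using orthogonal_decomposition_unique[OF U, of "P x" "Q x" u w] PQ that by metis
  qed
  have lin: "clinear_on (rspace \<rho>) P"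
  proof (rule clinear_onI)
    fix x y assume xy: "x \<in> rspace \<rho>" "y \<in> rspace \<rho>"
    have "x + y = (P x + Q x) + (P y + Q y)" using PQ[OF xy(1)] PQ[OF xy(2)] by metis
    also have "\<dots> = (P x + P y) + (Q x + Q y)" by (simp add: algebra_simps)
    finally have "x + y = (P x + P y) + (Q x + Q y)" .
    moreover have "P x + P y \<in> U" "Q x + Q y \<in> ?W"
      using PQ[OF xy(1)] PQ[OF xy(2)] complex_vector.subspace_add U(1) W(1) by metis+
    ultimately show "P (x + y) = P x + P y" using uniq by metis
  next
    fix c x assume x: "x \<in> rspace \<rho>"
    have "c *\<^sub>C x = c *\<^sub>C P x + c *\<^sub>C Q x"
      using PQ[OF x] by (metis scaleC_add_right)
    moreover have "c *\<^sub>C P x \<in> U" "c *\<^sub>C Q x \<in> ?W"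
      using PQ[OF x] complex_vector.subspace_scale U(1) W(1) by metis+
    ultimately show "P (c *\<^sub>C x) = c *\<^sub>C P x" using uniq by metis
  qed
  have "P (ract \<rho> g x) = ract \<rho> g (P x)" if g: "g \<in> carrier G" and x: "x \<in> rspace \<rho>" for g x
  proof -
    have "ract \<rho> g (P x + Q x) = ract \<rho> g (P x) + ract \<rho> g (Q x)"
      using PQ[OF x] U(2) W(2) by (intro clinear_on_add[OF act_linear[OF g]]) auto
    then have "ract \<rho> g x = ract \<rho> g (P x) + ract \<rho> g (Q x)"
      using PQ[OF x] by metis
    moreover have "ract \<rho> g (P x) \<in> U" "ract \<rho> g (Q x) \<in> ?W"
      using PQ[OF x] invariant_subspace_act[OF assms g]
        invariant_subspace_act[OF invariant_orthocomplement[OF assms] g] by metis+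
    ultimately show ?thesis using uniq by metis
  qed
  then have "intertwiner G \<rho> \<rho> P"
    unfolding intertwiner_def using lin PQ U(2) by blast
  moreover have "P u = u" if "u \<in> U" for u
    using uniq[OF that complex_vector.subspace_0[OF W(1)]] by simp
  ultimately show ?thesis using PQ by blast
qed

text \<open>An induction principle: a linear property of all vectors need only be checked on
  irreducible invariant subspaces. A nonzero U that is not irreducible splits into a proper
  invariant subspace and the complement of that in U, both of smaller dimension.\<close>

lemma complete_reducibility:
  assumes "csubspace X"
    and "\<And>U. invariant_subspace G \<rho> U \<Longrightarrow> irreducible_rep G (\<rho>\<lparr>rspace := U\<rparr>) \<Longrightarrow> U \<subseteq> X"
  shows "rspace \<rho> \<subseteq> X"
proof -
  have "U \<subseteq> X" if "invariant_subspace G \<rho> U" for U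
    using that
  proof (induction "cdim U" arbitrary: U rule: less_induct)
    case less
    have U: "csubspace U" "U \<subseteq> rspace \<rho>"
      using less.prems unfolding invariant_subspace_def by auto
    show ?case
    proof (cases "U = {0} \<or> irreducible_rep G (\<rho>\<lparr>rspace := U\<rparr>)")
      case True
      then show ?thesis using assms less.prems complex_vector.subspace_0 by blast
    next
      case False
      then obtain W where "invariant_subspace G (\<rho>\<lparr>rspace := U\<rparr>) W" "W \<noteq> {0}" "W \<noteq> U"
        using unitary_rep_restrict[OF less.prems] unfolding irreducible_rep_def by auto
      then have W: "invariant_subspace G \<rho> W" "W \<subseteq> U" "W \<noteq> {0}" "W \<noteq> U"
        using invariant_subspace_restrict[OF less.prems] by auto
      have sW: "csubspace W" "W \<subseteq> rspace \<rho>" using W(1) unfolding invariant_subspace_def by auto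
      let ?W' = "U \<inter> orthocomplement W"
      have W': "invariant_subspace G \<rho> ?W'"
        using less.prems invariant_orthocomplement[OF W(1)] complex_vector.subspace_inter
        unfolding invariant_subspace_def by blast
      then have sW': "csubspace ?W'" unfolding invariant_subspace_def by blast
      \<comment> \<open>A nonzero vector of \<open>W\<close> is not orthogonal to \<open>W\<close>,
        so the complement within \<open>U\<close> is proper and the induction hypothesis covers
        it.\<close>
      obtain w where w: "w \<in> W" "w \<noteq> 0" using W(3) complex_vector.subspace_0[OF sW(1)] by blast
      then have "w \<notin> ?W'" using orthocomplement_Int[OF sW(2)] by blast
      then have "?W' \<subset> U" using w(1) W(2) by blast
      then have sub: "W \<subseteq> X" "?W' \<subseteq> X"
        using less.hyps W W' dim_strict_mono[OF fin_dim_subset[OF fin_dim U(2)] U(1)] sW(1) sW'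
        by (meson psubsetI)+
      show ?thesis
      proof
        fix x assume x: "x \<in> U"
        then obtain u v where uv: "u \<in> W" "v \<in> orthocomplement W" "x = u + v"
          using orthogonal_decomposition[OF sW] U(2) by blast
        then have "v = x - u" by simp
        then have "v \<in> U" using x uv(1) W(2) complex_vector.subspace_diff[OF U(1)] by blast
        then show "x \<in> X" using uv sub complex_vector.subspace_add[OF assms(1)] by blast
      qed
    qed
  qed
  then show ?thesis using invariant_subspace_UNIV by blast
qed

end

section \<open>Irreducible representations and Schur's lemma\<close>

locale irreducible_representation = group G
  for G :: "('g, 'm) monoid_scheme" (structure) +
  fixes \<rho> :: "('g, 'v::complex_vector) urep"
  assumes irreducible: "irreducible_rep G \<rho>"
begin

sublocale unitary_representation
  using irreducible unfolding irreducible_rep_def by unfold_locales blast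

lemma nonzero_vector: obtains x where "x \<in> rspace \<rho>" "x \<noteq> 0"
  using irreducible mem_zero unfolding irreducible_rep_def by blast

lemma invariant_subspace_eq:
  "invariant_subspace G \<rho> U \<Longrightarrow> x \<in> U \<Longrightarrow> x \<noteq> 0 \<Longrightarrow> U = rspace \<rho>"
  using irreducible unfolding irreducible_rep_def by blast

text \<open>An eigenspace of A is invariant because A commutes with the action; it can be chosen
  nonzero, hence it is everything.\<close>

lemma schur:
  assumes "intertwiner G \<rho> \<rho> A"
  shows "\<exists>c. \<forall>x\<in>rspace \<rho>. A x = c *\<^sub>C x"
proof -
  have "rspace \<rho> \<noteq> {0}" using irreducible unfolding irreducible_rep_def by blast
  moreover have "A \<in> rspace \<rho> \<rightarrow> rspace \<rho>" using intertwiner_mem[OF assms] by blast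
  ultimately obtain c x where x: "x \<in> rspace \<rho>" "x \<noteq> 0" "A x = c *\<^sub>C x"
    using eigenvector_exists[OF intertwiner_linear[OF assms] subspace fin_dim] by metis
  let ?U = "{x \<in> rspace \<rho>. A x = c *\<^sub>C x}"
  note lin = intertwiner_linear[OF assms]
  have "invariant_subspace G \<rho> ?U"
    unfolding invariant_subspace_def
  proof (intro conjI ballI)
    show "csubspace ?U"
      by (rule complex_vector.subspaceI)
        (auto simp: mem_zero mem_add mem_scale clinear_on_zero[OF lin subspace]
          clinear_on_add[OF lin] clinear_on_scale[OF lin] scaleC_add_right scaleC_scaleC mult.commute)
    show "ract \<rho> g \<in> ?U \<rightarrow> ?U" if "g \<in> carrier G" for g
      using that by (auto simp: act_mem intertwiner_act[OF assms] clinear_on_scale[OF act_linear])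
  qed auto
  then have "?U = rspace \<rho>" using invariant_subspace_eq x by blast
  then show ?thesis by blast
qed

text \<open>The kernel is an invariant subspace. The pointwise form serves twice: a nonzero
  intertwiner is injective, and evaluation at one nonzero vector is injective on the space of
  intertwiners.\<close>

lemma intertwiner_eq_0:
  assumes "intertwiner G \<rho> \<tau> T" "unitary_rep G \<tau>" "x \<in> rspace \<rho>" "x \<noteq> 0" "T x = 0" "y \<in> rspace \<rho>"
  shows "T y = 0"
proof -
  interpret \<tau>: unitary_representation G \<tau> by unfold_locales (fact assms(2))
  let ?U = "{x \<in> rspace \<rho>. T x = 0}"
  note lin = intertwiner_linear[OF assms(1)]
  have "invariant_subspace G \<rho> ?U"
    unfolding invariant_subspace_def
  proof (intro conjI ballI)
    show "csubspace ?U"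
      by (rule complex_vector.subspaceI)
        (auto simp: mem_zero mem_add mem_scale clinear_on_zero[OF lin subspace]
          clinear_on_add[OF lin] clinear_on_scale[OF lin])
    show "ract \<rho> g \<in> ?U \<rightarrow> ?U" if "g \<in> carrier G" for g
      using that by (auto simp: act_mem intertwiner_act[OF assms(1)]
          clinear_on_zero[OF \<tau>.act_linear \<tau>.subspace])
  qed auto
  then have "?U = rspace \<rho>" using invariant_subspace_eq assms(3-5) by blast
  then show ?thesis using assms(6) by blast
qed

lemma intertwiner_inj_on:
  assumes "intertwiner G \<rho> \<tau> T" "unitary_rep G \<tau>" "x \<in> rspace \<rho>" "T x \<noteq> 0"
  shows "inj_on T (rspace \<rho>)"
  using clinear_on_inj_on[OF intertwiner_linear[OF assms(1)] subspace]
    intertwiner_eq_0[OF assms(1,2) _ _ _ assms(3)] assms(4) by blast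

text \<open>Trades the dimension in \<open>rep_multiplicity\<close> for proportionality, which can
  be used without any normalisation off the space.\<close>

lemma rep_multiplicity_le_1_iff:
  assumes "unitary_rep G \<tau>"
  shows "rep_multiplicity G \<rho> \<tau> \<le> 1 \<longleftrightarrow>
    (\<forall>S T. intertwiner G \<rho> \<tau> S \<longrightarrow> intertwiner G \<rho> \<tau> T \<longrightarrow> (\<exists>x\<in>rspace \<rho>. T x \<noteq> 0) \<longrightarrow>
      (\<exists>c. \<forall>x\<in>rspace \<rho>. S x = c *\<^sub>C T x))" (is "_ \<longleftrightarrow> ?R")
proof -
  interpret \<tau>: unitary_representation G \<tau> by unfold_locales (fact assms)
  let ?H = "rep_Hom G \<rho> \<tau>"
  have sH: "csubspace ?H" by (rule subspace_rep_Hom[OF \<tau>.subspace \<tau>.act_linear])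
  \<comment> \<open>Evaluation at \<open>w\<close> embeds the intertwiners into the space of \<tau>.
    Without this finiteness a dimension of at most 1 would say nothing, as infinite dimensions count
    as 0.\<close>
  obtain w where w: "w \<in> rspace \<rho>" "w \<noteq> 0" by (rule nonzero_vector)
  have "clinear_on ?H (\<lambda>T. T w)" by (rule clinear_onI) (auto simp: scaleC_fun_def)
  moreover from this sH have "inj_on (\<lambda>T. T w) ?H"
  proof (rule clinear_on_inj_on)
    fix T assume T: "T \<in> ?H" "T w = 0"
    have "T x = 0" for x
      using T intertwiner_eq_0[OF _ assms w, of T x] unfolding rep_Hom_iff by blast
    then show "T = 0" by (simp add: fun_eq_iff)
  qed
  moreover have "(\<lambda>T. T w) ` ?H \<subseteq> rspace \<tau>" using w(1) by (auto simp: rep_Hom_def)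
  ultimately have fH: "fin_dim ?H" using fin_dim_inj sH \<tau>.fin_dim by blast
  \<comment> \<open>Intertwiners enter \<open>rep_Hom\<close> after being set to 0 off the space of
    \<rho>.\<close>
  let ?cut = "\<lambda>T x. if x \<in> rspace \<rho> then T x else 0"
  have cut: "?cut T \<in> ?H" if "intertwiner G \<rho> \<tau> T" for T
    using that by (auto simp: rep_Hom_def intertwiner_def clinear_on_def act_mem mem_add mem_scale)
  show ?thesis
  proof
    assume L: "rep_multiplicity G \<rho> \<tau> \<le> 1"
    show ?R
    proof (intro allI impI)
      fix S T assume ST: "intertwiner G \<rho> \<tau> S" "intertwiner G \<rho> \<tau> T" "\<exists>x\<in>rspace \<rho>. T x \<noteq> 0"
      then have "?cut T \<noteq> 0" by (auto simp: fun_eq_iff)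
      moreover have "cdim ?H \<le> 1" using L by (simp add: rep_multiplicity_def)
      ultimately obtain c where "?cut S = c *\<^sub>C ?cut T"
        using cdim_le_1_proportional[OF fH sH _ cut[OF ST(2)] cut[OF ST(1)]] by metis
      then have cut_eq: "?cut S x = (c *\<^sub>C ?cut T) x" for x by (rule fun_cong)
      have "S x = c *\<^sub>C T x" if "x \<in> rspace \<rho>" for x
        using cut_eq[of x] that by (simp add: scaleC_fun_def)
      then show "\<exists>c. \<forall>x\<in>rspace \<rho>. S x = c *\<^sub>C T x" by blast
    qed
  next
    assume R: ?R
    have "\<exists>T. ?H \<subseteq> cspan {T}"
    proof (cases "?H \<subseteq> {0}")
      case True
      then show ?thesis using complex_vector.span_zero by blast
    next
      case False
      then obtain T where T: "T \<in> ?H" "T \<noteq> 0" by blast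
      then have nz: "\<exists>x\<in>rspace \<rho>. T x \<noteq> 0" by (auto simp: rep_Hom_def fun_eq_iff)
      have "S \<in> cspan {T}" if "S \<in> ?H" for S
      proof -
        have "intertwiner G \<rho> \<tau> S" "intertwiner G \<rho> \<tau> T" using that T by (auto simp: rep_Hom_iff)
        then obtain c where c: "\<forall>x\<in>rspace \<rho>. S x = c *\<^sub>C T x" using R nz by blast
        have "S x = (c *\<^sub>C T) x" for x
          using c that T(1) by (cases "x \<in> rspace \<rho>") (auto simp: rep_Hom_def scaleC_fun_def)
        then have "S = c *\<^sub>C T" by blast
        then show ?thesis by (simp add: complex_vector.span_base complex_vector.span_scale)
      qed
      then show ?thesis by blast
    qed
    then obtain T where "?H \<subseteq> cspan {T}" by blast
    then show "rep_multiplicity G \<rho> \<tau> \<le> 1"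
      unfolding rep_multiplicity_def using complex_vector.dim_le_card[of ?H "{T}"] by simp
  qed
qed

end

lemma (in group) intertwiner_inv_into:
  assumes "unitary_rep G \<sigma>" "intertwiner G \<sigma> \<rho> T" "inj_on T (rspace \<sigma>)"
  shows "intertwiner G (\<rho>\<lparr>rspace := T ` rspace \<sigma>\<rparr>) \<sigma> (inv_into (rspace \<sigma>) T)"
proof -
  interpret \<sigma>: unitary_representation G \<sigma> by unfold_locales (fact assms(1))
  have "inv_into (rspace \<sigma>) T (ract \<rho> g (T x)) = ract \<sigma> g x"
    if "g \<in> carrier G" "x \<in> rspace \<sigma>" for g x
    using that assms(3) intertwiner_act[OF assms(2) that] \<sigma>.act_mem by (metis inv_into_f_f)
  then show ?thesis
    using assms(3) clinear_on_inv_into[OF intertwiner_linear[OF assms(2)] \<sigma>.subspace assms(3)]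
    unfolding intertwiner_def by (auto simp: inv_into_into)
qed

lemma (in group) invariant_image:
  assumes "unitary_rep G \<sigma>" "intertwiner G \<sigma> \<rho> T" "invariant_subspace G \<sigma> U"
  shows "invariant_subspace G \<rho> (T ` U)"
proof -
  have U: "csubspace U" "U \<subseteq> rspace \<sigma>" using assms(3) unfolding invariant_subspace_def by auto
  have "ract \<rho> g (T x) \<in> T ` U" if "g \<in> carrier G" "x \<in> U" for g x
    using invariant_subspace_act[OF assms(3) that] intertwiner_act[OF assms(2)] that U(2)
    by (metis imageI subsetD)
  moreover have "csubspace (T ` U)"
    using clinear_on_image_subspace[OF clinear_on_subset[OF intertwiner_linear[OF assms(2)] U(2)] U(1)] .
  ultimately show ?thesis
    using intertwiner_mem[OF assms(2)] U(2) unfolding invariant_subspace_def by blast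
qed

section \<open>Multiplicity-freeness and commuting endomorphisms\<close>

context unitary_representation
begin

text \<open>The inverse of T is itself an intertwiner and carries an invariant subspace of the image
  back to one of \<sigma>.\<close>

lemma irreducible_image:
  assumes "irreducible_rep G \<sigma>" "intertwiner G \<sigma> \<rho> T" "inj_on T (rspace \<sigma>)"
  shows "invariant_subspace G \<rho> (T ` rspace \<sigma>)" "irreducible_rep G (\<rho>\<lparr>rspace := T ` rspace \<sigma>\<rparr>)"
proof -
  interpret \<sigma>: irreducible_representation G \<sigma> by unfold_locales (fact assms(1))
  let ?U = "T ` rspace \<sigma>"
  show inv: "invariant_subspace G \<rho> ?U"
    by (rule invariant_image[OF \<sigma>.unitary assms(2) \<sigma>.invariant_subspace_UNIV])
  have uU: "unitary_rep G (\<rho>\<lparr>rspace := ?U\<rparr>)" by (rule unitary_rep_restrict[OF inv])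
  have T0: "T 0 = 0" using clinear_on_zero[OF intertwiner_linear[OF assms(2)] \<sigma>.subspace] .
  obtain x where x: "x \<in> rspace \<sigma>" "x \<noteq> 0" by (rule \<sigma>.nonzero_vector)
  then have "T x \<noteq> 0" using assms(3) T0 \<sigma>.mem_zero by (metis inj_onD)
  moreover have "W = {0} \<or> W = ?U" if W: "invariant_subspace G (\<rho>\<lparr>rspace := ?U\<rparr>) W" for W
  proof -
    let ?S = "inv_into (rspace \<sigma>) T"
    have "invariant_subspace G \<sigma> (?S ` W)"
      by (rule invariant_image[OF uU intertwiner_inv_into[OF \<sigma>.unitary assms(2,3)] W])
    then have "?S ` W = {0} \<or> ?S ` W = rspace \<sigma>"
      using assms(1) unfolding irreducible_rep_def by blast
    moreover have "T ` ?S ` W = W"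
      using W unfolding invariant_subspace_def by (auto simp: image_image f_inv_into_f subset_iff)
    ultimately show ?thesis using T0 by (metis image_empty image_insert)
  qed
  ultimately show "irreducible_rep G (\<rho>\<lparr>rspace := ?U\<rparr>)"
    unfolding irreducible_rep_def using uU x(1) by auto
qed

text \<open>The inclusion of U and the restriction of E are two intertwiners from the same
  irreducible representation, so they are proportional. That E maps U into itself is part of the
  conclusion.\<close>

lemma multiplicity_free_scalar:
  assumes "multiplicity_free G \<rho>" "intertwiner G \<rho> \<rho> E"
    and "invariant_subspace G \<rho> U" "irreducible_rep G (\<rho>\<lparr>rspace := U\<rparr>)"
  shows "\<exists>c. \<forall>x\<in>U. E x = c *\<^sub>C x"
proof -
  let ?\<sigma> = "\<rho>\<lparr>rspace := U\<rparr>"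
  interpret \<sigma>: irreducible_representation G ?\<sigma> by unfold_locales (fact assms(4))
  have U: "U \<subseteq> rspace \<rho>" using assms(3) unfolding invariant_subspace_def by blast
  have "intertwiner G ?\<sigma> \<rho> (\<lambda>x. x)"
    using U by (auto simp: intertwiner_def clinear_on_def)
  moreover have "intertwiner G ?\<sigma> \<rho> E"
    using intertwiner_mem[OF assms(2)] intertwiner_act[OF assms(2)] U
      clinear_on_subset[OF intertwiner_linear[OF assms(2)] U]
    by (auto simp: intertwiner_def subset_iff)
  moreover have "\<exists>x\<in>rspace ?\<sigma>. x \<noteq> 0" using \<sigma>.nonzero_vector by blast
  moreover have "rep_multiplicity G ?\<sigma> \<rho> \<le> 1"
    using assms(1,4) unfolding multiplicity_free_def by blast
  ultimately obtain c where "\<forall>x\<in>rspace ?\<sigma>. E x = c *\<^sub>C x"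
    using \<sigma>.rep_multiplicity_le_1_iff[OF unitary] by blast
  then show ?thesis by auto
qed

text \<open>The vectors on which E and F commute form a subspace, and on an irreducible invariant
  subspace both maps are scalars; \<open>complete_reducibility\<close> does the rest.\<close>

lemma multiplicity_free_imp_commute:
  assumes "multiplicity_free G \<rho>" "intertwiner G \<rho> \<rho> E" "intertwiner G \<rho> \<rho> F" "x \<in> rspace \<rho>"
  shows "E (F x) = F (E x)"
proof -
  let ?X = "{x \<in> rspace \<rho>. E (F x) = F (E x)}"
  note EF = intertwiner_compose[OF assms(3,2)] and FE = intertwiner_compose[OF assms(2,3)]
  note lin = intertwiner_linear[OF EF] intertwiner_linear[OF FE]
  have "csubspace ?X"
    by (rule complex_vector.subspaceI)
      (auto simp: mem_zero mem_add mem_scale clinear_on_zero[OF lin(1) subspace]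
        clinear_on_zero[OF lin(2) subspace] clinear_on_add[OF lin(1)] clinear_on_add[OF lin(2)]
        clinear_on_scale[OF lin(1)] clinear_on_scale[OF lin(2)])
  moreover have "U \<subseteq> ?X"
    if U: "invariant_subspace G \<rho> U" "irreducible_rep G (\<rho>\<lparr>rspace := U\<rparr>)" for U
  proof
    fix x assume x: "x \<in> U"
    then have x': "x \<in> rspace \<rho>" using U(1) unfolding invariant_subspace_def by blast
    obtain a where "\<forall>x\<in>U. E x = a *\<^sub>C x"
      using multiplicity_free_scalar[OF assms(1,2) U] by blast
    moreover obtain b where "\<forall>x\<in>U. F x = b *\<^sub>C x"
      using multiplicity_free_scalar[OF assms(1,3) U] by blast
    ultimately show "x \<in> ?X"
      using x x' clinear_on_scale[OF intertwiner_linear[OF assms(2)] x']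
        clinear_on_scale[OF intertwiner_linear[OF assms(3)] x']
      by (simp add: scaleC_scaleC mult.commute)
  qed
  ultimately have "rspace \<rho> \<subseteq> ?X" by (rule complete_reducibility)
  then show ?thesis using assms(4) by blast
qed

text \<open>
  If \<open>T\<close> embeds the irreducible \<open>\<sigma>\<close> and \<open>P\<close> projects onto its image, then \<open>S T\<^sup>-\<^sup>1 P\<close> commutes
  with \<open>P\<close>, which forces the image of \<open>S\<close> into that of \<open>T\<close>; Schur's lemma applies to \<open>T\<^sup>-\<^sup>1 S\<close>.
\<close>

lemma commute_imp_multiplicity_free:
  assumes "\<And>E F x. intertwiner G \<rho> \<rho> E \<Longrightarrow> intertwiner G \<rho> \<rho> F \<Longrightarrow> x \<in> rspace \<rho> \<Longrightarrow> E (F x) = F (E x)"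
  shows "multiplicity_free G \<rho>"
  unfolding multiplicity_free_def
proof (intro allI impI)
  fix \<sigma> :: "('g, 'v) urep" assume "irreducible_rep G \<sigma>"
  then interpret \<sigma>: irreducible_representation G \<sigma> by unfold_locales
  have "\<exists>c. \<forall>x\<in>rspace \<sigma>. S x = c *\<^sub>C T x"
    if S: "intertwiner G \<sigma> \<rho> S" and T: "intertwiner G \<sigma> \<rho> T" and nz: "\<exists>x\<in>rspace \<sigma>. T x \<noteq> 0" for S T
  proof -
    have inj: "inj_on T (rspace \<sigma>)" using nz \<sigma>.intertwiner_inj_on[OF T unitary] by blast
    let ?U = "T ` rspace \<sigma>" and ?R = "inv_into (rspace \<sigma>) T"
    have inv: "invariant_subspace G \<rho> ?U" using irreducible_image(1)[OF \<sigma>.irreducible T inj] .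
    have R: "intertwiner G (\<rho>\<lparr>rspace := ?U\<rparr>) \<sigma> ?R"
      by (rule intertwiner_inv_into[OF \<sigma>.unitary T inj])
    obtain P where P: "intertwiner G \<rho> \<rho> P" "\<forall>x\<in>rspace \<rho>. P x \<in> ?U" "\<forall>u\<in>?U. P u = u"
      using projection_intertwiner[OF inv] by blast
    have "intertwiner G \<rho> (\<rho>\<lparr>rspace := ?U\<rparr>) P"
      using P(1,2) unfolding intertwiner_def by auto
    then have E: "intertwiner G \<rho> \<rho> (\<lambda>x. S (?R (P x)))"
      using intertwiner_compose[OF intertwiner_compose[OF _ R] S] by blast
    have SU: "S x \<in> ?U" if x: "x \<in> rspace \<sigma>" for x
    proof -
      have Tx: "T x \<in> rspace \<rho>" "P (T x) = T x" "?R (T x) = x"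
        using x P(3) intertwiner_mem[OF T] inj by auto
      then have "S x = P (S x)" using assms[OF E P(1) Tx(1)] by simp
      then show ?thesis using P(2) intertwiner_mem[OF S x] by metis
    qed
    then have "intertwiner G \<sigma> (\<rho>\<lparr>rspace := ?U\<rparr>) S"
      using S unfolding intertwiner_def by auto
    then obtain c where c: "\<forall>x\<in>rspace \<sigma>. ?R (S x) = c *\<^sub>C x"
      using \<sigma>.schur[OF intertwiner_compose[OF _ R]] by blast
    have "S x = c *\<^sub>C T x" if x: "x \<in> rspace \<sigma>" for x
      using f_inv_into_f[OF SU[OF x]] bspec[OF c x] clinear_on_scale[OF intertwiner_linear[OF T] x] by metis
    then show ?thesis by blast
  qed
  then show "rep_multiplicity G \<sigma> \<rho> \<le> 1"
    using \<sigma>.rep_multiplicity_le_1_iff[OF unitary] by blast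
qed

end

section \<open>Convolution and the Hecke algebra\<close>

lemma (in group) m_inv_inv_mult:
  "x \<in> carrier G \<Longrightarrow> y \<in> carrier G \<Longrightarrow> x \<otimes> (inv x \<otimes> y) = y"
  "x \<in> carrier G \<Longrightarrow> y \<in> carrier G \<Longrightarrow> inv x \<otimes> (x \<otimes> y) = y"
  by (simp_all add: m_assoc[symmetric])

lemma (in group) sum_inverse:
  assumes "subgroup H G"
  shows "(\<Sum>k\<in>H. f (inv k)) = (\<Sum>k\<in>H. f k)"
  by (rule sum.reindex_bij_witness[of _ "\<lambda>k. inv k" "\<lambda>k. inv k"])
    (use subgroup.m_inv_closed[OF assms] subgroup.mem_carrier[OF assms] in auto)

lemma (in group) sum_left_mult:
  assumes "subgroup H G" "h \<in> H"
  shows "(\<Sum>k\<in>H. f (h \<otimes> k)) = (\<Sum>k\<in>H. f k)"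
  by (rule sum.reindex_bij_witness[of _ "\<lambda>k. inv h \<otimes> k" "\<lambda>k. h \<otimes> k"])
    (use assms subgroup.m_inv_closed[OF assms(1)] subgroup.mem_carrier[OF assms(1)]
      subgroup.m_closed[OF assms(1)] in \<open>auto simp: m_inv_inv_mult\<close>)

lemma (in group) sum_right_mult:
  assumes "subgroup H G" "h \<in> H"
  shows "(\<Sum>k\<in>H. f (k \<otimes> h)) = (\<Sum>k\<in>H. f k)"
  by (rule sum.reindex_bij_witness[of _ "\<lambda>k. k \<otimes> inv h" "\<lambda>k. k \<otimes> h"])
    (use assms subgroup.m_inv_closed[OF assms(1)] subgroup.mem_carrier[OF assms(1)]
      subgroup.m_closed[OF assms(1)] in \<open>auto simp: m_assoc\<close>)

context group
begin

definition translate :: "'a \<Rightarrow> ('a \<Rightarrow> complex) \<Rightarrow> 'a \<Rightarrow> complex" where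
  "translate h f = (\<lambda>x. if x \<in> carrier G then f (inv h \<otimes> x) else 0)"

lemma gconv_in_functions_on: "gconv G f1 f2 \<in> functions_on (carrier G)"
  by (simp add: functions_on_def gconv_def)

text \<open>The substitution x = g h gives the form in which the left factor supplies weights for
  translates of the right one.\<close>

lemma gconv_eq:
  assumes "g \<in> carrier G"
  shows "gconv G f1 f2 g = (\<Sum>x\<in>carrier G. f1 x * f2 (inv x \<otimes> g))"
proof -
  have "gconv G f1 f2 g = (\<Sum>h\<in>carrier G. f1 (g \<otimes> h) * f2 (inv (g \<otimes> h) \<otimes> g))"
    unfolding gconv_def using assms by (auto intro!: sum.cong simp: inv_mult_group m_assoc)
  also have "\<dots> = (\<Sum>x\<in>carrier G. f1 x * f2 (inv x \<otimes> g))"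
    by (rule sum_left_mult[OF subgroup_self assms])
  finally show ?thesis .
qed

lemma gconv_assoc: "gconv G (gconv G a b) c = gconv G a (gconv G b c)"
proof
  fix g show "gconv G (gconv G a b) c g = gconv G a (gconv G b c) g"
  proof (cases "g \<in> carrier G")
    case True
    have "gconv G (gconv G a b) c g =
        (\<Sum>y\<in>carrier G. \<Sum>x\<in>carrier G. a x * b (inv x \<otimes> y) * c (inv y \<otimes> g))"
      using True by (simp add: gconv_eq sum_distrib_right)
    also have "\<dots> = (\<Sum>x\<in>carrier G. \<Sum>y\<in>carrier G. a x * b (inv x \<otimes> y) * c (inv y \<otimes> g))"
      by (rule sum.swap)
    also have "\<dots> = (\<Sum>x\<in>carrier G. a x * (\<Sum>z\<in>carrier G. b z * c (inv z \<otimes> (inv x \<otimes> g))))"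
    proof (rule sum.cong[OF refl])
      fix x assume x: "x \<in> carrier G"
      have "(\<Sum>z\<in>carrier G. b z * c (inv z \<otimes> (inv x \<otimes> g))) =
          (\<Sum>y\<in>carrier G. b (inv x \<otimes> y) * c (inv (inv x \<otimes> y) \<otimes> (inv x \<otimes> g)))"
        by (rule sum_left_mult[OF subgroup_self, symmetric]) (use x in simp)
      also have "\<dots> = (\<Sum>y\<in>carrier G. b (inv x \<otimes> y) * c (inv y \<otimes> g))"
        using x True by (intro sum.cong) (auto simp: inv_mult_group m_assoc m_inv_inv_mult)
      finally show "(\<Sum>y\<in>carrier G. a x * b (inv x \<otimes> y) * c (inv y \<otimes> g)) =
          a x * (\<Sum>z\<in>carrier G. b z * c (inv z \<otimes> (inv x \<otimes> g)))"
        by (simp add: sum_distrib_left mult.assoc)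
    qed
    also have "\<dots> = gconv G a (gconv G b c) g"
      using True by (simp add: gconv_eq)
    finally show ?thesis .
  qed (simp add: gconv_def)
qed

lemma gconv_add_left: "gconv G (a + b) c = gconv G a c + gconv G b c"
  and gconv_add_right: "gconv G c (a + b) = gconv G c a + gconv G c b"
  and gconv_scale_left: "gconv G (z *\<^sub>C a) c = z *\<^sub>C gconv G a c"
  and gconv_scale_right: "gconv G c (z *\<^sub>C a) = z *\<^sub>C gconv G c a"
  by (auto simp: gconv_def fun_eq_iff scaleC_fun_def scaleC_complex_def algebra_simps
      sum.distrib sum_distrib_left)

lemma gconv_zero_right: "gconv G c 0 = 0"
  by (simp add: gconv_def fun_eq_iff)

text \<open>Hence a linear map that commutes with left translations commutes with left convolutions.
  This is what turns an endomorphism into a right convolution.\<close>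

lemma gconv_eq_sum_translate:
  "gconv G a b = (\<Sum>h\<in>carrier G. a h *\<^sub>C translate h b)"
proof -
  have "(\<Sum>h\<in>A. a h *\<^sub>C translate h b) g = (\<Sum>h\<in>A. a h *\<^sub>C translate h b g)" for A g
    by (induction A rule: infinite_finite_induct) (simp_all add: scaleC_fun_def)
  moreover have "gconv G a b g = (\<Sum>h\<in>carrier G. a h *\<^sub>C translate h b g)" for g
  proof (cases "g \<in> carrier G")
    case True
    then show ?thesis by (simp add: gconv_eq translate_def scaleC_complex_def)
  qed (simp add: gconv_def translate_def scaleC_complex_def)
  ultimately show ?thesis by (simp add: fun_eq_iff)
qed

lemma gconv_translate:
  assumes "h \<in> carrier G"
  shows "gconv G (translate h a) b = translate h (gconv G a b)"
  using assms by (auto simp: fun_eq_iff gconv_def translate_def m_assoc intro!: sum.cong)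

end

section \<open>The setting of the theorem and the reproducing formula\<close>

locale hecke_setting = group G for G :: "('g, 'm) monoid_scheme" (structure) +
  fixes K :: "'g set" and \<theta> :: "('g, 'v::complex_vector) urep" and v :: 'v
  assumes finite_carrier: "finite (carrier G)"
    and subgroup_K: "subgroup K G"
    and irreducible_\<theta>: "irreducible_rep (G\<lparr>carrier := K\<rparr>) \<theta>"
    and v_mem: "v \<in> rspace \<theta>"
    and v_norm: "rnorm \<theta> v = 1"
begin

sublocale \<theta>: irreducible_representation "G\<lparr>carrier := K\<rparr>" \<theta>
  using subgroup.subgroup_is_group[OF subgroup_K] irreducible_\<theta> group_axioms
  by (simp add: irreducible_representation_def irreducible_representation_axioms_def)

abbreviation "V \<equiv> rspace \<theta>"
abbreviation "ip \<equiv> rinner \<theta>"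
abbreviation "act \<equiv> ract \<theta>"
abbreviation "\<rho> \<equiv> ind_rep G K \<theta>"
abbreviation "\<psi> \<equiv> hecke_psi K \<theta> v"
abbreviation "tv \<equiv> T_vec G K \<theta> v"
abbreviation "H \<equiv> hecke_algebra G K \<psi>"
abbreviation "I \<equiv> I_space G K \<theta> v"

text \<open>The constant of the Schur orthogonality relations; \<open>hecke_psi\<close> carries its
  reciprocal.\<close>

definition \<kappa> :: complex where "\<kappa> = of_nat (card K) / of_nat (cdim V)"

lemma K_carrier: "k \<in> K \<Longrightarrow> k \<in> carrier G"
  and K_mult: "k \<in> K \<Longrightarrow> l \<in> K \<Longrightarrow> k \<otimes> l \<in> K"
  and K_inv: "k \<in> K \<Longrightarrow> inv k \<in> K"
  and K_one: "\<one> \<in> K"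
  using subgroup.mem_carrier[OF subgroup_K] subgroup.m_closed[OF subgroup_K]
    subgroup.m_inv_closed[OF subgroup_K] subgroup.one_closed[OF subgroup_K] by auto

lemma finite_K: "finite K"
  using finite_subset[OF _ finite_carrier] K_carrier by blast

lemma card_K: "card K > 0"
  using finite_K K_one card_gt_0_iff by blast

lemma act_mem: "k \<in> K \<Longrightarrow> x \<in> V \<Longrightarrow> act k x \<in> V"
  and act_linear: "k \<in> K \<Longrightarrow> clinear_on V (act k)"
  and act_one: "x \<in> V \<Longrightarrow> act \<one> x = x"
  and act_mult: "k \<in> K \<Longrightarrow> l \<in> K \<Longrightarrow> x \<in> V \<Longrightarrow> act (k \<otimes> l) x = act k (act l x)"
  and ip_act: "k \<in> K \<Longrightarrow> x \<in> V \<Longrightarrow> y \<in> V \<Longrightarrow> ip (act k x) (act k y) = ip x y"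
  using \<theta>.act_mem[of k x] \<theta>.act_linear[of k] \<theta>.act_one[of x] \<theta>.act_mult[of k l x] \<theta>.inner_act[of k x y]
  by simp_all

lemma act_inv_cancel: "k \<in> K \<Longrightarrow> x \<in> V \<Longrightarrow> act k (act (inv k) x) = x"
  "k \<in> K \<Longrightarrow> x \<in> V \<Longrightarrow> act (inv k) (act k x) = x"
  using act_mult[of k "inv k" x] act_mult[of "inv k" k x] K_inv K_carrier act_one by auto

lemma ip_act_left: "k \<in> K \<Longrightarrow> x \<in> V \<Longrightarrow> y \<in> V \<Longrightarrow> ip (act k x) y = ip x (act (inv k) y)"
  using ip_act[of k x "act (inv k) y"] act_inv_cancel K_inv act_mem by simp

lemma ip_act_right: "k \<in> K \<Longrightarrow> x \<in> V \<Longrightarrow> y \<in> V \<Longrightarrow> ip x (act k y) = ip (act (inv k) x) y"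
  using ip_act[of k "act (inv k) x" y] act_inv_cancel K_inv act_mem by simp

lemma act_sum: "k \<in> K \<Longrightarrow> (\<And>i. i \<in> A \<Longrightarrow> x i \<in> V) \<Longrightarrow> act k (\<Sum>i\<in>A. x i) = (\<Sum>i\<in>A. act k (x i))"
  by (rule clinear_on_sum[OF act_linear \<theta>.subspace])

lemma act_scale: "k \<in> K \<Longrightarrow> x \<in> V \<Longrightarrow> act k (c *\<^sub>C x) = c *\<^sub>C act k x"
  by (rule clinear_on_scale[OF act_linear])

lemma ip_v_v: "ip v v = 1"
proof -
  have "Re (ip v v) = 1" using v_norm unfolding rnorm_def by simp
  then show ?thesis using \<theta>.ip_self[OF v_mem] by simp
qed

lemma dim_V_pos: "cdim V > 0"
proof -
  obtain B where B: "finite B" "cspan B = V" "card B = cdim V"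
    using fin_dim_basis[OF \<theta>.fin_dim \<theta>.subspace] by metis
  have "v \<noteq> 0" using ip_v_v \<theta>.ip_zero_left[OF v_mem] by auto
  then have "B \<noteq> {}" using B(2) v_mem by auto
  then show ?thesis using B card_gt_0_iff by metis
qed

lemma \<kappa>_nonzero: "\<kappa> \<noteq> 0"
  unfolding \<kappa>_def using card_K dim_V_pos by simp

text \<open>
  This is the only consequence of the Schur orthogonality relations that is needed: by Schur's
  lemma the sum is a multiple of \<open>x\<close>, and the factor is found by taking traces.
\<close>

lemma reproducing:
  assumes "x \<in> V"
  shows "(\<Sum>k\<in>K. ip (act k x) v *\<^sub>C act (inv k) v) = \<kappa> *\<^sub>C x"
proof -
  \<comment> \<open>\<open>A\<close> is the sum over K of the conjugates of the rank-one projection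
    onto v.\<close>
  define A where "A x = (\<Sum>k\<in>K. ip (act k x) v *\<^sub>C act (inv k) v)" for x
  have A_mem: "A x \<in> V" for x
    unfolding A_def by (intro \<theta>.mem_sum \<theta>.mem_scale act_mem K_inv v_mem)
  have "clinear_on V A"
    by (rule clinear_onI)
      (simp_all add: A_def clinear_on_add[OF act_linear] act_scale \<theta>.ip_add_left \<theta>.ip_scale_left
        act_mem v_mem scaleC_add_left sum.distrib complex_vector.scale_sum_right scaleC_scaleC)
  moreover have "A (act h x) = act h (A x)" if h: "h \<in> K" and x: "x \<in> V" for h x
  proof -
    have "act h (A x) = (\<Sum>k\<in>K. ip (act k x) v *\<^sub>C act (h \<otimes> inv k) v)"
      unfolding A_def using h
      by (subst act_sum) (auto intro!: sum.cong \<theta>.mem_scale act_mem K_inv v_mem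
          simp: act_scale act_mult act_mem K_inv v_mem)
    also have "\<dots> = (\<Sum>k\<in>K. ip (act (k \<otimes> h) x) v *\<^sub>C act (h \<otimes> inv (k \<otimes> h)) v)"
      by (rule sum_right_mult[OF subgroup_K h, symmetric])
    also have "\<dots> = A (act h x)"
      unfolding A_def using h x
      by (intro sum.cong) (auto simp: act_mult inv_mult_group K_carrier K_inv m_inv_inv_mult)
    finally show ?thesis ..
  qed
  ultimately have "intertwiner (G\<lparr>carrier := K\<rparr>) \<theta> \<theta> A"
    unfolding intertwiner_def using A_mem by auto
  then obtain c where c: "\<forall>x\<in>V. A x = c *\<^sub>C x" using \<theta>.schur by blast
  obtain B where B: "\<theta>.orthonormal B" "cspan B = V"
    using \<theta>.orthonormal_basis[OF \<theta>.subspace] by blast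
  then have BV: "finite B" "B \<subseteq> V" unfolding \<theta>.orthonormal_def by auto
  have cardB: "card B = cdim V"
    using complex_vector.dim_span_eq_card_independent[OF \<theta>.orthonormal_independent[OF B(1)]] B(2)
    by simp
  have "(\<Sum>e\<in>B. ip (A e) e) = (\<Sum>e\<in>B. c)"
    using B(1) BV c by (intro sum.cong) (auto simp: \<theta>.ip_scale_left \<theta>.orthonormal_def subset_iff)
  also have "\<dots> = of_nat (cdim V) * c" by (simp add: cardB)
  finally have "of_nat (cdim V) * c = (\<Sum>e\<in>B. ip (A e) e)" ..
  also have "\<dots> = (\<Sum>e\<in>B. \<Sum>k\<in>K. ip e (act (inv k) v) * ip (act (inv k) v) e)"
  proof (rule sum.cong[OF refl])
    fix e assume "e \<in> B"
    then have e: "e \<in> V" using BV by blast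
    show "ip (A e) e = (\<Sum>k\<in>K. ip e (act (inv k) v) * ip (act (inv k) v) e)"
      unfolding A_def using e
      by (subst \<theta>.ip_sum_left)
        (auto intro!: sum.cong \<theta>.mem_scale
          simp: \<theta>.ip_scale_left ip_act_left act_mem K_inv v_mem)
  qed
  also have "\<dots> = (\<Sum>k\<in>K. \<Sum>e\<in>B. ip e (act (inv k) v) * ip (act (inv k) v) e)"
    by (rule sum.swap)
  \<comment> \<open>By Parseval each conjugate has as trace the squared norm of a translate of v,
    which is 1.\<close>
  also have "\<dots> = (\<Sum>k\<in>K. 1)"
    using \<theta>.parseval[OF B] act_mem K_inv v_mem ip_act ip_v_v by (intro sum.cong) auto
  finally have "c = \<kappa>" unfolding \<kappa>_def using dim_V_pos by (simp add: field_simps)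
  then show ?thesis using c assms unfolding A_def by blast
qed

text \<open>The version with k inverted suits induced functions: there F(g k) = \<theta>(k)^-1 F(g),
  so for x = F(g) the coefficients are those of F along the coset gK.\<close>

lemma reproducing':
  assumes "x \<in> V"
  shows "(\<Sum>k\<in>K. ip (act (inv k) x) v *\<^sub>C act k v) = \<kappa> *\<^sub>C x"
proof -
  have "(\<Sum>k\<in>K. ip (act (inv k) x) v *\<^sub>C act k v) =
      (\<Sum>k\<in>K. ip (act (inv (inv k)) x) v *\<^sub>C act (inv k) v)"
    by (rule sum_inverse[OF subgroup_K, symmetric])
  also have "\<dots> = (\<Sum>k\<in>K. ip (act k x) v *\<^sub>C act (inv k) v)"
    by (intro sum.cong) (auto simp: K_carrier)
  finally show ?thesis using reproducing[OF assms] by simp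
qed

lemma reproducing_ip:
  assumes "x \<in> V" "y \<in> V"
  shows "(\<Sum>k\<in>K. ip (act (inv k) x) v * ip (act k v) y) = \<kappa> * ip x y"
proof -
  have "ip (\<Sum>k\<in>K. ip (act (inv k) x) v *\<^sub>C act k v) y = (\<Sum>k\<in>K. ip (act (inv k) x) v * ip (act k v) y)"
    using assms(2) by (subst \<theta>.ip_sum_left)
      (auto intro!: sum.cong \<theta>.mem_scale simp: \<theta>.ip_scale_left act_mem v_mem)
  then show ?thesis using reproducing'[OF assms(1)] assms by (simp add: \<theta>.ip_scale_left)
qed

lemma \<psi>_K: "k \<in> K \<Longrightarrow> \<psi> k = ip v (act k v) / \<kappa>"
  by (simp add: hecke_psi_def \<kappa>_def)

lemma \<psi>_inv: "k \<in> K \<Longrightarrow> \<psi> (inv k) = ip (act k v) v / \<kappa>"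
  using \<psi>_K[OF K_inv] ip_act_right[OF K_inv] v_mem K_carrier by simp

lemma \<psi>_outside: "g \<notin> K \<Longrightarrow> \<psi> g = 0"
  by (simp add: hecke_psi_def)

text \<open>As psi lives on K, the equation f * psi = f becomes an averaging identity over the coset
  gK, the form in which it meets \<open>reproducing_ip\<close>.\<close>

lemma gconv_\<psi>_right:
  assumes "g \<in> carrier G"
  shows "gconv G f \<psi> g = (\<Sum>k\<in>K. f (g \<otimes> k) * ip (act k v) v) / \<kappa>"
proof -
  have "gconv G f \<psi> g = (\<Sum>h\<in>carrier G. f (g \<otimes> h) * \<psi> (inv h))"
    using assms by (simp add: gconv_def)
  also have "\<dots> = (\<Sum>k\<in>K. f (g \<otimes> k) * \<psi> (inv k))"
  proof (rule sum.mono_neutral_right[OF finite_carrier])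
    show "\<forall>h\<in>carrier G - K. f (g \<otimes> h) * \<psi> (inv h) = 0"
      using K_inv \<psi>_outside inv_inv by (metis DiffE mult_zero_right)
  qed (use K_carrier in blast)
  also have "\<dots> = (\<Sum>k\<in>K. f (g \<otimes> k) * ip (act k v) v) / \<kappa>"
    by (simp add: \<psi>_inv sum_divide_distrib)
  finally show ?thesis .
qed

lemma gconv_\<psi>_left:
  assumes "g \<in> carrier G"
  shows "gconv G \<psi> f g = (\<Sum>k\<in>K. ip (act k v) v * f (k \<otimes> g)) / \<kappa>"
proof -
  have "gconv G \<psi> f g = (\<Sum>x\<in>carrier G. \<psi> x * f (inv x \<otimes> g))"
    using assms by (rule gconv_eq)
  also have "\<dots> = (\<Sum>k\<in>K. \<psi> k * f (inv k \<otimes> g))"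
    using K_carrier \<psi>_outside by (intro sum.mono_neutral_right[OF finite_carrier]) auto
  also have "\<dots> = (\<Sum>k\<in>K. \<psi> (inv k) * f (inv (inv k) \<otimes> g))"
    by (rule sum_inverse[OF subgroup_K, symmetric])
  also have "\<dots> = (\<Sum>k\<in>K. ip (act k v) v * f (k \<otimes> g)) / \<kappa>"
    by (simp add: \<psi>_inv sum_divide_distrib K_carrier)
  finally show ?thesis .
qed

section \<open>The induced representation is unitary\<close>

lemma \<rho>_iff: "F \<in> rspace \<rho> \<longleftrightarrow> (\<forall>g\<in>carrier G. F g \<in> V) \<and> (\<forall>g. g \<notin> carrier G \<longrightarrow> F g = 0) \<and>
    (\<forall>g\<in>carrier G. \<forall>k\<in>K. F (g \<otimes> k) = act (inv k) (F g))"
  by (simp add: ind_rep_def)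

lemma rinner_\<rho>: "rinner \<rho> F1 F2 = (\<Sum>g\<in>carrier G. ip (F1 g) (F2 g)) / of_nat (card K)"
  by (simp add: ind_rep_def)

lemma ract_\<rho>: "ract \<rho> g F x = (if x \<in> carrier G then F (inv g \<otimes> x) else 0)"
  by (simp add: ind_rep_def)

lemma subspace_\<rho>: "csubspace (rspace \<rho>)"
  by (rule complex_vector.subspaceI)
    (auto simp: \<rho>_iff \<theta>.mem_zero \<theta>.mem_add \<theta>.mem_scale scaleC_fun_def
      clinear_on_zero[OF act_linear \<theta>.subspace] clinear_on_add[OF act_linear] act_scale K_inv)

lemma fin_dim_\<rho>: "fin_dim (rspace \<rho>)"
  using fin_dim_supported_product[OF finite_carrier \<theta>.subspace \<theta>.fin_dim]
  by (rule fin_dim_subset) (auto simp: \<rho>_iff)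

lemma unitary_\<rho>: "unitary_rep G \<rho>"
  unfolding unitary_rep_def fd_inner_product_space_def
proof (intro conjI ballI impI)
  show "\<exists>B. finite B \<and> rspace \<rho> = cspan B"
    using fin_dim_basis[OF fin_dim_\<rho> subspace_\<rho>] by metis
next
  fix F' assume "F' \<in> rspace \<rho>"
  then show "clinear_on (rspace \<rho>) (\<lambda>F. rinner \<rho> F F')"
    by (intro clinear_onI)
      (auto simp: rinner_\<rho> \<rho>_iff \<theta>.ip_add_left \<theta>.ip_scale_left scaleC_fun_def sum.distrib
        add_divide_distrib scaleC_complex_def sum_distrib_left)
next
  fix F F' assume F: "F \<in> rspace \<rho>" "F' \<in> rspace \<rho>"
  then have "ip (F' g) (F g) = cnj (ip (F g) (F' g))" if "g \<in> carrier G" for g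
    using that \<theta>.ip_commute \<rho>_iff by blast
  then show "rinner \<rho> F' F = cnj (rinner \<rho> F F')"
    by (simp add: rinner_\<rho>)
next
  fix F assume F: "F \<in> rspace \<rho>" "F \<noteq> 0"
  then obtain g where "F g \<noteq> 0" by (auto simp: fun_eq_iff)
  then have g: "g \<in> carrier G" "F g \<noteq> 0" using F(1) \<rho>_iff by blast+
  have pos: "x \<in> V \<Longrightarrow> 0 \<le> Re (ip x x)" for x
    using \<theta>.ip_pos[of x] \<theta>.ip_zero_left[OF \<theta>.mem_zero] by (cases "x = 0") auto
  have "0 < (\<Sum>g\<in>carrier G. Re (ip (F g) (F g)))"
    using finite_carrier g(1)
  proof (rule sum_pos2)
    show "0 < Re (ip (F g) (F g))" using g F(1) \<theta>.ip_pos \<rho>_iff by blast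
    show "0 \<le> Re (ip (F h) (F h))" if "h \<in> carrier G" for h
      using that pos F(1) \<rho>_iff by blast
  qed
  then show "0 < Re (rinner \<rho> F F)" using card_K by (simp add: rinner_\<rho>)
next
  fix g assume g: "g \<in> carrier G"
  show "ract \<rho> g \<in> rspace \<rho> \<rightarrow> rspace \<rho>"
    using g by (auto simp: \<rho>_iff ract_\<rho> m_assoc[symmetric] K_carrier)
  show "clinear_on (rspace \<rho>) (ract \<rho> g)"
    by (rule clinear_onI) (simp_all add: fun_eq_iff ract_\<rho> scaleC_fun_def)
  fix F assume F: "F \<in> rspace \<rho>"
  { fix h assume "h \<in> carrier G"
    then show "ract \<rho> (g \<otimes> h) F = ract \<rho> g (ract \<rho> h F)"
      using g by (auto simp: fun_eq_iff ract_\<rho> inv_mult_group m_assoc) }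
  fix F' assume "F' \<in> rspace \<rho>"
  have "(\<Sum>x\<in>carrier G. ip (F (inv g \<otimes> x)) (F' (inv g \<otimes> x))) = (\<Sum>x\<in>carrier G. ip (F x) (F' x))"
    by (rule sum_left_mult[OF subgroup_self]) (use g in simp)
  then show "rinner \<rho> (ract \<rho> g F) (ract \<rho> g F') = rinner \<rho> F F'"
    by (simp add: rinner_\<rho> ract_\<rho>)
next
  fix F assume "F \<in> rspace \<rho>"
  then show "ract \<rho> \<one> F = F" by (auto simp: fun_eq_iff ract_\<rho> \<rho>_iff)
qed (fact subspace_\<rho>)

sublocale \<rho>: unitary_representation G \<rho>
  by unfold_locales (rule unitary_\<rho>)

section \<open>The embedding of the induced space into the group algebra\<close>

text \<open>The scaling factor of \<open>T_vec\<close>. Its square is 1 / \<kappa>: one factor comes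
  from applying the map, the other from the formula for its inverse.\<close>

definition \<gamma> :: complex where "\<gamma> = of_real (sqrt (real (cdim V) / real (card K)))"

lemma \<gamma>_nonzero: "\<gamma> \<noteq> 0"
  unfolding \<gamma>_def using card_K dim_V_pos by simp

lemma \<gamma>_square: "\<gamma> * \<gamma> = 1 / \<kappa>"
proof -
  have "\<gamma> * \<gamma> = of_real (real (cdim V) / real (card K))"
    unfolding \<gamma>_def by (simp flip: of_real_mult)
  then show ?thesis by (simp add: \<kappa>_def)
qed

lemma tv_eq: "tv F g = (if g \<in> carrier G then \<gamma> * ip (F g) v else 0)"
  by (simp add: T_vec_def \<gamma>_def)

lemma tv_linear: "clinear_on (rspace \<rho>) tv"
  by (rule clinear_onI)
    (auto simp: fun_eq_iff tv_eq \<rho>_iff \<theta>.ip_add_left \<theta>.ip_scale_left v_mem scaleC_fun_def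
      scaleC_complex_def algebra_simps)

text \<open>The coefficients of F along v on the coset gK determine F(g), by the reproducing
  formula.\<close>

lemma tv_inj: "inj_on tv (rspace \<rho>)"
proof (rule clinear_on_inj_on[OF tv_linear subspace_\<rho>])
  fix F assume F: "F \<in> rspace \<rho>" "tv F = 0"
  have 0: "ip (F g) v = 0" if "g \<in> carrier G" for g
    using fun_cong[OF F(2), of g] that \<gamma>_nonzero by (simp add: tv_eq)
  have "F g = 0" if g: "g \<in> carrier G" for g
  proof -
    have "\<kappa> *\<^sub>C F g = (\<Sum>k\<in>K. ip (act (inv k) (F g)) v *\<^sub>C act k v)"
      by (rule reproducing'[symmetric]) (use F(1) g \<rho>_iff in blast)
    also have "\<dots> = (\<Sum>k\<in>K. ip (F (g \<otimes> k)) v *\<^sub>C act k v)"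
      using F(1) g \<rho>_iff by (intro sum.cong) auto
    also have "\<dots> = 0" using 0 g K_carrier by (intro sum.neutral) auto
    finally show ?thesis using \<kappa>_nonzero by simp
  qed
  then show "F = 0" using F(1) \<rho>_iff by (auto simp: fun_eq_iff)
qed

lemma tv_ract: "g \<in> carrier G \<Longrightarrow> tv (ract \<rho> g F) = translate g (tv F)"
  by (auto simp: fun_eq_iff tv_eq ract_\<rho> translate_def)

text \<open>The reproducing formula shows that coefficients of induced functions are fixed by psi.
  Conversely it leaves one candidate for the preimage of f, and f * psi = f is just what makes this
  candidate map to f.\<close>

lemma I_iff: "f \<in> I \<longleftrightarrow> f \<in> functions_on (carrier G) \<and> gconv G f \<psi> = f"
proof
  assume "f \<in> I"
  then obtain F where F: "F \<in> rspace \<rho>" "f = tv F" unfolding I_space_def by blast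
  have "gconv G f \<psi> g = f g" if g: "g \<in> carrier G" for g
  proof -
    have Fg: "F g \<in> V" using F(1) g \<rho>_iff by blast
    have "(\<Sum>k\<in>K. f (g \<otimes> k) * ip (act k v) v) =
        \<gamma> * (\<Sum>k\<in>K. ip (act (inv k) (F g)) v * ip (act k v) v)"
      unfolding sum_distrib_left using F g by (intro sum.cong) (auto simp: tv_eq \<rho>_iff K_carrier)
    also have "\<dots> = \<kappa> * f g"
      using reproducing_ip[OF Fg v_mem] F g by (simp add: tv_eq)
    finally show ?thesis using gconv_\<psi>_right[OF g, of f] \<kappa>_nonzero by simp
  qed
  then show "f \<in> functions_on (carrier G) \<and> gconv G f \<psi> = f"
    using F by (auto simp: functions_on_def tv_eq fun_eq_iff gconv_def)
next
  assume f: "f \<in> functions_on (carrier G) \<and> gconv G f \<psi> = f"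
  \<comment> \<open>Solving \<open>tv F = f\<close> for \<open>F\<close> by the reproducing formula
    gives this sum with the factor 1 / (\<gamma> \<kappa>), which equals \<gamma>.\<close>
  define F where "F g = (if g \<in> carrier G then \<gamma> *\<^sub>C (\<Sum>k\<in>K. f (g \<otimes> k) *\<^sub>C act k v) else 0)" for g
  have S: "(\<Sum>k\<in>K. f (g \<otimes> k) *\<^sub>C act k v) \<in> V" for g
    by (intro \<theta>.mem_sum \<theta>.mem_scale act_mem v_mem)
  have "F (g \<otimes> l) = act (inv l) (F g)" if g: "g \<in> carrier G" and l: "l \<in> K" for g l
  proof -
    have "(\<Sum>k\<in>K. f (g \<otimes> l \<otimes> k) *\<^sub>C act k v) = (\<Sum>k\<in>K. f (g \<otimes> l \<otimes> (inv l \<otimes> k)) *\<^sub>C act (inv l \<otimes> k) v)"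
      by (rule sum_left_mult[OF subgroup_K K_inv[OF l], symmetric])
    also have "\<dots> = (\<Sum>k\<in>K. act (inv l) (f (g \<otimes> k) *\<^sub>C act k v))"
      using g l by (intro sum.cong)
        (auto simp: act_scale act_mult act_mem K_inv v_mem m_assoc K_carrier m_inv_inv_mult)
    also have "\<dots> = act (inv l) (\<Sum>k\<in>K. f (g \<otimes> k) *\<^sub>C act k v)"
      using l by (intro act_sum[symmetric]) (auto intro!: \<theta>.mem_scale act_mem v_mem K_inv)
    finally show ?thesis
      using g l S act_scale[OF K_inv[OF l] S] by (simp add: F_def K_carrier)
  qed
  then have "F \<in> rspace \<rho>" using S by (auto simp: \<rho>_iff F_def \<theta>.mem_scale)
  moreover have "tv F = f"
  proof
    fix g show "tv F g = f g"
    proof (cases "g \<in> carrier G")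
      case True
      have "ip (F g) v = \<gamma> * (\<Sum>k\<in>K. f (g \<otimes> k) * ip (act k v) v)"
        unfolding F_def using True S \<theta>.ip_scale_left[OF S v_mem]
        by (simp add: \<theta>.ip_sum_left \<theta>.ip_scale_left \<theta>.mem_scale act_mem v_mem)
      then have "tv F g = \<gamma> * \<gamma> * (\<Sum>k\<in>K. f (g \<otimes> k) * ip (act k v) v)"
        using True by (simp add: tv_eq)
      then show ?thesis using gconv_\<psi>_right[OF True, of f] f by (simp add: \<gamma>_square)
    qed (use f in \<open>simp add: tv_eq functions_on_def\<close>)
  qed
  ultimately show "f \<in> I" unfolding I_space_def by blast
qed

lemma subspace_I: "csubspace I"
  unfolding I_space_def by (rule clinear_on_image_subspace[OF tv_linear subspace_\<rho>])

text \<open>The preimage lives on K, where it sends k to a multiple of \<theta>(k)^-1 v. Its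
  existence puts psi into I, whence psi * psi = psi.\<close>

lemma \<psi>_preimage: obtains \<Psi> where "\<Psi> \<in> rspace \<rho>" "tv \<Psi> = \<psi>"
proof -
  define F where "F g = (if g \<in> K then \<gamma> *\<^sub>C act (inv g) v else 0)" for g
  have "F (g \<otimes> k) = act (inv k) (F g)" if "g \<in> carrier G" "k \<in> K" for g k
  proof (cases "g \<in> K")
    case True
    then show ?thesis
      using that by (simp add: F_def K_mult K_inv K_carrier inv_mult_group act_mult act_scale
          act_mem v_mem)
  next
    case False
    then have "g \<otimes> k \<notin> K"
      using that K_mult[OF _ K_inv[OF that(2)], of "g \<otimes> k"] by (auto simp: m_assoc K_carrier)
    then show ?thesis
      using False that clinear_on_zero[OF act_linear \<theta>.subspace] K_inv by (simp add: F_def)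
  qed
  then have "F \<in> rspace \<rho>"
    by (auto simp: \<rho>_iff F_def \<theta>.mem_zero K_carrier intro!: \<theta>.mem_scale act_mem K_inv v_mem)
  moreover have "tv F = \<psi>"
  proof
    fix g show "tv F g = \<psi> g"
    proof (cases "g \<in> K")
      case True
      then have "tv F g = \<gamma> * \<gamma> * ip (act (inv g) v) v"
        by (simp add: tv_eq F_def K_carrier \<theta>.ip_scale_left act_mem K_inv v_mem)
      then show ?thesis
        using True ip_act_right[OF True v_mem v_mem] by (simp add: \<gamma>_square \<psi>_K)
    qed (simp add: tv_eq F_def \<psi>_outside \<theta>.ip_zero_left v_mem)
  qed
  ultimately show thesis by (rule that)
qed

lemma \<psi>_in_I: "\<psi> \<in> I"
  unfolding I_space_def by (rule \<psi>_preimage) (rule image_eqI, rule sym)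

lemma \<psi>_idem: "gconv G \<psi> \<psi> = \<psi>"
  using \<psi>_in_I I_iff by blast

section \<open>The Hecke algebra as the algebra of endomorphisms\<close>

text \<open>Idempotence of psi splits the two-sided condition into one for each side; psi is then
  the unit of H.\<close>

lemma H_iff: "f \<in> H \<longleftrightarrow> f \<in> I \<and> gconv G \<psi> f = f"
proof
  assume "f \<in> H"
  then have f: "f \<in> functions_on (carrier G)" "f = gconv G (gconv G \<psi> f) \<psi>"
    unfolding hecke_algebra_def by auto
  have "gconv G f \<psi> = f" using f(2) gconv_assoc \<psi>_idem by metis
  moreover have "gconv G \<psi> f = f" using f(2) gconv_assoc \<psi>_idem by metis
  ultimately show "f \<in> I \<and> gconv G \<psi> f = f" using f(1) I_iff by blast
next
  assume "f \<in> I \<and> gconv G \<psi> f = f"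
  then show "f \<in> H" using I_iff by (simp add: hecke_algebra_def)
qed

lemma subspace_H: "csubspace H"
  using complex_vector.subspace_0[OF subspace_I] complex_vector.subspace_add[OF subspace_I]
    complex_vector.subspace_scale[OF subspace_I]
  by (intro complex_vector.subspaceI)
    (auto simp: H_iff gconv_add_right gconv_scale_right gconv_zero_right)

lemma fin_dim_H: "fin_dim H"
  using fin_dim_functions_on[OF finite_carrier]
  by (rule fin_dim_subset) (auto simp: hecke_algebra_def)

lemma gconv_in_I: "f \<in> H \<Longrightarrow> gconv G a f \<in> I"
  by (simp add: H_iff I_iff gconv_in_functions_on gconv_assoc)

lemma gconv_in_H: "f1 \<in> H \<Longrightarrow> f2 \<in> H \<Longrightarrow> gconv G f1 f2 \<in> H"
  using gconv_in_I[of f2 f1] gconv_assoc[of \<psi> f1 f2] by (simp add: H_iff)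

lemma tv_in_I: "F \<in> rspace \<rho> \<Longrightarrow> tv F \<in> I"
  by (simp add: I_space_def)

text \<open>Right convolution by f preserves I and commutes with left translations; the intertwiner
  is its transport through \<open>tv\<close>.\<close>

lemma intertwiner_of_H:
  assumes "f \<in> H"
  obtains E where "intertwiner G \<rho> \<rho> E" "\<forall>F\<in>rspace \<rho>. tv (E F) = gconv G (tv F) f"
proof -
  let ?E = "\<lambda>F. inv_into (rspace \<rho>) tv (gconv G (tv F) f)"
  have mem: "gconv G (tv F) f \<in> tv ` rspace \<rho>" for F
    using gconv_in_I[OF assms] unfolding I_space_def .
  then have tvE: "tv (?E F) = gconv G (tv F) f" for F by (rule f_inv_into_f)
  have E_mem: "?E F \<in> rspace \<rho>" for F using mem by (rule inv_into_into)
  have eqI: "?E F = F'" if "F' \<in> rspace \<rho>" "tv F' = gconv G (tv F) f" for F F'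
    using that tv_inj by (metis inv_into_f_f)
  note lin = clinear_on_add[OF tv_linear] clinear_on_scale[OF tv_linear]
  have "clinear_on (rspace \<rho>) ?E"
  proof (rule clinear_onI)
    fix F F' assume "F \<in> rspace \<rho>" "F' \<in> rspace \<rho>"
    then show "?E (F + F') = ?E F + ?E F'"
      by (intro eqI \<rho>.mem_add E_mem) (simp add: lin E_mem tvE gconv_add_left)
  next
    fix c F assume "F \<in> rspace \<rho>"
    then show "?E (c *\<^sub>C F) = c *\<^sub>C ?E F"
      by (intro eqI \<rho>.mem_scale E_mem) (simp add: lin E_mem tvE gconv_scale_left)
  qed
  moreover have "?E (ract \<rho> g F) = ract \<rho> g (?E F)" if "g \<in> carrier G" "F \<in> rspace \<rho>" for g F
    using that by (intro eqI \<rho>.act_mem E_mem) (simp_all add: tv_ract tvE gconv_translate)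
  ultimately have "intertwiner G \<rho> \<rho> ?E" unfolding intertwiner_def using E_mem by blast
  then show thesis using that tvE by blast
qed

text \<open>Every element of I is a combination of translates of psi, so E is determined by its
  value at the preimage of psi, and the image of that value under \<open>tv\<close> is the f
  sought.\<close>

lemma H_of_intertwiner:
  assumes "intertwiner G \<rho> \<rho> E"
  obtains f where "f \<in> H" "\<forall>F\<in>rspace \<rho>. tv (E F) = gconv G (tv F) f"
proof -
  obtain \<Psi> where \<Psi>: "\<Psi> \<in> rspace \<rho>" "tv \<Psi> = \<psi>"
    by (rule \<psi>_preimage)
  let ?f = "tv (E \<Psi>)"
  have E\<Psi>: "E \<Psi> \<in> rspace \<rho>" using intertwiner_mem[OF assms \<Psi>(1)] .
  have sum_tv: "tv (\<Sum>h\<in>carrier G. a h *\<^sub>C ract \<rho> h F) = gconv G a (tv F)"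
    if "F \<in> rspace \<rho>" for a F
  proof -
    have "tv (\<Sum>h\<in>carrier G. a h *\<^sub>C ract \<rho> h F) = (\<Sum>h\<in>carrier G. tv (a h *\<^sub>C ract \<rho> h F))"
      using that by (intro clinear_on_sum[OF tv_linear subspace_\<rho>] \<rho>.mem_scale \<rho>.act_mem)
    also have "\<dots> = (\<Sum>h\<in>carrier G. a h *\<^sub>C translate h (tv F))"
      using that by (intro sum.cong)
        (simp_all add: clinear_on_scale[OF tv_linear \<rho>.act_mem] tv_ract)
    finally show ?thesis by (simp add: gconv_eq_sum_translate)
  qed
  have tvE: "tv (E F) = gconv G (tv F) ?f" if F: "F \<in> rspace \<rho>" for F
  proof -
    let ?S = "\<Sum>h\<in>carrier G. tv F h *\<^sub>C ract \<rho> h \<Psi>"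
    have S: "?S \<in> rspace \<rho>" using \<Psi>(1) by (intro \<rho>.mem_sum \<rho>.mem_scale \<rho>.act_mem)
    have tvS: "tv F = tv ?S"
      using sum_tv[OF \<Psi>(1), of "tv F"] \<Psi>(2) tv_in_I[OF F] I_iff by simp
    have "F = ?S" by (rule inj_onD[OF tv_inj tvS F S])
    then have "E F = E ?S" by (rule arg_cong)
    also have "\<dots> = (\<Sum>h\<in>carrier G. E (tv F h *\<^sub>C ract \<rho> h \<Psi>))"
      using \<Psi>(1)
      by (intro clinear_on_sum[OF intertwiner_linear[OF assms] subspace_\<rho>] \<rho>.mem_scale \<rho>.act_mem)
    also have "\<dots> = (\<Sum>h\<in>carrier G. tv F h *\<^sub>C ract \<rho> h (E \<Psi>))"
      using \<Psi>(1) by (intro sum.cong)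
        (simp_all add: clinear_on_scale[OF intertwiner_linear[OF assms] \<rho>.act_mem]
          intertwiner_act[OF assms])
    finally show ?thesis using sum_tv[OF E\<Psi>, of "tv F"] by simp
  qed
  \<comment> \<open>Taking for F the preimage of psi gives f = psi * f, the half of membership in H
    that is not automatic.\<close>
  have "?f \<in> H" using H_iff tv_in_I[OF E\<Psi>] tvE[OF \<Psi>(1)] \<Psi>(2) by simp
  then show thesis using that tvE by blast
qed

lemma multiplicity_free_iff_commutative:
  "multiplicity_free G \<rho> \<longleftrightarrow> commutative_on (gconv G) H"
proof
  assume mf: "multiplicity_free G \<rho>"
  obtain \<Psi> where \<Psi>: "\<Psi> \<in> rspace \<rho>" "tv \<Psi> = \<psi>"
    by (rule \<psi>_preimage)
  have "gconv G f1 f2 = gconv G f2 f1" if f: "f1 \<in> H" "f2 \<in> H" for f1 f2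
  proof -
    obtain E where E: "intertwiner G \<rho> \<rho> E" "\<forall>F\<in>rspace \<rho>. tv (E F) = gconv G (tv F) f1"
      using intertwiner_of_H[OF f(1)] by blast
    obtain E' where E': "intertwiner G \<rho> \<rho> E'" "\<forall>F\<in>rspace \<rho>. tv (E' F) = gconv G (tv F) f2"
      using intertwiner_of_H[OF f(2)] by blast
    \<comment> \<open>At the preimage of psi, the unit of H, a composition becomes the bare product
      of \<open>f1\<close> and \<open>f2\<close> in reversed order.\<close>
    have "tv (E (E' \<Psi>)) = gconv G f2 f1" "tv (E' (E \<Psi>)) = gconv G f1 f2"
      using E E' \<Psi> intertwiner_mem[OF E(1) \<Psi>(1)] intertwiner_mem[OF E'(1) \<Psi>(1)] f H_iff by auto
    then show ?thesis using \<rho>.multiplicity_free_imp_commute[OF mf E(1) E'(1) \<Psi>(1)] by simp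
  qed
  then show "commutative_on (gconv G) H" unfolding commutative_on_def by blast
next
  assume comm: "commutative_on (gconv G) H"
  show "multiplicity_free G \<rho>"
  proof (rule \<rho>.commute_imp_multiplicity_free)
    fix E E' F assume E: "intertwiner G \<rho> \<rho> E" and E': "intertwiner G \<rho> \<rho> E'" and F: "F \<in> rspace \<rho>"
    obtain f where f: "f \<in> H" "\<forall>F\<in>rspace \<rho>. tv (E F) = gconv G (tv F) f"
      using H_of_intertwiner[OF E] by blast
    obtain f' where f': "f' \<in> H" "\<forall>F\<in>rspace \<rho>. tv (E' F) = gconv G (tv F) f'"
      using H_of_intertwiner[OF E'] by blast
    have mem: "E F \<in> rspace \<rho>" "E' F \<in> rspace \<rho>" "E (E' F) \<in> rspace \<rho>" "E' (E F) \<in> rspace \<rho>"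
      using F intertwiner_mem[OF E] intertwiner_mem[OF E'] by auto
    have "tv (E (E' F)) = gconv G (tv F) (gconv G f' f)" "tv (E' (E F)) = gconv G (tv F) (gconv G f f')"
      using f f' F mem gconv_assoc by auto
    moreover have "gconv G f f' = gconv G f' f"
      using comm f(1) f'(1) unfolding commutative_on_def by blast
    ultimately show "E (E' F) = E' (E F)" using tv_inj mem by (metis inj_onD)
  qed
qed

end

section \<open>Double cosets\<close>

context hecke_setting
begin

section \<open>Biequivariant operator-valued functions\<close>

text \<open>For the coefficient f of \<Phi> at v, the right condition yields f * psi = f and the
  left one psi * f = f.\<close>

definition biequivariant :: "('g \<Rightarrow> 'v \<Rightarrow> 'v) \<Rightarrow> bool" where
  "biequivariant \<Phi> \<longleftrightarrow>
    (\<forall>g\<in>carrier G. \<Phi> g \<in> V \<rightarrow> V \<and> clinear_on V (\<Phi> g)) \<and>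
    (\<forall>g\<in>carrier G. \<forall>k\<in>K. \<forall>x\<in>V. \<Phi> (k \<otimes> g) x = \<Phi> g (act (inv k) x)) \<and>
    (\<forall>g\<in>carrier G. \<forall>k\<in>K. \<forall>x\<in>V. \<Phi> (g \<otimes> k) x = act (inv k) (\<Phi> g x))"

lemma biequivariant_mem: "biequivariant \<Phi> \<Longrightarrow> g \<in> carrier G \<Longrightarrow> x \<in> V \<Longrightarrow> \<Phi> g x \<in> V"
  and biequivariant_linear: "biequivariant \<Phi> \<Longrightarrow> g \<in> carrier G \<Longrightarrow> clinear_on V (\<Phi> g)"
  and biequivariant_left: "biequivariant \<Phi> \<Longrightarrow> g \<in> carrier G \<Longrightarrow> k \<in> K \<Longrightarrow> x \<in> V \<Longrightarrow>
    \<Phi> (k \<otimes> g) x = \<Phi> g (act (inv k) x)"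
  and biequivariant_right: "biequivariant \<Phi> \<Longrightarrow> g \<in> carrier G \<Longrightarrow> k \<in> K \<Longrightarrow> x \<in> V \<Longrightarrow>
    \<Phi> (g \<otimes> k) x = act (inv k) (\<Phi> g x)"
  unfolding biequivariant_def by blast+

text \<open>On functions that are already biequivariant this is multiplication by the square of |K|.
  It is applied to rank-one operators weighted by f and to functions supported on double coset
  representatives. The value 0 off V is the normalisation of \<open>rep_Hom\<close>.\<close>

definition average :: "('g \<Rightarrow> 'v \<Rightarrow> 'v) \<Rightarrow> 'g \<Rightarrow> 'v \<Rightarrow> 'v" where
  "average B g x =
    (if x \<in> V then \<Sum>k\<in>K. \<Sum>l\<in>K. act l (B (k \<otimes> g \<otimes> l) (act k x)) else 0)"

text \<open>Translating g by an element of K on one side shifts one of the two summation variables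
  and leaves the other alone.\<close>

lemma biequivariant_average:
  assumes B: "\<And>h x. h \<in> carrier G \<Longrightarrow> x \<in> V \<Longrightarrow> B h x \<in> V"
    "\<And>h. h \<in> carrier G \<Longrightarrow> clinear_on V (B h)"
  shows "biequivariant (average B)"
proof -
  have mem: "average B g x \<in> V" if "g \<in> carrier G" "x \<in> V" for g x
    unfolding average_def using that by (auto intro!: \<theta>.mem_sum act_mem B simp: K_carrier)
  have lin: "clinear_on V (average B g)" if g: "g \<in> carrier G" for g
  proof (rule clinear_onI)
    fix x y assume "x \<in> V" "y \<in> V"
    then show "average B g (x + y) = average B g x + average B g y"
      using g by (simp add: average_def \<theta>.mem_add clinear_on_add[OF act_linear] act_mem
          clinear_on_add[OF B(2)] K_carrier B(1) sum.distrib)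
  next
    fix c x assume "x \<in> V"
    then show "average B g (c *\<^sub>C x) = c *\<^sub>C average B g x"
      using g by (simp add: average_def \<theta>.mem_scale act_scale act_mem
          clinear_on_scale[OF B(2)] K_carrier B(1) complex_vector.scale_sum_right)
  qed
  have left: "average B (h \<otimes> g) x = average B g (act (inv h) x)"
    if g: "g \<in> carrier G" and h: "h \<in> K" and x: "x \<in> V" for g h x
  proof -
    have "average B g (act (inv h) x) =
        (\<Sum>k\<in>K. \<Sum>l\<in>K. act l (B (k \<otimes> g \<otimes> l) (act k (act (inv h) x))))"
      using h x by (simp add: average_def act_mem K_inv)
    also have "\<dots> = (\<Sum>k\<in>K. \<Sum>l\<in>K. act l (B (k \<otimes> h \<otimes> g \<otimes> l) (act (k \<otimes> h) (act (inv h) x))))"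
      by (rule sum_right_mult[OF subgroup_K h, symmetric])
    also have "\<dots> = (\<Sum>k\<in>K. \<Sum>l\<in>K. act l (B (k \<otimes> (h \<otimes> g) \<otimes> l) (act k x)))"
      using g h x
      by (intro sum.cong) (auto simp: act_mult act_mem K_inv act_inv_cancel m_assoc K_carrier)
    also have "\<dots> = average B (h \<otimes> g) x" using x by (simp add: average_def)
    finally show ?thesis ..
  qed
  have right: "average B (g \<otimes> h) x = act (inv h) (average B g x)"
    if g: "g \<in> carrier G" and h: "h \<in> K" and x: "x \<in> V" for g h x
  proof -
    have Bmem: "B (k \<otimes> g \<otimes> l) (act k x) \<in> V" if "k \<in> K" "l \<in> K" for k l
      using that g x by (intro B(1) act_mem) (auto simp: K_carrier)
    have "act (inv h) (average B g x) =
        (\<Sum>k\<in>K. \<Sum>l\<in>K. act (inv h) (act l (B (k \<otimes> g \<otimes> l) (act k x))))"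
      using x h by (simp add: average_def act_sum K_inv \<theta>.mem_sum act_mem Bmem)
    also have "\<dots> = (\<Sum>k\<in>K. \<Sum>l\<in>K.
        act (inv h) (act (h \<otimes> l) (B (k \<otimes> g \<otimes> (h \<otimes> l)) (act k x))))"
      by (intro sum.cong refl sum_left_mult[OF subgroup_K h, symmetric])
    also have "\<dots> = (\<Sum>k\<in>K. \<Sum>l\<in>K. act l (B (k \<otimes> (g \<otimes> h) \<otimes> l) (act k x)))"
    proof (intro sum.cong refl)
      fix k l assume k: "k \<in> K" and l: "l \<in> K"
      have "k \<otimes> g \<otimes> (h \<otimes> l) = k \<otimes> (g \<otimes> h) \<otimes> l"
        using k l g h by (simp add: m_assoc K_carrier)
      then show "act (inv h) (act (h \<otimes> l) (B (k \<otimes> g \<otimes> (h \<otimes> l)) (act k x))) =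
          act l (B (k \<otimes> (g \<otimes> h) \<otimes> l) (act k x))"
        using Bmem[OF k K_mult[OF h l]] h l by (simp add: act_mult act_inv_cancel act_mem)
    qed
    also have "\<dots> = average B (g \<otimes> h) x" using x by (simp add: average_def)
    finally show ?thesis ..
  qed
  show ?thesis
    unfolding biequivariant_def
    by (simp add: Pi_iff mem lin left right)
qed

definition operator :: "('g \<Rightarrow> complex) \<Rightarrow> 'g \<Rightarrow> 'v \<Rightarrow> 'v" where
  "operator f = average (\<lambda>h x. (f h * ip x v) *\<^sub>C v)"

lemma operator_eq:
  "x \<in> V \<Longrightarrow> operator f g x =
    (\<Sum>k\<in>K. \<Sum>l\<in>K. (f (k \<otimes> g \<otimes> l) * ip (act k x) v) *\<^sub>C act l v)"
  by (simp add: operator_def average_def act_scale v_mem)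

lemma biequivariant_operator: "biequivariant (operator f)"
  unfolding operator_def
  by (rule biequivariant_average)
    (auto intro!: clinear_onI \<theta>.mem_scale simp: v_mem \<theta>.ip_add_left \<theta>.ip_scale_left
      scaleC_add_left scaleC_scaleC algebra_simps)

lemma operator_add: "operator (f1 + f2) g = operator f1 g + operator f2 g"
  and operator_scale: "operator (c *\<^sub>C f) g = c *\<^sub>C operator f g"
proof -
  show "operator (f1 + f2) g = operator f1 g + operator f2 g"
  proof
    fix x show "operator (f1 + f2) g x = (operator f1 g + operator f2 g) x"
      by (cases "x \<in> V")
        (simp_all add: operator_eq scaleC_add_left sum.distrib distrib_right,
          simp add: operator_def average_def)
  qed
  show "operator (c *\<^sub>C f) g = c *\<^sub>C operator f g"
  proof
    fix x show "operator (c *\<^sub>C f) g x = (c *\<^sub>C operator f g) x"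
      by (cases "x \<in> V")
        (simp_all add: operator_eq scaleC_fun_def scaleC_complex_def complex_vector.scale_sum_right
          scaleC_scaleC mult.assoc, simp add: operator_def average_def)
  qed
qed

lemma operator_scale_apply: "operator (c *\<^sub>C f) g x = c *\<^sub>C operator f g x"
  unfolding operator_scale by (simp only: scaleC_fun_def)

text \<open>The double sum is the square of \<kappa> times (psi * f * psi)(g). So an f in H can be
  read off from \<open>operator f\<close>.\<close>

lemma coefficient_operator:
  assumes f: "f \<in> H" and g: "g \<in> carrier G"
  shows "ip (operator f g v) v = \<kappa> * \<kappa> * f g"
proof -
  have right: "(\<Sum>l\<in>K. f (h \<otimes> l) * ip (act l v) v) = \<kappa> * f h" if "h \<in> carrier G" for h
    using gconv_\<psi>_right[OF that, of f] f \<kappa>_nonzero by (simp add: H_iff I_iff field_simps)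
  have left: "(\<Sum>k\<in>K. ip (act k v) v * f (k \<otimes> g)) = \<kappa> * f g"
    using gconv_\<psi>_left[OF g, of f] f \<kappa>_nonzero by (simp add: H_iff field_simps)
  have "ip (operator f g v) v =
      (\<Sum>k\<in>K. \<Sum>l\<in>K. f (k \<otimes> g \<otimes> l) * ip (act k v) v * ip (act l v) v)"
    by (simp add: operator_eq v_mem \<theta>.ip_sum_left \<theta>.mem_sum \<theta>.mem_scale act_mem \<theta>.ip_scale_left)
  also have "\<dots> = (\<Sum>k\<in>K. ip (act k v) v * (\<Sum>l\<in>K. f (k \<otimes> g \<otimes> l) * ip (act l v) v))"
    by (simp add: sum_distrib_left mult_ac)
  also have "\<dots> = (\<Sum>k\<in>K. ip (act k v) v * (\<kappa> * f (k \<otimes> g)))"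
    using g right by (intro sum.cong) (auto simp: K_carrier)
  also have "\<dots> = \<kappa> * (\<Sum>k\<in>K. ip (act k v) v * f (k \<otimes> g))"
    by (simp add: sum_distrib_left mult_ac)
  finally show ?thesis using left by simp
qed

text \<open>The reproducing formula is used once on each side of \<open>\<Phi> g\<close>, which
  accounts for the two factors \<kappa>.\<close>

lemma
  assumes \<Phi>: "biequivariant \<Phi>"
  defines "f \<equiv> \<lambda>g. if g \<in> carrier G then ip (\<Phi> g v) v else 0"
  shows coefficient_in_H: "f \<in> H"
    and operator_coefficient: "g \<in> carrier G \<Longrightarrow> x \<in> V \<Longrightarrow> operator f g x = (\<kappa> * \<kappa>) *\<^sub>C \<Phi> g x"
proof -
  \<comment> \<open>The reproducing formula for the argument \<open>x\<close>, pushed through the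
    linear map \<open>\<Phi> g\<close>.\<close>
  have \<Phi>_repr: "(\<Sum>k\<in>K. ip (act k x) v *\<^sub>C \<Phi> g (act (inv k) v)) = \<kappa> *\<^sub>C \<Phi> g x"
    if g: "g \<in> carrier G" and x: "x \<in> V" for g x
  proof -
    note lin = biequivariant_linear[OF \<Phi> g]
    have "(\<Sum>k\<in>K. ip (act k x) v *\<^sub>C \<Phi> g (act (inv k) v)) =
        (\<Sum>k\<in>K. \<Phi> g (ip (act k x) v *\<^sub>C act (inv k) v))"
      by (intro sum.cong) (simp_all add: clinear_on_scale[OF lin] act_mem K_inv v_mem)
    also have "\<dots> = \<Phi> g (\<Sum>k\<in>K. ip (act k x) v *\<^sub>C act (inv k) v)"
      by (intro clinear_on_sum[OF lin \<theta>.subspace, symmetric] \<theta>.mem_scale act_mem K_inv v_mem)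
    finally show ?thesis using reproducing[OF x] clinear_on_scale[OF lin x] by simp
  qed
  have \<Phi>v: "\<Phi> g v \<in> V" if "g \<in> carrier G" for g
    using biequivariant_mem[OF \<Phi> that v_mem] .
  show "f \<in> H"
    unfolding H_iff I_iff
  proof (intro conjI)
    show "f \<in> functions_on (carrier G)" by (simp add: f_def functions_on_def)
    show "gconv G f \<psi> = f"
    proof
      fix g show "gconv G f \<psi> g = f g"
      proof (cases "g \<in> carrier G")
        case True
        have "(\<Sum>k\<in>K. f (g \<otimes> k) * ip (act k v) v) = \<kappa> * f g"
          using reproducing_ip[OF \<Phi>v[OF True] v_mem] True
          by (simp add: f_def K_carrier biequivariant_right[OF \<Phi> True _ v_mem])
        then show ?thesis using gconv_\<psi>_right[OF True, of f] \<kappa>_nonzero by simp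
      qed (simp add: f_def gconv_def)
    qed
    show "gconv G \<psi> f = f"
    proof
      fix g show "gconv G \<psi> f g = f g"
      proof (cases "g \<in> carrier G")
        case True
        have "ip (\<Sum>k\<in>K. ip (act k v) v *\<^sub>C \<Phi> g (act (inv k) v)) v =
            (\<Sum>k\<in>K. ip (act k v) v * f (k \<otimes> g))"
          using True
          by (simp add: \<theta>.ip_sum_left \<theta>.ip_scale_left \<theta>.mem_scale v_mem act_mem K_inv f_def
              biequivariant_mem[OF \<Phi>] biequivariant_left[OF \<Phi>] K_carrier)
        then have "(\<Sum>k\<in>K. ip (act k v) v * f (k \<otimes> g)) = \<kappa> * f g"
          using \<Phi>_repr[OF True v_mem] True \<Phi>v by (simp add: \<theta>.ip_scale_left v_mem f_def)
        then show ?thesis using gconv_\<psi>_left[OF True, of f] \<kappa>_nonzero by simp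
      qed (simp add: f_def gconv_def)
    qed
  qed
  show "operator f g x = (\<kappa> * \<kappa>) *\<^sub>C \<Phi> g x" if g: "g \<in> carrier G" and x: "x \<in> V"
  proof -
    \<comment> \<open>The inner sum reproduces the vector \<open>\<Phi> g (act (inv k) v)\<close>;
      the outer one is then \<open>\<Phi>_repr\<close>.\<close>
    have "operator f g x = (\<Sum>k\<in>K. ip (act k x) v *\<^sub>C
        (\<Sum>l\<in>K. ip (act (inv l) (\<Phi> g (act (inv k) v))) v *\<^sub>C act l v))"
      using g x
      by (simp add: operator_eq f_def K_carrier biequivariant_right[OF \<Phi>] biequivariant_left[OF \<Phi>]
          v_mem complex_vector.scale_sum_right scaleC_scaleC mult.commute)
    also have "\<dots> = (\<Sum>k\<in>K. ip (act k x) v *\<^sub>C \<kappa> *\<^sub>C \<Phi> g (act (inv k) v))"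
      using g by (intro sum.cong)
        (simp_all add: reproducing' biequivariant_mem[OF \<Phi>] act_mem K_inv v_mem)
    also have "\<dots> = \<kappa> *\<^sub>C (\<Sum>k\<in>K. ip (act k x) v *\<^sub>C \<Phi> g (act (inv k) v))"
      by (simp add: complex_vector.scale_sum_right scaleC_scaleC mult.commute)
    finally show ?thesis using \<Phi>_repr[OF g x] by (simp add: scaleC_scaleC)
  qed
qed

section \<open>Intertwiners at double coset representatives\<close>

abbreviation double_Hom :: "'g \<Rightarrow> ('v \<Rightarrow> 'v) set" where
  "double_Hom s \<equiv> rep_Hom (G\<lparr>carrier := conj_inter G K s\<rparr>) \<theta> (conj_rep G s \<theta>)"

lemma conj_inter_iff:
  assumes "s \<in> carrier G"
  shows "x \<in> conj_inter G K s \<longleftrightarrow> x \<in> K \<and> inv s \<otimes> x \<otimes> s \<in> K"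
proof -
  have "x \<in> (s <# K) #> inv s \<longleftrightarrow> inv s \<otimes> x \<otimes> s \<in> K" if x: "x \<in> carrier G"
  proof
    assume "x \<in> (s <# K) #> inv s"
    then obtain k where "k \<in> K" "x = s \<otimes> k \<otimes> inv s" by (auto simp: l_coset_def r_coset_def)
    then show "inv s \<otimes> x \<otimes> s \<in> K" using assms by (simp add: m_assoc m_inv_inv_mult K_carrier)
  next
    assume k: "inv s \<otimes> x \<otimes> s \<in> K"
    have "x = s \<otimes> (inv s \<otimes> x \<otimes> s) \<otimes> inv s" using assms x by (simp add: m_assoc m_inv_inv_mult)
    then show "x \<in> (s <# K) #> inv s" using k unfolding l_coset_def r_coset_def by blast
  qed
  then show ?thesis unfolding conj_inter_def using K_carrier by blast
qed

lemma double_Hom_iff: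
  assumes "s \<in> carrier G"
  shows "T \<in> double_Hom s \<longleftrightarrow>
    T \<in> V \<rightarrow> V \<and> clinear_on V T \<and> (\<forall>x. x \<notin> V \<longrightarrow> T x = 0) \<and>
    (\<forall>k\<in>K. inv s \<otimes> k \<otimes> s \<in> K \<longrightarrow> (\<forall>x\<in>V. T (act k x) = act (inv s \<otimes> k \<otimes> s) (T x)))"
  by (auto simp: rep_Hom_def conj_rep_def conj_inter_iff[OF assms])

lemma subspace_double_Hom: "s \<in> carrier G \<Longrightarrow> csubspace (double_Hom s)"
  by (rule subspace_rep_Hom) (auto simp: conj_rep_def conj_inter_iff \<theta>.subspace act_linear)

text \<open>For k in \<open>conj_inter G K s\<close> the element k^-1 s is both a left and a right
  K-translate of s; comparing the two equivariance conditions there gives the intertwining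
  relation.\<close>

lemma biequivariant_double_Hom:
  assumes \<Phi>: "biequivariant \<Phi>" and s: "s \<in> carrier G" and zero: "\<And>x. x \<notin> V \<Longrightarrow> \<Phi> s x = 0"
  shows "\<Phi> s \<in> double_Hom s"
proof -
  have "\<Phi> s (act k x) = act (inv s \<otimes> k \<otimes> s) (\<Phi> s x)"
    if k: "k \<in> K" "inv s \<otimes> k \<otimes> s \<in> K" and x: "x \<in> V" for k x
  proof -
    let ?l = "inv s \<otimes> k \<otimes> s"
    have "inv k \<otimes> s = s \<otimes> inv ?l"
      using k s by (simp add: inv_mult_group m_assoc m_inv_inv_mult K_carrier)
    then have "\<Phi> (inv k \<otimes> s) x = \<Phi> (s \<otimes> inv ?l) x" by simp
    then show ?thesis
      using biequivariant_left[OF \<Phi> s K_inv[OF k(1)] x] k(1)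
        biequivariant_right[OF \<Phi> s K_inv[OF k(2)] x] k(2)
      by (simp add: K_carrier)
  qed
  then show ?thesis
    unfolding double_Hom_iff[OF s]
    using biequivariant_mem[OF \<Phi> s] biequivariant_linear[OF \<Phi> s] zero by blast
qed

text \<open>Ensures that the average of a function supported on S sees, at s, only the pairs (k, l)
  with k s l = s.\<close>

lemma double_coset_uniqueness:
  assumes S: "double_coset_representatives G K S" and s: "s \<in> S"
    and k: "k \<in> K" and l: "l \<in> K" and t: "k \<otimes> s \<otimes> l \<in> S"
  shows "k \<otimes> s \<otimes> l = s"
proof -
  have SG: "S \<subseteq> carrier G" using S unfolding double_coset_representatives_def by blast
  let ?t = "k \<otimes> s \<otimes> l"
  have tG: "?t \<in> carrier G" using SG t by blast
  have coset: "k' \<otimes> (u \<otimes> l') \<in> K <#> (u <# K)" if "k' \<in> K" "l' \<in> K" for k' l' u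
    using that unfolding set_mult_def l_coset_def by blast
  have "?t \<in> K <#> (s <# K)" using coset[OF k l, of s] s SG k l by (simp add: m_assoc K_carrier subset_iff)
  moreover have "?t \<in> K <#> (?t <# K)" using coset[OF K_one K_one, of ?t] tG by simp
  ultimately show ?thesis
    using S tG s t unfolding double_coset_representatives_def by blast
qed

text \<open>Prescribing values at k s l directly would require independence of the choice of k and
  l. Instead a function supported on S is averaged, and the intertwining relation makes all
  contributing terms at s equal.\<close>

lemma double_Hom_extend:
  assumes S: "double_coset_representatives G K S" and T: "\<And>s. s \<in> S \<Longrightarrow> T s \<in> double_Hom s"
  shows "\<exists>\<Phi>. biequivariant \<Phi> \<and> (\<forall>s\<in>S. \<forall>x\<in>V. \<Phi> s x = T s x)"
proof -
  have SG: "S \<subseteq> carrier G" using S unfolding double_coset_representatives_def by blast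
  \<comment> \<open>\<open>N s\<close> counts the terms that contribute at \<open>s\<close>; the
    pair of units is always one of them.\<close>
  define N :: "'g \<Rightarrow> complex" where "N s = of_nat (card {p \<in> K \<times> K. fst p \<otimes> s \<otimes> snd p = s})" for s
  have N: "N s \<noteq> 0" if "s \<in> S" for s
  proof -
    have "(\<one>, \<one>) \<in> {p \<in> K \<times> K. fst p \<otimes> s \<otimes> snd p = s}" using K_one SG that by auto
    moreover have "finite {p \<in> K \<times> K. fst p \<otimes> s \<otimes> snd p = s}" using finite_K by simp
    ultimately show ?thesis unfolding N_def by (auto simp: card_eq_0_iff)
  qed
  define B where "B h x = (if h \<in> S then (1 / N h) *\<^sub>C T h x else 0)" for h x
  have T_mem: "T s x \<in> V" if "s \<in> S" "x \<in> V" for s x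
    using that SG T[OF that(1)] double_Hom_iff[of s "T s"] by blast
  have T_lin: "clinear_on V (T s)" if "s \<in> S" for s
    using that SG T[OF that] double_Hom_iff[of s "T s"] by blast
  have T_act: "T s (act k x) = act (inv s \<otimes> k \<otimes> s) (T s x)"
    if "s \<in> S" "k \<in> K" "inv s \<otimes> k \<otimes> s \<in> K" "x \<in> V" for s k x
    using that SG T[OF that(1)] double_Hom_iff[of s "T s"] by blast
  have "biequivariant (average B)"
  proof (rule biequivariant_average)
    show "B h x \<in> V" if "x \<in> V" for h x
      using that T_mem by (auto simp: B_def \<theta>.mem_scale \<theta>.mem_zero)
    show "clinear_on V (B h)" for h
      by (rule clinear_onI)
        (auto simp: B_def clinear_on_add[OF T_lin] clinear_on_scale[OF T_lin] scaleC_add_right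
          scaleC_scaleC mult.commute)
  qed
  moreover have "average B s x = T s x" if s: "s \<in> S" and x: "x \<in> V" for s x
  proof -
    have sG: "s \<in> carrier G" using SG s by blast
    have term_eq: "act l (B (k \<otimes> s \<otimes> l) (act k x)) =
        (if k \<otimes> s \<otimes> l = s then (1 / N s) *\<^sub>C T s x else 0)" if k: "k \<in> K" and l: "l \<in> K" for k l
    proof (cases "k \<otimes> s \<otimes> l = s")
      case True
      \<comment> \<open>Here k s l = s forces s^-1 k s = l^-1, so k lies in
        \<open>conj_inter G K s\<close> and the action of l undoes what the intertwining relation
        produces.\<close>
      have "inv s \<otimes> (k \<otimes> s \<otimes> l) = \<one>" using True sG by simp
      then have "(inv s \<otimes> k \<otimes> s) \<otimes> l = \<one>" using sG k l by (simp add: m_assoc K_carrier)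
      then have il: "inv s \<otimes> k \<otimes> s = inv l"
        using sG k l inv_equality[of "inv s \<otimes> k \<otimes> s" l] by (simp add: K_carrier)
      then have "act l (T s (act k x)) = T s x"
        using T_act[OF s k _ x] act_inv_cancel(1)[OF l T_mem[OF s x]] K_inv[OF l] by simp
      then show ?thesis
        using True s T_mem[OF s act_mem[OF k x]] act_scale[OF l] by (simp add: B_def)
    next
      case False
      then have "k \<otimes> s \<otimes> l \<notin> S" using double_coset_uniqueness[OF S s k l] by blast
      then show ?thesis using False clinear_on_zero[OF act_linear[OF l] \<theta>.subspace] by (simp add: B_def)
    qed
    have "average B s x = (\<Sum>k\<in>K. \<Sum>l\<in>K. if k \<otimes> s \<otimes> l = s then (1 / N s) *\<^sub>C T s x else 0)"
      using x term_eq by (simp add: average_def)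
    also have "\<dots> = (\<Sum>p\<in>K \<times> K. if fst p \<otimes> s \<otimes> snd p = s then (1 / N s) *\<^sub>C T s x else 0)"
      by (simp add: sum.cartesian_product case_prod_unfold)
    also have "\<dots> = (\<Sum>p\<in>{p \<in> K \<times> K. fst p \<otimes> s \<otimes> snd p = s}. (1 / N s) *\<^sub>C T s x)"
      using finite_K by (intro sum.inter_filter[symmetric]) simp
    also have "\<dots> = (\<Sum>p\<in>{p \<in> K \<times> K. fst p \<otimes> s \<otimes> snd p = s}. 1 / N s) *\<^sub>C T s x"
      by (rule complex_vector.scale_sum_left[symmetric])
    also have "(\<Sum>p\<in>{p \<in> K \<times> K. fst p \<otimes> s \<otimes> snd p = s}. 1 / N s) = 1"
      using N[OF s] by (simp add: N_def)
    finally show ?thesis by (simp add: scaleC_one)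
  qed
  ultimately show ?thesis by blast
qed

text \<open>Evaluating \<open>operator f\<close> at the representatives is a linear bijection from H
  onto the product of the spaces of intertwiners.\<close>

lemma cdim_hecke_algebra_double_cosets:
  assumes S: "double_coset_representatives G K S"
  shows "cdim H = (\<Sum>s\<in>S. cdim (double_Hom s))"
proof -
  have SG: "S \<subseteq> carrier G" using S unfolding double_coset_representatives_def by blast
  have finS: "finite S" using SG finite_carrier finite_subset by blast
  let ?X = "{F. (\<forall>s\<in>S. F s \<in> double_Hom s) \<and> (\<forall>s. s \<notin> S \<longrightarrow> F s = 0)}"
  define L where "L f s = (if s \<in> S then operator f s else 0)" for f s
  have op0: "operator f g x = 0" if "x \<notin> V" for f g x
    using that by (simp add: operator_def average_def)
  have op_Hom: "operator f s \<in> double_Hom s" if "s \<in> carrier G" for f s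
    using biequivariant_double_Hom[OF biequivariant_operator that] op0 by blast
  have lin: "clinear_on H L"
    by (rule clinear_onI; rule ext)
      (simp_all add: L_def operator_add operator_scale scaleC_fun_def[where 'a = 'g and 'b = "'v \<Rightarrow> 'v"])
  have inj: "inj_on L H"
  proof (rule clinear_on_inj_on[OF lin subspace_H])
    fix f assume f: "f \<in> H" "L f = 0"
    have "f g = 0" if g: "g \<in> carrier G" for g
    proof -
      \<comment> \<open>Any g is k s l with s in S, so biequivariance carries the vanishing of the
        operator from s to g, where f(g) is one of its coefficients up to a nonzero factor.\<close>
      obtain s where "s \<in> S" "g \<in> K <#> (s <# K)"
        using S g unfolding double_coset_representatives_def by blast
      then obtain k l where s: "s \<in> S" "k \<in> K" "l \<in> K" "g = k \<otimes> (s \<otimes> l)"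
        unfolding set_mult_def l_coset_def by blast
      have sG: "s \<in> carrier G" "s \<otimes> l \<in> carrier G" using s SG K_carrier by auto
      have "operator f s = 0" using fun_cong[OF f(2), of s] s(1) by (simp add: L_def)
      then have "operator f g v = act (inv l) 0"
        unfolding s(4)
        using biequivariant_left[OF biequivariant_operator sG(2) s(2) v_mem]
          biequivariant_right[OF biequivariant_operator sG(1) s(3) act_mem[OF K_inv[OF s(2)] v_mem]]
        by simp
      also have "\<dots> = 0" by (rule clinear_on_zero[OF act_linear[OF K_inv[OF s(3)]] \<theta>.subspace])
      finally have "ip (operator f g v) v = 0" using \<theta>.ip_zero_left[OF v_mem] by simp
      then show ?thesis using coefficient_operator[OF f(1) g] \<kappa>_nonzero by simp
    qed
    moreover have "f \<in> functions_on (carrier G)" using f(1) H_iff I_iff by blast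
    ultimately show "f = 0" by (auto simp: functions_on_def fun_eq_iff)
  qed
  have surj: "\<exists>f\<in>H. L f = F" if F: "F \<in> ?X" for F
  proof -
    obtain \<Phi> where \<Phi>: "biequivariant \<Phi>" "\<forall>s\<in>S. \<forall>x\<in>V. \<Phi> s x = F s x"
      using double_Hom_extend[OF S, of F] F by blast
    define f where "f = (\<lambda>g. if g \<in> carrier G then ip (\<Phi> g v) v else 0)"
    have fH: "f \<in> H" using coefficient_in_H[OF \<Phi>(1)] unfolding f_def .
    have op: "operator f s x = (\<kappa> * \<kappa>) *\<^sub>C F s x" if "s \<in> S" "x \<in> V" for s x
      using operator_coefficient[OF \<Phi>(1), of s x] \<Phi>(2) that SG unfolding f_def by auto
    \<comment> \<open>Passing to the coefficient and back multiplies by the square of \<kappa>,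
      which the scalar removes.\<close>
    have "L ((1 / (\<kappa> * \<kappa>)) *\<^sub>C f) s x = F s x" for s x
    proof (cases "s \<in> S \<and> x \<in> V")
      case True
      then show ?thesis
        using op \<kappa>_nonzero by (simp add: L_def operator_scale_apply scaleC_scaleC scaleC_one)
    next
      case False
      have "F s x = 0"
        using F False SG double_Hom_iff[of s "F s"] by (cases "s \<in> S") auto
      then show ?thesis
        using False op0 by (auto simp: L_def operator_scale_apply)
    qed
    then have "L ((1 / (\<kappa> * \<kappa>)) *\<^sub>C f) = F" by blast
    then show ?thesis using complex_vector.subspace_scale[OF subspace_H fH] by blast
  qed
  have LX: "L f \<in> ?X" for f
    using op_Hom SG by (auto simp: L_def)
  have "bij_betw L H ?X"
    unfolding bij_betw_def using inj LX surj by blast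
  then have "cdim ?X = cdim H" by (rule cdim_bij_betw[OF lin subspace_H fin_dim_H])
  \<comment> \<open>Each space of intertwiners lies in the image of H under evaluation at
    \<open>s\<close>; this gives the finiteness that \<open>cdim_supported_product\<close> asks
    for.\<close>
  moreover have "fin_dim (double_Hom s)" if s: "s \<in> S" for s
  proof -
    have "clinear_on H (\<lambda>f. L f s)"
      by (rule clinear_onI) (auto simp: L_def operator_add operator_scale)
    then have "fin_dim ((\<lambda>f. L f s) ` H)"
      by (rule fin_dim_image[OF _ subspace_H fin_dim_H])
    moreover have "double_Hom s \<subseteq> (\<lambda>f. L f s) ` H"
    proof
      fix T assume T: "T \<in> double_Hom s"
      have "(\<lambda>t. if t = s then T else 0) \<in> ?X"
        using T s SG complex_vector.subspace_0[OF subspace_double_Hom] by auto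
      from surj[OF this] obtain f where f: "f \<in> H" "L f = (\<lambda>t. if t = s then T else 0)" ..
      show "T \<in> (\<lambda>f. L f s) ` H"
        by (rule image_eqI[OF _ f(1)]) (simp add: f(2))
    qed
    ultimately show ?thesis by (rule fin_dim_subset)
  qed
  ultimately show ?thesis
    using cdim_supported_product[OF finS, of double_Hom] subspace_double_Hom SG by auto
qed

end

section \<open>Multiplicity-free decompositions\<close>

lemma internal_direct_sum_subset:
  assumes "internal_direct_sum X J U" "i \<in> J"
  shows "U i \<subseteq> X"
proof
  fix x assume x: "x \<in> U i"
  have U: "finite J" "\<And>i. i \<in> J \<Longrightarrow> csubspace (U i)" "X = {(\<Sum>i\<in>J. u i) |u. \<forall>i\<in>J. u i \<in> U i}"
    using assms(1) unfolding internal_direct_sum_def by blast+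
  have "(\<Sum>j\<in>J. if j = i then x else 0) = x" using U(1) assms(2) by simp
  moreover have "\<forall>j\<in>J. (if j = i then x else 0) \<in> U j"
    using x complex_vector.subspace_0[OF U(2)] by auto
  ultimately show "x \<in> X"
    unfolding U(3) by (intro CollectI exI[of _ "\<lambda>j. if j = i then x else 0"]) simp
qed

lemma internal_direct_sum_image:
  assumes ds: "internal_direct_sum X J U" and lin: "clinear_on X f" and X: "csubspace X"
    and inj: "inj_on f X"
  shows "internal_direct_sum (f ` X) J (\<lambda>i. f ` U i)"
proof -
  have U: "finite J" "\<And>i. i \<in> J \<Longrightarrow> csubspace (U i)" "X = {(\<Sum>i\<in>J. u i) |u. \<forall>i\<in>J. u i \<in> U i}"
    "\<And>u. \<forall>i\<in>J. u i \<in> U i \<Longrightarrow> (\<Sum>i\<in>J. u i) = 0 \<Longrightarrow> \<forall>i\<in>J. u i = 0"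
    using ds unfolding internal_direct_sum_def by blast+
  note UX = internal_direct_sum_subset[OF ds]
  have f_sum: "f (\<Sum>i\<in>J. u i) = (\<Sum>i\<in>J. f (u i))" if "\<forall>i\<in>J. u i \<in> U i" for u
    using that UX by (intro clinear_on_sum[OF lin X]) blast
  have f0: "f 0 = 0" by (rule clinear_on_zero[OF lin X])
  have lift: "\<exists>u. (\<forall>i\<in>J. u i \<in> U i) \<and> (\<forall>i\<in>J. w i = f (u i))" if "\<forall>i\<in>J. w i \<in> f ` U i" for w
  proof -
    have "\<forall>i\<in>J. \<exists>x. x \<in> U i \<and> w i = f x" using that by blast
    from bchoice[OF this] show ?thesis by blast
  qed
  have sub: "\<forall>i\<in>J. csubspace (f ` U i)"
    using clinear_on_image_subspace[OF clinear_on_subset[OF lin UX] U(2)] by blast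
  have "f ` X = {(\<Sum>i\<in>J. w i) |w. \<forall>i\<in>J. w i \<in> f ` U i}"
  proof (intro subset_antisym subsetI)
    fix y assume "y \<in> f ` X"
    then obtain u where u: "\<forall>i\<in>J. u i \<in> U i" "y = f (\<Sum>i\<in>J. u i)" unfolding U(3) by blast
    then show "y \<in> {(\<Sum>i\<in>J. w i) |w. \<forall>i\<in>J. w i \<in> f ` U i}"
      using f_sum[OF u(1)] by (intro CollectI exI[of _ "\<lambda>i. f (u i)"]) auto
  next
    fix y assume "y \<in> {(\<Sum>i\<in>J. w i) |w. \<forall>i\<in>J. w i \<in> f ` U i}"
    then obtain w where w: "\<forall>i\<in>J. w i \<in> f ` U i" "y = (\<Sum>i\<in>J. w i)" by blast
    obtain u where u: "\<forall>i\<in>J. u i \<in> U i" "\<forall>i\<in>J. w i = f (u i)" using lift[OF w(1)] by blast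
    have "y = f (\<Sum>i\<in>J. u i)" using f_sum[OF u(1)] u(2) w(2) by simp
    moreover have "(\<Sum>i\<in>J. u i) \<in> X" unfolding U(3) using u(1) by blast
    ultimately show "y \<in> f ` X" by blast
  qed
  moreover have "\<forall>i\<in>J. w i = 0" if w: "\<forall>i\<in>J. w i \<in> f ` U i" "(\<Sum>i\<in>J. w i) = 0" for w
  proof -
    obtain u where u: "\<forall>i\<in>J. u i \<in> U i" "\<forall>i\<in>J. w i = f (u i)" using lift[OF w(1)] by blast
    have "f (\<Sum>i\<in>J. u i) = f 0" using f_sum[OF u(1)] u(2) w(2) f0 by simp
    moreover have "(\<Sum>i\<in>J. u i) \<in> X" unfolding U(3) using u(1) by blast
    ultimately have "(\<Sum>i\<in>J. u i) = 0"
      using inj_onD[OF inj] complex_vector.subspace_0[OF X] by blast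
    then show ?thesis using U(4)[OF u(1)] u(2) f0 by simp
  qed
  ultimately show ?thesis unfolding internal_direct_sum_def using U(1) sub by blast
qed

text \<open>The source of surjectivity onto the functions on J. Acting by a scalar on each summand
  is equivariant because the summands are invariant.\<close>

lemma (in unitary_representation) intertwiner_of_scalars:
  assumes ds: "internal_direct_sum (rspace \<rho>) J U" and inv: "\<And>i. i \<in> J \<Longrightarrow> invariant_subspace G \<rho> (U i)"
  shows "\<exists>E. intertwiner G \<rho> \<rho> E \<and> (\<forall>i\<in>J. \<forall>x\<in>U i. E x = a i *\<^sub>C x)"
proof -
  have U: "finite J" "\<And>i. i \<in> J \<Longrightarrow> csubspace (U i)"
    "rspace \<rho> = {(\<Sum>i\<in>J. u i) |u. \<forall>i\<in>J. u i \<in> U i}"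
    "\<And>u. \<forall>i\<in>J. u i \<in> U i \<Longrightarrow> (\<Sum>i\<in>J. u i) = 0 \<Longrightarrow> \<forall>i\<in>J. u i = 0"
    using ds unfolding internal_direct_sum_def by blast+
  have UX: "U i \<subseteq> rspace \<rho>" if "i \<in> J" for i using inv[OF that] unfolding invariant_subspace_def by blast
  have "\<forall>x\<in>rspace \<rho>. \<exists>u. (\<forall>i\<in>J. u i \<in> U i) \<and> x = (\<Sum>i\<in>J. u i)"
    unfolding U(3) by blast
  then obtain p where p: "\<forall>x\<in>rspace \<rho>. (\<forall>i\<in>J. p x i \<in> U i) \<and> x = (\<Sum>i\<in>J. p x i)"
    by metis
  define E where "E x = (\<Sum>i\<in>J. a i *\<^sub>C p x i)" for x
  have sumU: "(\<Sum>i\<in>J. u i) \<in> rspace \<rho>" if "\<forall>i\<in>J. u i \<in> U i" for u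
    unfolding U(3) using that by blast
  \<comment> \<open>The components \<open>p x i\<close> are picked by choice but are unique, so
    \<open>E\<close> may be computed from any decomposition; each later property reduces to naming
    one.\<close>
  have E_sum: "E (\<Sum>i\<in>J. u i) = (\<Sum>i\<in>J. a i *\<^sub>C u i)" if u: "\<forall>i\<in>J. u i \<in> U i" for u
  proof -
    let ?x = "\<Sum>i\<in>J. u i"
    note px = bspec[OF p sumU[OF u]]
    have "\<forall>i\<in>J. p ?x i - u i \<in> U i" using px u complex_vector.subspace_diff[OF U(2)] by blast
    moreover have "(\<Sum>i\<in>J. p ?x i - u i) = 0" using px by (simp add: sum_subtractf)
    ultimately have "\<forall>i\<in>J. p ?x i - u i = 0" by (rule U(4))
    then show ?thesis unfolding E_def by simp
  qed
  have E_mem: "E x \<in> rspace \<rho>" if "x \<in> rspace \<rho>" for x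
    unfolding E_def using bspec[OF p that] complex_vector.subspace_scale[OF U(2)]
    by (intro sumU ballI) simp
  have "clinear_on (rspace \<rho>) E"
  proof (rule clinear_onI)
    fix x y assume x: "x \<in> rspace \<rho>" and y: "y \<in> rspace \<rho>"
    have "x + y = (\<Sum>i\<in>J. p x i) + (\<Sum>i\<in>J. p y i)" using bspec[OF p x] bspec[OF p y] by metis
    then have "x + y = (\<Sum>i\<in>J. p x i + p y i)" by (simp add: sum.distrib)
    moreover have "\<forall>i\<in>J. p x i + p y i \<in> U i"
      using bspec[OF p x] bspec[OF p y] complex_vector.subspace_add[OF U(2)] by blast
    ultimately show "E (x + y) = E x + E y"
      using E_sum[of "\<lambda>i. p x i + p y i"] by (simp add: E_def[of x] E_def[of y] scaleC_add_right sum.distrib)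
  next
    fix c x assume x: "x \<in> rspace \<rho>"
    have "c *\<^sub>C x = c *\<^sub>C (\<Sum>i\<in>J. p x i)" using bspec[OF p x] by metis
    then have "c *\<^sub>C x = (\<Sum>i\<in>J. c *\<^sub>C p x i)" by (simp add: complex_vector.scale_sum_right)
    moreover have "\<forall>i\<in>J. c *\<^sub>C p x i \<in> U i"
      using bspec[OF p x] complex_vector.subspace_scale[OF U(2)] by blast
    ultimately show "E (c *\<^sub>C x) = c *\<^sub>C E x"
      using E_sum[of "\<lambda>i. c *\<^sub>C p x i"]
      by (simp add: E_def[of x] complex_vector.scale_sum_right scaleC_scaleC mult.commute)
  qed
  moreover have "E (ract \<rho> g x) = ract \<rho> g (E x)" if g: "g \<in> carrier G" and x: "x \<in> rspace \<rho>" for g x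
  proof -
    have pU: "p x i \<in> U i" "p x i \<in> rspace \<rho>" if "i \<in> J" for i
      using bspec[OF p x] that UX by auto
    have "ract \<rho> g x = ract \<rho> g (\<Sum>i\<in>J. p x i)" using bspec[OF p x] by metis
    also have "\<dots> = (\<Sum>i\<in>J. ract \<rho> g (p x i))"
      by (rule clinear_on_sum[OF act_linear[OF g] subspace pU(2)])
    finally have "E (ract \<rho> g x) = (\<Sum>i\<in>J. a i *\<^sub>C ract \<rho> g (p x i))"
      using E_sum[of "\<lambda>i. ract \<rho> g (p x i)"] invariant_subspace_act[OF inv g] pU(1) by simp
    also have "\<dots> = (\<Sum>i\<in>J. ract \<rho> g (a i *\<^sub>C p x i))"
      using pU(2) by (intro sum.cong) (simp_all add: clinear_on_scale[OF act_linear[OF g]])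
    also have "\<dots> = ract \<rho> g (E x)"
      unfolding E_def using pU(2)
      by (intro clinear_on_sum[OF act_linear[OF g] subspace, symmetric] mem_scale)
    finally show ?thesis .
  qed
  ultimately have "intertwiner G \<rho> \<rho> E" unfolding intertwiner_def using E_mem by blast
  moreover have "E x = a i *\<^sub>C x" if i: "i \<in> J" and x: "x \<in> U i" for i x
  proof -
    let ?u = "\<lambda>j. if j = i then x else 0"
    have "\<forall>j\<in>J. ?u j \<in> U j" using x complex_vector.subspace_0[OF U(2)] by simp
    moreover have "(\<Sum>j\<in>J. ?u j) = x" using U(1) i by simp
    ultimately have "E x = (\<Sum>j\<in>J. a j *\<^sub>C ?u j)" using E_sum[of ?u] by simp
    also have "\<dots> = (\<Sum>j\<in>J. if j = i then a i *\<^sub>C x else 0)" by (intro sum.cong) auto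
    finally show ?thesis using U(1) i by simp
  qed
  ultimately show ?thesis by blast
qed

section \<open>Eigenvalues on the components\<close>

locale explicit_decomposition_setting = hecke_setting +
  fixes J :: "('a, 'w::complex_vector) urep set" and T :: "('a, 'w) urep \<Rightarrow> 'w \<Rightarrow> 'a \<Rightarrow> 'c"
  assumes multiplicity_free: "multiplicity_free G \<rho>"
    and irreducible_J: "\<sigma> \<in> J \<Longrightarrow> irreducible_rep G \<sigma>"
    and decomposition: "explicit_decomposition G \<rho> J T"
begin

abbreviation component :: "('a, 'w) urep \<Rightarrow> ('a \<Rightarrow> complex) set" where
  "component \<sigma> \<equiv> tv ` T \<sigma> ` rspace \<sigma>"

lemma direct_sum: "internal_direct_sum (rspace \<rho>) J (\<lambda>\<sigma>. T \<sigma> ` rspace \<sigma>)"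
  using decomposition unfolding explicit_decomposition_def by blast

lemma finite_J: "finite J"
  using direct_sum unfolding internal_direct_sum_def by blast

lemma direct_sum_I: "internal_direct_sum I J component"
  unfolding I_space_def by (rule internal_direct_sum_image[OF direct_sum tv_linear subspace_\<rho> tv_inj])

lemma intertwiner_T: "\<sigma> \<in> J \<Longrightarrow> intertwiner G \<sigma> \<rho> (T \<sigma>)"
  using decomposition rep_Hom_iff unfolding explicit_decomposition_def by blast

lemma T_inj:
  assumes "\<sigma> \<in> J"
  shows "inj_on (T \<sigma>) (rspace \<sigma>)"
proof -
  interpret \<sigma>: irreducible_representation G \<sigma> by unfold_locales (rule irreducible_J[OF assms])
  show ?thesis
  proof (rule clinear_on_inj_on[OF intertwiner_linear[OF intertwiner_T[OF assms]] \<sigma>.subspace])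
    fix x assume x: "x \<in> rspace \<sigma>" "T \<sigma> x = 0"
    have "rinner \<rho> (T \<sigma> x) (T \<sigma> x) = rinner \<sigma> x x"
      using decomposition assms x(1) unfolding explicit_decomposition_def by blast
    then have "rinner \<sigma> x x = 0" using x(2) \<rho>.ip_zero_left[OF \<rho>.mem_zero] by simp
    then show "x = 0" using \<sigma>.ip_self_eq_0[OF x(1)] by simp
  qed
qed

lemma irreducible_component:
  assumes "\<sigma> \<in> J"
  shows "invariant_subspace G \<rho> (T \<sigma> ` rspace \<sigma>)"
    and "irreducible_rep G (\<rho>\<lparr>rspace := T \<sigma> ` rspace \<sigma>\<rparr>)"
  using \<rho>.irreducible_image[OF irreducible_J intertwiner_T T_inj] assms by blast+

text \<open>This makes eigenvalues unique: only on a nonzero space does an operator determine the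
  scalar by which it acts.\<close>

lemma component_nonzero:
  assumes "\<sigma> \<in> J"
  obtains y where "y \<in> component \<sigma>" "y \<noteq> 0"
proof -
  interpret U: irreducible_representation G "\<rho>\<lparr>rspace := T \<sigma> ` rspace \<sigma>\<rparr>"
    by unfold_locales (rule irreducible_component(2)[OF assms])
  obtain F where F: "F \<in> T \<sigma> ` rspace \<sigma>" "F \<noteq> 0" using U.nonzero_vector by auto
  then have "F \<in> rspace \<rho>" using irreducible_component(1)[OF assms] unfolding invariant_subspace_def by blast
  then have "tv F \<noteq> 0"
    using inj_onD[OF tv_inj, of F 0] F(2) \<rho>.mem_zero clinear_on_zero[OF tv_linear subspace_\<rho>] by auto
  then show thesis using that F(1) by blast
qed

lemma component_subset: "\<sigma> \<in> J \<Longrightarrow> component \<sigma> \<subseteq> I"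
  by (rule internal_direct_sum_subset[OF direct_sum_I])

lemma eigenvalue_on_iff:
  assumes "\<sigma> \<in> J"
  shows "eigenvalue_on (T_conv G K \<theta> v f) (component \<sigma>) c \<longleftrightarrow>
    (\<forall>y\<in>component \<sigma>. gconv G y f = c *\<^sub>C y)"
proof -
  have "component \<sigma> \<noteq> {0}" using component_nonzero[OF assms] by (metis singletonD)
  moreover have "T_conv G K \<theta> v f y = gconv G y f" if "y \<in> component \<sigma>" for y
    unfolding T_conv_def by (rule restrict_apply') (use component_subset[OF assms] that in blast)
  ultimately show ?thesis unfolding eigenvalue_on_def by simp
qed

text \<open>The intertwiner belonging to f is a scalar on each irreducible summand because the
  induced representation is multiplicity-free, and \<open>tv\<close> turns it into right convolution
  by f.\<close>

lemma eigenvalue_exists: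
  assumes f: "f \<in> H" and \<sigma>: "\<sigma> \<in> J"
  shows "\<exists>c. eigenvalue_on (T_conv G K \<theta> v f) (component \<sigma>) c"
proof -
  obtain E where E: "intertwiner G \<rho> \<rho> E" "\<forall>F\<in>rspace \<rho>. tv (E F) = gconv G (tv F) f"
    using intertwiner_of_H[OF f] by blast
  obtain c where c: "\<forall>F\<in>T \<sigma> ` rspace \<sigma>. E F = c *\<^sub>C F"
    using \<rho>.multiplicity_free_scalar[OF multiplicity_free E(1) irreducible_component[OF \<sigma>]] by blast
  have "gconv G (tv F) f = c *\<^sub>C tv F" if "F \<in> T \<sigma> ` rspace \<sigma>" for F
  proof -
    have F: "F \<in> rspace \<rho>"
      using that irreducible_component(1)[OF \<sigma>] unfolding invariant_subspace_def by blast
    then have "gconv G (tv F) f = tv (E F)" using E(2) by simp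
    also have "\<dots> = tv (c *\<^sub>C F)" using bspec[OF c that] by (rule arg_cong)
    also have "\<dots> = c *\<^sub>C tv F" by (rule clinear_on_scale[OF tv_linear F])
    finally show ?thesis .
  qed
  then show ?thesis unfolding eigenvalue_on_iff[OF \<sigma>] by blast
qed

text \<open>Uniqueness of eigenvalues gives linearity and multiplicativity. Injectivity holds
  because the unit psi of H lies in the sum of the components, surjectivity because scalars on the
  summands can be prescribed.\<close>

lemma algebra_isomorphism_eigenvalues:
  assumes "\<forall>f\<in>H. \<forall>\<sigma>\<in>J. eigenvalue_on (T_conv G K \<theta> v f) (component \<sigma>) (lam \<sigma> f)"
  shows "algebra_isomorphism H (gconv G) (functions_on J) (\<lambda>a b \<sigma>. a \<sigma> * b \<sigma>)
    (\<lambda>f \<sigma>. if \<sigma> \<in> J then lam \<sigma> f else 0)" (is "algebra_isomorphism _ _ _ _ ?\<phi>")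
proof -
  have lam: "gconv G y f = lam \<sigma> f *\<^sub>C y" if "f \<in> H" "\<sigma> \<in> J" "y \<in> component \<sigma>" for f \<sigma> y
    using assms that eigenvalue_on_iff by blast
  have unique: "lam \<sigma> f = c"
    if f: "f \<in> H" and \<sigma>: "\<sigma> \<in> J" and c: "\<And>y. y \<in> component \<sigma> \<Longrightarrow> gconv G y f = c *\<^sub>C y" for f \<sigma> c
  proof -
    obtain y where y: "y \<in> component \<sigma>" "y \<noteq> 0" by (rule component_nonzero[OF \<sigma>])
    have "lam \<sigma> f *\<^sub>C y = c *\<^sub>C y" using lam[OF f \<sigma> y(1)] c[OF y(1)] by metis
    then show ?thesis using y(2) by simp
  qed
  have lin: "clinear_on H ?\<phi>"
  proof (rule clinear_onI)
    fix f g assume fg: "f \<in> H" "g \<in> H"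
    have "lam \<sigma> (f + g) = lam \<sigma> f + lam \<sigma> g" if \<sigma>: "\<sigma> \<in> J" for \<sigma>
      by (rule unique[OF complex_vector.subspace_add[OF subspace_H fg] \<sigma>])
        (simp add: gconv_add_right lam[OF _ \<sigma>] fg scaleC_add_left)
    then show "?\<phi> (f + g) = ?\<phi> f + ?\<phi> g" by (auto simp: fun_eq_iff)
  next
    fix c f assume f: "f \<in> H"
    have "lam \<sigma> (c *\<^sub>C f) = c * lam \<sigma> f" if \<sigma>: "\<sigma> \<in> J" for \<sigma>
      by (rule unique[OF complex_vector.subspace_scale[OF subspace_H f] \<sigma>])
        (simp add: gconv_scale_right lam[OF _ \<sigma>] f scaleC_scaleC)
    then show "?\<phi> (c *\<^sub>C f) = c *\<^sub>C ?\<phi> f"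
      by (auto simp: fun_eq_iff scaleC_fun_def[where 'b = complex] scaleC_complex_def)
  qed
  have mult: "?\<phi> (gconv G f g) = (\<lambda>\<sigma>. ?\<phi> f \<sigma> * ?\<phi> g \<sigma>)" if fg: "f \<in> H" "g \<in> H" for f g
  proof -
    \<comment> \<open>Right convolution by f * g applies f before g; on a common eigenspace the
      order is immaterial.\<close>
    have "lam \<sigma> (gconv G f g) = lam \<sigma> f * lam \<sigma> g" if \<sigma>: "\<sigma> \<in> J" for \<sigma>
      by (rule unique[OF gconv_in_H[OF fg] \<sigma>])
        (simp add: gconv_assoc[symmetric] lam[OF _ \<sigma>] fg gconv_scale_left scaleC_scaleC)
    then show ?thesis by (auto simp: fun_eq_iff)
  qed
  have inj: "inj_on ?\<phi> H"
  proof (rule clinear_on_inj_on[OF lin subspace_H])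
    fix f assume f: "f \<in> H" "?\<phi> f = 0"
    have lam0: "lam \<sigma> f = 0" if "\<sigma> \<in> J" for \<sigma>
      using fun_cong[OF f(2), of \<sigma>] that by simp
    have "I = {(\<Sum>\<sigma>\<in>J. u \<sigma>) |u. \<forall>\<sigma>\<in>J. u \<sigma> \<in> component \<sigma>}"
      using direct_sum_I unfolding internal_direct_sum_def by blast
    then obtain u where u: "\<forall>\<sigma>\<in>J. u \<sigma> \<in> component \<sigma>" "\<psi> = (\<Sum>\<sigma>\<in>J. u \<sigma>)"
      using \<psi>_in_I by blast
    have lin': "clinear_on UNIV (\<lambda>y. gconv G y f)"
      by (rule clinear_onI) (simp_all add: gconv_add_left gconv_scale_left)
    \<comment> \<open>f is recovered as psi * f, and right convolution by f kills every component of
      psi.\<close>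
    have "f = gconv G \<psi> f" using f(1) H_iff by simp
    also have "\<dots> = (\<Sum>\<sigma>\<in>J. gconv G (u \<sigma>) f)"
      unfolding u(2) by (rule clinear_on_sum[OF lin']) simp_all
    also have "\<dots> = 0"
      using lam[OF f(1)] lam0 u(1) by (intro sum.neutral) simp
    finally show "f = 0" .
  qed
  have surj: "\<exists>f\<in>H. ?\<phi> f = a" if a: "a \<in> functions_on J" for a
  proof -
    obtain E where E: "intertwiner G \<rho> \<rho> E" "\<forall>\<sigma>\<in>J. \<forall>F\<in>T \<sigma> ` rspace \<sigma>. E F = a \<sigma> *\<^sub>C F"
      using \<rho>.intertwiner_of_scalars[OF direct_sum irreducible_component(1)] by blast
    obtain f where f: "f \<in> H" "\<forall>F\<in>rspace \<rho>. tv (E F) = gconv G (tv F) f"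
      by (rule H_of_intertwiner[OF E(1)])
    have "lam \<sigma> f = a \<sigma>" if \<sigma>: "\<sigma> \<in> J" for \<sigma>
    proof (rule unique[OF f(1) \<sigma>])
      fix y assume "y \<in> component \<sigma>"
      then obtain F where F: "F \<in> T \<sigma> ` rspace \<sigma>" "y = tv F" by blast
      then have F': "F \<in> rspace \<rho>"
        using irreducible_component(1)[OF \<sigma>] unfolding invariant_subspace_def by blast
      have "gconv G y f = tv (a \<sigma> *\<^sub>C F)" using f(2) F F' E(2) \<sigma> by metis
      then show "gconv G y f = a \<sigma> *\<^sub>C y" using clinear_on_scale[OF tv_linear F'] F(2) by simp
    qed
    then have "?\<phi> f = a" using a by (auto simp: functions_on_def)
    then show ?thesis using f(1) by blast
  qed
  have "bij_betw ?\<phi> H (functions_on J)"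
    unfolding bij_betw_def using inj surj by (auto simp: functions_on_def)
  moreover have "csubspace (functions_on J)" by (rule csubspace_functions_on)
  ultimately show ?thesis
    unfolding algebra_isomorphism_def
    using subspace_H gconv_in_H lin mult by (simp add: functions_on_def)
qed

text \<open>The isomorphism is applied to an arbitrary choice of eigenvalues, merely to transport
  the dimension.\<close>

lemma cdim_H: "cdim H = card J"
proof -
  define lam where "lam \<sigma> f = (SOME c. eigenvalue_on (T_conv G K \<theta> v f) (component \<sigma>) c)" for \<sigma> f
  have "\<forall>f\<in>H. \<forall>\<sigma>\<in>J. eigenvalue_on (T_conv G K \<theta> v f) (component \<sigma>) (lam \<sigma> f)"
    unfolding lam_def using someI_ex[OF eigenvalue_exists] by blast
  then have "algebra_isomorphism H (gconv G) (functions_on J) (\<lambda>a b \<sigma>. a \<sigma> * b \<sigma>)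
      (\<lambda>f \<sigma>. if \<sigma> \<in> J then lam \<sigma> f else 0)"
    by (rule algebra_isomorphism_eigenvalues)
  then have "cdim (functions_on J) = cdim H"
    unfolding algebra_isomorphism_def using cdim_bij_betw[OF _ subspace_H fin_dim_H] by blast
  then show ?thesis using cdim_functions_on[OF finite_J] by simp
qed

end

text \<open>Eigenvalues enter through an arbitrary function \<open>lam\<close> with the eigenvalue
  property, next to a separate claim of existence, so that no choice is built into the statement.
  Cutting off outside J places the image in \<open>functions_on J\<close>, which stands for the
  algebra of J-tuples.\<close>

theorem theorem4p1:
  fixes G :: "('g, 'm) monoid_scheme" and K :: "'g set"
    and \<theta> :: "('g, 'v::complex_vector) urep" and v :: 'v
  assumes "group G" and "finite (carrier G)" and "subgroup K G"
    and "irreducible_rep (G\<lparr>carrier := K\<rparr>) \<theta>"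
    and "v \<in> rspace \<theta>" and "rnorm \<theta> v = 1"
  shows "(multiplicity_free G (ind_rep G K \<theta>) \<longleftrightarrow>
          commutative_on (gconv G) (hecke_algebra G K (hecke_psi K \<theta> v)))
    \<and> (multiplicity_free G (ind_rep G K \<theta>) \<or>
          commutative_on (gconv G) (hecke_algebra G K (hecke_psi K \<theta> v)) \<longrightarrow>
        (\<forall>(J :: ('g, 'w::complex_vector) urep set) T.
          complete_constituents G (ind_rep G K \<theta>) J \<and>
          explicit_decomposition G (ind_rep G K \<theta>) J T \<longrightarrow>
            internal_direct_sum (I_space G K \<theta> v) J (\<lambda>\<sigma>. T_vec G K \<theta> v ` T \<sigma> ` rspace \<sigma>)
          \<and> (\<forall>f\<in>hecke_algebra G K (hecke_psi K \<theta> v). \<forall>\<sigma>\<in>J.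
               \<exists>c. eigenvalue_on (T_conv G K \<theta> v f) (T_vec G K \<theta> v ` T \<sigma> ` rspace \<sigma>) c)
          \<and> (\<forall>lam :: ('g, 'w) urep \<Rightarrow> ('g \<Rightarrow> complex) \<Rightarrow> complex.
               (\<forall>f\<in>hecke_algebra G K (hecke_psi K \<theta> v). \<forall>\<sigma>\<in>J.
                  eigenvalue_on (T_conv G K \<theta> v f) (T_vec G K \<theta> v ` T \<sigma> ` rspace \<sigma>) (lam \<sigma> f)) \<longrightarrow>
               algebra_isomorphism
                 (hecke_algebra G K (hecke_psi K \<theta> v)) (gconv G)
                 (functions_on J) (\<lambda>a b \<sigma>. a \<sigma> * b \<sigma>)
                 (\<lambda>f \<sigma>. if \<sigma> \<in> J then lam \<sigma> f else 0))
          \<and> complex_vector.dim (hecke_algebra G K (hecke_psi K \<theta> v)) = card J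
          \<and> (\<forall>S. double_coset_representatives G K S \<longrightarrow>
               card J = (\<Sum>s\<in>S. complex_vector.dim
                 (rep_Hom (G\<lparr>carrier := conj_inter G K s\<rparr>) \<theta> (conj_rep G s \<theta>))))))"
proof -
  interpret hecke_setting G K \<theta> v
    using assms by (simp add: hecke_setting_def hecke_setting_axioms_def)
  show ?thesis
  proof (intro conjI impI allI; (elim conjE)?)
    show "multiplicity_free G \<rho> \<longleftrightarrow> commutative_on (gconv G) H"
      by (rule multiplicity_free_iff_commutative)
  next
    fix J :: "('g, 'w) urep set" and T
    assume "multiplicity_free G \<rho> \<or> commutative_on (gconv G) H"
      and J: "complete_constituents G \<rho> J" "explicit_decomposition G \<rho> J T"
    then have mf: "multiplicity_free G \<rho>" using multiplicity_free_iff_commutative by blast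
    interpret explicit_decomposition_setting G K \<theta> v J T
      using J mf by unfold_locales (auto simp: complete_constituents_def)
    show "internal_direct_sum I J component" by (rule direct_sum_I)
    show "\<forall>f\<in>H. \<forall>\<sigma>\<in>J. \<exists>c. eigenvalue_on (T_conv G K \<theta> v f) (component \<sigma>) c"
      using eigenvalue_exists by blast
    show "cdim H = card J" by (rule cdim_H)
    show "algebra_isomorphism H (gconv G) (functions_on J) (\<lambda>a b \<sigma>. a \<sigma> * b \<sigma>)
        (\<lambda>f \<sigma>. if \<sigma> \<in> J then lam \<sigma> f else 0)"
      if "\<forall>f\<in>H. \<forall>\<sigma>\<in>J. eigenvalue_on (T_conv G K \<theta> v f) (component \<sigma>) (lam \<sigma> f)" for lam
      using that by (rule algebra_isomorphism_eigenvalues)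
    show "card J = (\<Sum>s\<in>S. cdim (double_Hom s))" if "double_coset_representatives G K S" for S
      \<comment> \<open>Both numbers are the dimension of the Hecke algebra.\<close>
      using cdim_hecke_algebra_double_cosets[OF that] cdim_H by simp
  qed
qed

end
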